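(* Let $u\ge 3$ be an integer. If $r\ge\max\{7u-5,u^2-1\}$ is an integer, then $h(r,u,1)\le u(r+1)$. Moreover, if in addition there exists an orthogonal array $OA(u+1,r+1)$, then $h(r,u,1)=u(r+1)$.
   Context: A hypergraph $H=(V,E)$ consists of a finite vertex set $V$ and a set $E$ of subsets of $V$ (edges), each of size at least 2 (no repeated edges). It is $u$-uniform if every edge has exactly $u$ vertices and $r$-regular if every vertex is in exactly $r$ edges. A walk of length $p$ is a sequence $(x_0,e_1,x_1,\ldots,e_p,x_p)$ of vertices and edges with $x_{i-1},x_i\in e_i$, $x_{i-1}\ne x_i$; $H$ is connected if any two vertices are joined by a walk. The girth is the minimum length of a Berge cycle (a walk with $x_0=x_p$ with all edges distinct and all vertices distinct except $x_0=x_p$); girth at least 3 means any two distinct vertices lie in at most one common edge. The adjacency matrix has entries $A_{xy}=|\{e\in E:\{x,y\}\subset e\}|$ for $x\neq y$ and $A_{xx}=0$; the eigenvalues of $H$ are those of $A$, and the second eigenvalue is the second largest one (with multiplicity). All hypergraphs are assumed connected with girth at least 3. $h(r,u,\theta)$ denotes the maximum order (number of vertices) of such an $r$-regular $u$-uniform hypergraph whose second eigenvalue is at most $\theta$ ($-\infty$ if there is none). An orthogonal array $OA(m,s)$ is an $m\times s^2$ array with entries from an $s$-element set $S$ such that in any two rows each ordered pair of symbols of $S$ occurs in exactly one column. *)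

theory Defs
  imports
    "Jordan_Normal_Form.Char_Poly"
    "HOL-Library.Multiset"
    "HOL-Library.Extended_Nat"
    "HOL-Library.Extended_Real"
begin

definition hypergraph :: "'a set \<Rightarrow> 'a set set \<Rightarrow> bool" where
  "hypergraph V E \<longleftrightarrow> finite V \<and> (\<forall>e\<in>E. e \<subseteq> V \<and> 2 \<le> card e)"

definition uniform :: "nat \<Rightarrow> 'a set set \<Rightarrow> bool" where
  "uniform u E \<longleftrightarrow> (\<forall>e\<in>E. card e = u)"

definition regular :: "nat \<Rightarrow> 'a set \<Rightarrow> 'a set set \<Rightarrow> bool" where
  "regular r V E \<longleftrightarrow> (\<forall>x\<in>V. card {e\<in>E. x \<in> e} = r)"

text \<open>The walk \<open>(x\<^sub>0, e\<^sub>1, x\<^sub>1, \<dots>, e\<^sub>p, x\<^sub>p)\<close> is given by the lists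
  \<open>xs = [x\<^sub>0, \<dots>, x\<^sub>p]\<close> and \<open>es = [e\<^sub>1, \<dots>, e\<^sub>p]\<close>; thus \<open>es ! i\<close> is \<open>e\<close> with index \<open>i + 1\<close>.
  Its length is \<open>length es\<close>.\<close>

definition walk :: "'a set \<Rightarrow> 'a set set \<Rightarrow> 'a list \<Rightarrow> 'a set list \<Rightarrow> bool" where
  "walk V E xs es \<longleftrightarrow>
     length xs = length es + 1 \<and> set xs \<subseteq> V \<and> set es \<subseteq> E \<and>
     (\<forall>i<length es. xs ! i \<in> es ! i \<and> xs ! Suc i \<in> es ! i \<and> xs ! i \<noteq> xs ! Suc i)"

definition connected_hypergraph :: "'a set \<Rightarrow> 'a set set \<Rightarrow> bool" where
  "connected_hypergraph V E \<longleftrightarrow>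
     (\<forall>x\<in>V. \<forall>y\<in>V. \<exists>xs es. walk V E xs es \<and> hd xs = x \<and> last xs = y)"

text \<open>The trivial walk of length 0 is not a cycle.\<close>

definition Berge_cycle :: "'a set \<Rightarrow> 'a set set \<Rightarrow> 'a list \<Rightarrow> 'a set list \<Rightarrow> bool" where
  "Berge_cycle V E xs es \<longleftrightarrow>
     walk V E xs es \<and> es \<noteq> [] \<and> hd xs = last xs \<and> distinct es \<and> distinct (tl xs)"

text \<open>The girth is \<open>\<infinity>\<close> if there is no Berge cycle.\<close>

definition girth :: "'a set \<Rightarrow> 'a set set \<Rightarrow> enat" where
  "girth V E = Inf {enat (length es) | xs es. Berge_cycle V E xs es}"

definition adjacency :: "'a set set \<Rightarrow> 'a \<Rightarrow> 'a \<Rightarrow> nat" where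
  "adjacency E x y = (if x = y then 0 else card {e\<in>E. {x, y} \<subseteq> e})"

text \<open>Rows and columns are indexed by the vertices in increasing order; the choice of the
  enumeration does not affect the characteristic polynomial.\<close>

definition adjacency_mat :: "'a::linorder set \<Rightarrow> 'a set set \<Rightarrow> real mat" where
  "adjacency_mat V E = mat (card V) (card V)
     (\<lambda>(i, j). real (adjacency E (sorted_list_of_set V ! i) (sorted_list_of_set V ! j)))"

text \<open>As the adjacency matrix is real and symmetric, all complex roots of its characteristic
  polynomial are real, so this multiset has \<open>card V\<close> elements.\<close>

definition eigenvalues_mset :: "'a::linorder set \<Rightarrow> 'a set set \<Rightarrow> real multiset" where
  "eigenvalues_mset V E = proots (char_poly (adjacency_mat V E))"

text \<open>The second largest eigenvalue, counted with multiplicity; meaningful only if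
  \<open>card V \<ge> 2\<close>.\<close>

definition second_eigenvalue :: "'a::linorder set \<Rightarrow> 'a set set \<Rightarrow> real" where
  "second_eigenvalue V E = rev (sorted_list_of_multiset (eigenvalues_mset V E)) ! 1"

text \<open>Every finite hypergraph is isomorphic to one on a set of natural numbers, so it suffices
  to range over those. The condition \<open>card V \<ge> 2\<close> makes the second eigenvalue exist. In the
  extended reals the supremum of the empty set is \<open>-\<infinity>\<close>, and a finite supremum of a
  nonempty set of natural numbers is its maximum.\<close>

definition h :: "nat \<Rightarrow> nat \<Rightarrow> real \<Rightarrow> ereal" where
  "h r u \<theta> = Sup {ereal (real (card V)) | (V :: nat set) E.
     hypergraph V E \<and> connected_hypergraph V E \<and> 3 \<le> girth V E \<and>
     regular r V E \<and> uniform u E \<and> 2 \<le> card V \<and> second_eigenvalue V E \<le> \<theta>}"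

definition orthogonal_array :: "nat \<Rightarrow> nat \<Rightarrow> 'b set \<Rightarrow> 'b mat \<Rightarrow> bool" where
  "orthogonal_array m s S M \<longleftrightarrow>
     finite S \<and> card S = s \<and> M \<in> carrier_mat m (s\<^sup>2) \<and> elements_mat M \<subseteq> S \<and>
     (\<forall>i<m. \<forall>i'<m. i \<noteq> i' \<longrightarrow>
       (\<forall>a\<in>S. \<forall>b\<in>S. \<exists>!j. j < s\<^sup>2 \<and> M $$ (i, j) = a \<and> M $$ (i', j) = b))"

end

theory Submission
  imports Defs "HOL-Analysis.Inner_Product" "HOL-Analysis.Function_Topology"
begin

text \<open>If the second eigenvalue is at most 1, then the complement \<open>D\<close> of the collinearity graph is regular
  with least eigenvalue at least \<open>-2\<close>, so its vertices are represented by vectors of norm 2 with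
  inner products 0 and 1, and regularity provides a vector \<open>\<tau>\<close> having inner product 1 with all of
  them. Thus a combination of norm 0 has coefficient sum 0. Instead of invoking the classification of
  such graphs, one uses this observation to show that with more than \<open>u (r + 1)\<close> vertices no
  neighbourhood in \<open>D\<close> contains three independent vertices or an induced pentagon; then every closed
  neighbourhood is a union of two cliques, one of them large. Large maximal cliques are disjoint, a
  vertex outside has at most one neighbour in such a clique, and as an edge of the hypergraph meets a
  clique of \<open>D\<close> at most once, a clique contains at most a fraction \<open>1 / u\<close> of the vertices. Counting
  the edges of \<open>D\<close> that leave a maximal clique now gives a contradiction. Equality is attained by the
  transversal design of an orthogonal array with one parallel class deleted.\<close>

text \<open>Most small configurations are refuted by one explicit combination of their vectors,
  whose squared norm is negative, or is 0 while the coefficients do not sum to 0. These combinations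
  typically arise by projecting vertices off the span of a clique, a nonadjacent pair or a pentagon
  and clearing denominators. A claw is treated differently: it forces \<open>\<tau>\<close> to be a
  short combination of the claw itself, which bounds the order by 28 = 4 + 3 * 8. The origin of
  \<open>u * (r + 1)\<close> is the last count. Put s = r + 1 and n = u s + t, so that d + 2 = u + s
  + t. If every vertex outside a maximal clique of size a has at most one neighbour in it, then a (d
  + 2 - a) \<le> n. The left side decreases on (d + 2) / 2 \<le> a \<le> n / u, so its value at n /
  u is also at most n, and this says t (u - 1) \<le> 0. The main obstacle is to pass from two
  neighbours in the clique to one: this needs cliques slightly larger than half of d, and there r
  must be large compared with u.\<close>

no_notation scalar_prod (infix "\<bullet>" 70)
unbundle inner_syntax

section \<open>Graphs represented by vectors of norm 2\<close>

text \<open>Up to sign the \<open>q y\<close> are orthonormal, and each line carries at most two of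
  them. By Bessel, the unit vector \<open>g\<close> makes cosine 1/2 with at most four orthogonal
  lines. The proof applies Cauchy--Schwarz to \<open>g\<close> and the sum \<open>c\<close> of the
  \<open>q y\<close>, signed to point towards \<open>g\<close>.\<close>

lemma card_le_8_of_frame:
  fixes q :: "'b \<Rightarrow> 'v::real_inner" and g :: 'v
  assumes fin: "finite F"
    and self: "\<And>y. y \<in> F \<Longrightarrow> q y \<bullet> q y = 1"
    and inj: "inj_on q F"
    and prods: "\<And>y z. y \<in> F \<Longrightarrow> z \<in> F \<Longrightarrow> y \<noteq> z \<Longrightarrow> q y \<bullet> q z = 0 \<or> q y \<bullet> q z = - 1"
    and g: "g \<bullet> g = 1" "\<And>y. y \<in> F \<Longrightarrow> \<bar>g \<bullet> q y\<bar> = 1/2"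
  shows "card F \<le> 8"
proof -
  define \<sigma> where "\<sigma> y = 2 * (g \<bullet> q y)" for y
  have \<sigma>: "\<bar>\<sigma> y\<bar> = 1" if "y \<in> F" for y
    using g(2)[OF that] by (simp add: \<sigma>_def abs_mult)
  define c where "c = (\<Sum>y\<in>F. \<sigma> y *\<^sub>R q y)"
  have gc: "g \<bullet> c = card F / 2"
  proof -
    have "g \<bullet> c = (\<Sum>y\<in>F. \<sigma> y * (g \<bullet> q y))"
      by (simp add: c_def inner_sum_right)
    also have "\<dots> = (\<Sum>y\<in>F. 1/2)"
    proof (rule sum.cong[OF refl])
      fix y assume y: "y \<in> F"
      have "\<sigma> y * (g \<bullet> q y) = 2 * (\<bar>g \<bullet> q y\<bar>)\<^sup>2" by (simp add: \<sigma>_def power2_eq_square)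
      also have "\<dots> = 1/2" using g(2)[OF y] by (simp only:) (simp add: power2_eq_square)
      finally show "\<sigma> y * (g \<bullet> q y) = 1/2" .
    qed
    finally show ?thesis by simp
  qed
  have opp: "q z = - q y" if "y \<in> F" "z \<in> F" "q y \<bullet> q z = - 1" for y z
  proof -
    have "(q y + q z) \<bullet> (q y + q z) = 0"
      using self[OF that(1)] self[OF that(2)] that(3) by (simp add: inner_simps inner_commute)
    then show ?thesis by (simp add: add_eq_0_iff)
  qed
  have row: "(\<Sum>z\<in>F. \<sigma> y * \<sigma> z * (q y \<bullet> q z)) \<le> 2" if y: "y \<in> F" for y
  proof -
    let ?S = "{z\<in>F. q y \<bullet> q z = - 1}"
    have card1: "card ?S \<le> 1"
    proof (rule card_le_Suc0_iff_eq[THEN iffD2, unfolded One_nat_def[symmetric]])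
      show "finite ?S" using fin by simp
      show "\<forall>a\<in>?S. \<forall>b\<in>?S. a = b"
        using opp[OF y] inj by (metis (mono_tags, lifting) inj_onD mem_Collect_eq)
    qed
    have "(\<Sum>z\<in>F. \<sigma> y * \<sigma> z * (q y \<bullet> q z)) \<le> (\<Sum>z\<in>F. (if z = y then 1 else 0) + (if z \<in> ?S then 1 else 0))"
    proof (rule sum_mono)
      fix z assume z: "z \<in> F"
      have s: "\<bar>\<sigma> y * \<sigma> z\<bar> = 1" using \<sigma>[OF y] \<sigma>[OF z] by (simp add: abs_mult)
      show "\<sigma> y * \<sigma> z * (q y \<bullet> q z) \<le> (if z = y then 1 else 0) + (if z \<in> ?S then 1 else 0)"
      proof (cases "z = y")
        case True then show ?thesis using s self[OF y] by (auto simp: abs_if split: if_splits)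
      next
        case False
        then have "q y \<bullet> q z = 0 \<or> q y \<bullet> q z = - 1" using prods y z by auto
        then show ?thesis using s z False by (auto simp: abs_if split: if_splits)
      qed
    qed
    also have "\<dots> = 1 + card ?S"
      using fin y by (simp add: sum.distrib sum.If_cases Int_absorb1 Collect_conj_eq Int_commute)
    also have "\<dots> \<le> 2" using card1 by simp
    finally show ?thesis .
  qed
  have cc: "c \<bullet> c \<le> 2 * card F"
  proof -
    have "c \<bullet> c = (\<Sum>y\<in>F. \<Sum>z\<in>F. \<sigma> y * \<sigma> z * (q y \<bullet> q z))"
      by (simp add: c_def inner_sum_left inner_sum_right sum_distrib_left mult_ac inner_commute)
    also have "\<dots> \<le> (\<Sum>y\<in>F. 2)" by (rule sum_mono) (rule row)
    finally show ?thesis by simp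
  qed
  have "(g \<bullet> c)\<^sup>2 \<le> (g \<bullet> g) * (c \<bullet> c)" by (rule Cauchy_Schwarz_ineq)
  then have "(card F / 2)\<^sup>2 \<le> 2 * card F" using gc g(1) cc by simp
  then have "real (card F) * card F \<le> 8 * card F" by (simp add: power2_eq_square)
  then show ?thesis by (cases "card F = 0") auto
qed

text \<open>On the span of the orthogonal vectors \<open>a\<close>, \<open>b\<close>,
  \<open>c\<close>, every \<open>f z\<close> projects to (a + b) / 2 and \<open>g\<close>, taken
  from another pillar, to (a + c) / 2. All residuals are unit vectors. Projecting lowers inner
  products within the pillar by 1 and those with \<open>g\<close> by 1/2, which gives exactly the
  values of \<open>card_le_8_of_frame\<close>.\<close>

lemma pillar_card_le_8:
  fixes f :: "'b \<Rightarrow> 'v::real_inner"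
  assumes fin: "finite F"
    and f: "\<And>z. z \<in> F \<Longrightarrow> f z \<bullet> f z = 2" "\<And>z. z \<in> F \<Longrightarrow> f z \<bullet> a = 1"
      "\<And>z. z \<in> F \<Longrightarrow> f z \<bullet> b = 1" "\<And>z. z \<in> F \<Longrightarrow> f z \<bullet> c = 0"
    and prods: "\<And>y z. y \<in> F \<Longrightarrow> z \<in> F \<Longrightarrow> y \<noteq> z \<Longrightarrow> f y \<bullet> f z = 0 \<or> f y \<bullet> f z = 1"
    and abc: "a \<bullet> a = 2" "b \<bullet> b = 2" "c \<bullet> c = 2" "a \<bullet> b = 0" "a \<bullet> c = 0" "b \<bullet> c = 0"
    and g: "g \<bullet> g = 2" "g \<bullet> a = 1" "g \<bullet> b = 0" "g \<bullet> c = 1"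
      "\<And>z. z \<in> F \<Longrightarrow> g \<bullet> f z = 0 \<or> g \<bullet> f z = 1"
  shows "card F \<le> 8"
proof (rule card_le_8_of_frame[OF fin])
  let ?q = "\<lambda>z. f z - (1/2) *\<^sub>R (a + b)"
  let ?g = "g - (1/2) *\<^sub>R (a + c)"
  have swap: "a \<bullet> f z = f z \<bullet> a" "b \<bullet> f z = f z \<bullet> b" "c \<bullet> f z = f z \<bullet> c"
    "a \<bullet> g = g \<bullet> a" "b \<bullet> g = g \<bullet> b" "c \<bullet> g = g \<bullet> c" "b \<bullet> a = a \<bullet> b" "c \<bullet> a = a \<bullet> c" "c \<bullet> b = b \<bullet> c" for z
    by (simp_all add: inner_commute)
  show "?q y \<bullet> ?q y = 1" if "y \<in> F" for y using that f abc swap by (simp add: inner_simps)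
  have qq: "?q y \<bullet> ?q z = f y \<bullet> f z - 1" if "y \<in> F" "z \<in> F" for y z
    using that f abc swap by (simp add: inner_simps)
  show "?q y \<bullet> ?q z = 0 \<or> ?q y \<bullet> ?q z = - 1" if "y \<in> F" "z \<in> F" "y \<noteq> z" for y z
    using qq[OF that(1,2)] prods[OF that] by auto
  show "inj_on ?q F"
  proof (rule inj_onI, rule ccontr)
    fix y z assume "y \<in> F" "z \<in> F" "?q y = ?q z" "y \<noteq> z"
    then show False using prods[of y z] f(1)[of y] by auto
  qed
  show "?g \<bullet> ?g = 1" using g abc swap by (simp add: inner_simps)
  show "\<bar>?g \<bullet> ?q y\<bar> = 1 / 2" if "y \<in> F" for y
    using g(1-4) g(5)[OF that] f[OF that] abc swap by (auto simp add: inner_simps)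
qed

text \<open>\<open>sum_phi\<close> expresses \<open>\<tau>\<close> as a multiple of the sum of all
  vectors, which lets \<open>zero_one_projection\<close> count vertices by an inner product.
  Connectedness is stated through sets closed under adjacency, the form in which it is both proved
  and applied.\<close>

locale root_graph =
  fixes V :: "'a set" and D :: "'a \<Rightarrow> 'a \<Rightarrow> bool" and \<phi> :: "'a \<Rightarrow> 'v::real_inner"
    and \<tau> :: 'v and d :: nat
  assumes finV: "finite V"
    and D_commute: "D x y \<longleftrightarrow> D y x"
    and D_irrefl: "\<not> D x x"
    and ip: "x \<in> V \<Longrightarrow> y \<in> V \<Longrightarrow> \<phi> x \<bullet> \<phi> y = (if x = y then 2 else if D x y then 1 else 0)"
    and deg: "x \<in> V \<Longrightarrow> card {y\<in>V. D x y} = d"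
    and tau: "x \<in> V \<Longrightarrow> \<tau> \<bullet> \<phi> x = 1"
    and sum_phi: "(\<Sum>x\<in>V. \<phi> x) = (real d + 2) *\<^sub>R \<tau>"
    and conn: "X \<subseteq> V \<Longrightarrow> X \<noteq> {} \<Longrightarrow> (\<And>x y. x \<in> X \<Longrightarrow> y \<in> V \<Longrightarrow> D x y \<Longrightarrow> y \<in> X) \<Longrightarrow> X = V"
begin

lemma phi_inj: "x \<in> V \<Longrightarrow> y \<in> V \<Longrightarrow> \<phi> x = \<phi> y \<Longrightarrow> x = y"
  using ip[of x y] ip[of y y] by (auto split: if_splits)

text \<open>The alternating sum around an induced four-cycle has squared norm 8 - 8 = 0. Hence three
  of its vertices determine the fourth.\<close>

lemma four_cycle:
  assumes V: "a \<in> V" "b \<in> V" "c \<in> V" "e \<in> V"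
    and D: "\<not> D a b" "\<not> D c e" "D a c" "D a e" "D b c" "D b e" "a \<noteq> b" "c \<noteq> e"
  shows "\<phi> a + \<phi> b = \<phi> c + \<phi> e"
proof -
  have ne: "a \<noteq> c" "a \<noteq> e" "b \<noteq> c" "b \<noteq> e" using D D_irrefl by auto
  have D': "D c a" "D e a" "D c b" "D e b" "\<not> D b a" "\<not> D e c" using D D_commute by auto
  have "(\<phi> a + \<phi> b - \<phi> c - \<phi> e) \<bullet> (\<phi> a + \<phi> b - \<phi> c - \<phi> e) = 0"
    using V D ne D' by (simp add: inner_simps ip)
  then have "\<phi> a + \<phi> b - \<phi> c - \<phi> e = 0" by (simp only: inner_eq_zero_iff)
  then show ?thesis by (simp add: algebra_simps)
qed

text \<open>Weight 2 at the centre and -1 at the four leaves is the null vector of the affine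
  diagram D4; its weights sum to -2.\<close>

lemma no_four_claw:
  assumes V: "x \<in> V" "a \<in> V" "b \<in> V" "c \<in> V" "e \<in> V"
    and D: "D x a" "D x b" "D x c" "D x e"
    "\<not> D a b" "\<not> D a c" "\<not> D a e" "\<not> D b c" "\<not> D b e" "\<not> D c e"
    and ne: "a \<noteq> b" "a \<noteq> c" "a \<noteq> e" "b \<noteq> c" "b \<noteq> e" "c \<noteq> e"
  shows False
proof -
  have ne': "x \<noteq> a" "x \<noteq> b" "x \<noteq> c" "x \<noteq> e" using D D_irrefl by auto
  have D': "D a x" "D b x" "D c x" "D e x"
    "\<not> D b a" "\<not> D c a" "\<not> D e a" "\<not> D c b" "\<not> D e b" "\<not> D e c" using D D_commute by auto
  let ?w = "2 *\<^sub>R \<phi> x - \<phi> a - \<phi> b - \<phi> c - \<phi> e"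
  have "?w \<bullet> ?w = 0" using V D ne ne' D' by (simp add: inner_simps ip)
  then have "?w = 0" by (simp only: inner_eq_zero_iff)
  then have "\<tau> \<bullet> ?w = 0" by simp
  then show False using V by (simp add: inner_simps tau)
qed

definition nbrs :: "'a \<Rightarrow> 'a set" where "nbrs x = {y\<in>V. D x y}"

lemma finite_nbrs [simp]: "finite (nbrs x)" by (simp add: nbrs_def finV)

lemma card_nbrs: "x \<in> V \<Longrightarrow> card (nbrs x) = d" by (simp add: nbrs_def deg)

text \<open>By Cauchy--Schwarz, applied to \<open>t\<close> and the sum of the \<open>\<phi> z\<close> with \<open>t \<bullet> \<phi> z = 1\<close>, these vertices
  have all their neighbours among themselves, so connectedness leaves no room for them.\<close>

lemma zero_one_projection:
  assumes t: "\<And>z. z \<in> V \<Longrightarrow> t \<bullet> \<phi> z = 0 \<or> t \<bullet> \<phi> z = 1"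
    and tt: "t \<bullet> t = t \<bullet> \<tau>" and x: "x \<in> V" "t \<bullet> \<phi> x = 0"
  shows "t = 0"
proof -
  define Z where "Z = {z\<in>V. t \<bullet> \<phi> z = 1}"
  have finZ: "finite Z" and ZV: "Z \<subseteq> V" using finV by (auto simp: Z_def)
  have jN: "(real d + 2) * (t \<bullet> t) = card Z"
  proof -
    have "(real d + 2) * (t \<bullet> t) = t \<bullet> (\<Sum>x\<in>V. \<phi> x)" by (simp add: sum_phi tt)
    also have "\<dots> = (\<Sum>x\<in>V. if x \<in> Z then 1 else 0)" unfolding inner_sum_right
      by (rule sum.cong) (use t in \<open>auto simp: Z_def\<close>)
    also have "\<dots> = card Z" using finV ZV by (simp add: sum.If_cases Int_absorb1)
    finally show ?thesis .
  qed
  define m where "m z = card (nbrs z \<inter> Z)" for z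
  have md: "m z \<le> d" if "z \<in> Z" for z
    using card_mono[OF finite_nbrs, of "nbrs z \<inter> Z" z] card_nbrs[of z] that ZV by (auto simp: m_def)
  define S where "S = (\<Sum>z\<in>Z. \<phi> z)"
  have tS: "t \<bullet> S = card Z" unfolding S_def inner_sum_right by (simp add: Z_def)
  have SS: "S \<bullet> S = (\<Sum>z\<in>Z. 2 + real (m z))"
  proof -
    have "S \<bullet> S = (\<Sum>z\<in>Z. \<Sum>y\<in>Z. \<phi> z \<bullet> \<phi> y)" by (simp add: S_def inner_sum_left inner_sum_right inner_commute)
    also have "\<dots> = (\<Sum>z\<in>Z. 2 + real (m z))"
    proof (rule sum.cong[OF refl])
      fix z assume z: "z \<in> Z"
      have "(\<Sum>y\<in>Z. \<phi> z \<bullet> \<phi> y) = (\<Sum>y\<in>Z. (if y = z then 2 else 0) + (if y \<in> nbrs z then 1 else 0))"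
        by (rule sum.cong) (use z ZV D_irrefl in \<open>auto simp: ip nbrs_def subset_iff\<close>)
      also have "\<dots> = 2 + real (m z)"
        using z finZ by (simp add: sum.distrib sum.If_cases m_def Int_commute Int_absorb1)
      finally show "(\<Sum>y\<in>Z. \<phi> z \<bullet> \<phi> y) = 2 + real (m z)" .
    qed
    finally show ?thesis .
  qed
  have "Z = {}"
  proof (rule ccontr)
    assume ne: "Z \<noteq> {}"
    then have cZ: "0 < card Z" using finZ by (simp add: card_gt_0_iff)
    have "(real (card Z))\<^sup>2 \<le> (t \<bullet> t) * (S \<bullet> S)" using Cauchy_Schwarz_ineq[of t S] tS by simp
    then have "(real d + 2) * (real (card Z))\<^sup>2 \<le> (real d + 2) * ((t \<bullet> t) * (S \<bullet> S))"
      by (intro mult_left_mono) auto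
    also have "\<dots> = card Z * (S \<bullet> S)" using jN by (simp add: mult.assoc[symmetric])
    finally have "card Z * ((real d + 2) * card Z) \<le> card Z * (S \<bullet> S)"
      by (simp add: power2_eq_square mult_ac)
    then have "(real d + 2) * card Z \<le> S \<bullet> S" using cZ by simp
    then have ge: "(\<Sum>z\<in>Z. real d) \<le> (\<Sum>z\<in>Z. real (m z))" by (simp add: SS sum.distrib algebra_simps)
    have all: "m z = d" if z: "z \<in> Z" for z
    proof (rule ccontr)
      assume "m z \<noteq> d"
      then have "m z < d" using md[OF z] by simp
      then have "(\<Sum>z\<in>Z. real (m z)) < (\<Sum>z\<in>Z. real d)"
        by (intro sum_strict_mono_ex1 finZ) (use md z in auto)
      then show False using ge by simp
    qed
    have "Z = V"
    proof (rule conn[OF ZV ne])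
      fix z y assume zy: "z \<in> Z" "y \<in> V" "D z y"
      have "nbrs z \<inter> Z = nbrs z"
        by (rule card_subset_eq) (use all[OF zy(1)] card_nbrs[of z] zy ZV in \<open>auto simp: m_def\<close>)
      then show "y \<in> Z" using zy by (auto simp: nbrs_def)
    qed
    then have "x \<in> Z" using x by simp
    then show False using x by (simp add: Z_def)
  qed
  then have "t \<bullet> t = 0" using jN by simp
  then show ?thesis by simp
qed

section \<open>Three independent vertices in a neighbourhood\<close>

context
  fixes x y1 y2 y3
  assumes xV: "x \<in> V" and yV: "y1 \<in> V" "y2 \<in> V" "y3 \<in> V"
    and Dx: "D x y1" "D x y2" "D x y3"
    and nD: "\<not> D y1 y2" "\<not> D y1 y3" "\<not> D y2 y3"
    and ne: "y1 \<noteq> y2" "y1 \<noteq> y3" "y2 \<noteq> y3"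
begin

private lemma facts: "x \<noteq> y1" "x \<noteq> y2" "x \<noteq> y3" "D y1 x" "D y2 x" "D y3 x"
    "\<not> D y2 y1" "\<not> D y3 y1" "\<not> D y3 y2"
  using Dx nD D_irrefl D_commute by auto

text \<open>Otherwise x, a, z, b is an induced four-cycle, and pairing its relation with the third
  leaf gives \<open>1 + \<phi> c \<bullet> \<phi> z = 0\<close>.\<close>

private lemma no_common: "z \<in> V \<Longrightarrow> \<not> D x z \<Longrightarrow> z \<noteq> x \<Longrightarrow> a \<in> V \<Longrightarrow> b \<in> V \<Longrightarrow> c \<in> V \<Longrightarrow>
    D x a \<Longrightarrow> D x b \<Longrightarrow> D x c \<Longrightarrow> \<not> D a b \<Longrightarrow> \<not> D a c \<Longrightarrow> \<not> D b c \<Longrightarrow>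
    a \<noteq> b \<Longrightarrow> a \<noteq> c \<Longrightarrow> b \<noteq> c \<Longrightarrow> \<not> (D z a \<and> D z b)"
proof
  assume a: "z \<in> V" "\<not> D x z" "z \<noteq> x" "a \<in> V" "b \<in> V" "c \<in> V"
    "D x a" "D x b" "D x c" "\<not> D a b" "\<not> D a c" "\<not> D b c" "a \<noteq> b" "a \<noteq> c" "b \<noteq> c" "D z a \<and> D z b"
  have "\<phi> x + \<phi> z = \<phi> a + \<phi> b"
    using a xV D_commute by (intro four_cycle) auto
  then have "\<phi> c \<bullet> (\<phi> x + \<phi> z) = \<phi> c \<bullet> (\<phi> a + \<phi> b)" by simp
  moreover have "\<not> D c a" "\<not> D c b" "D c x" "c \<noteq> x" using a D_commute D_irrefl by auto
  moreover have "\<phi> c \<bullet> \<phi> z \<ge> 0" using a by (simp add: ip)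
  ultimately show False using a xV by (simp add: inner_simps ip)
qed

private lemma not_all_adjacent:
  assumes "z \<in> V" "D x z" "D z y1" "D z y2" "D z y3" shows False
proof -
  have D': "z \<noteq> x" "z \<noteq> y1" "z \<noteq> y2" "z \<noteq> y3" "D z x" "D y1 z" "D y2 z" "D y3 z"
    using assms D_commute D_irrefl by auto
  let ?w = "\<phi> z + \<phi> x - \<phi> y1 - \<phi> y2 - \<phi> y3"
  have "?w \<bullet> ?w = 0" using D' facts xV yV Dx nD ne assms by (simp add: inner_simps ip)
  then have "?w = 0" by (simp only: inner_eq_zero_iff)
  then have "\<tau> \<bullet> ?w = 0" by simp
  then show False using xV yV assms by (simp add: inner_simps tau)
qed

text \<open>The right side has inner product 1 with all four claw vertices, so it is the projection
  of \<open>\<tau>\<close> to their span. The three preceding restrictions on adjacency to the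
  leaves leave only the values 0 and 1 for the residual on further vertices, and it vanishes at
  \<open>x\<close>, so \<open>zero_one_projection\<close> applies.\<close>

private lemma tau_eq: "\<tau> = \<phi> y1 + \<phi> y2 + \<phi> y3 - \<phi> x"
proof -
  let ?s = "\<phi> y1 + \<phi> y2 + \<phi> y3 - \<phi> x"
  let ?t = "\<tau> - ?s"
  have "?t = 0"
  proof (rule zero_one_projection)
    show "x \<in> V" by (rule xV)
    show "?t \<bullet> \<phi> x = 0" using xV yV Dx nD ne facts by (simp add: inner_simps ip tau)
    have "?s \<bullet> ?s = 2"
      using xV yV Dx nD ne facts by (simp add: inner_simps ip)
    moreover have "\<tau> \<bullet> ?s = 2" using xV yV by (simp add: inner_simps tau)
    moreover have "v \<bullet> v = 2 \<Longrightarrow> \<tau> \<bullet> v = 2 \<Longrightarrow> (\<tau> - v) \<bullet> (\<tau> - v) = (\<tau> - v) \<bullet> \<tau>" for v :: 'v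
      by (simp add: inner_simps inner_commute)
    ultimately show "?t \<bullet> ?t = ?t \<bullet> \<tau>" by blast
    fix z assume z: "z \<in> V"
    consider "z = x" | "z = y1" | "z = y2" | "z = y3"
      | (adj) "z \<noteq> x" "z \<noteq> y1" "z \<noteq> y2" "z \<noteq> y3" "D x z"
      | (nonadj) "z \<noteq> x" "z \<noteq> y1" "z \<noteq> y2" "z \<noteq> y3" "\<not> D x z" by blast
    then show "?t \<bullet> \<phi> z = 0 \<or> ?t \<bullet> \<phi> z = 1"
    proof cases
      case adj
      have "\<not> (\<not> D z y1 \<and> \<not> D z y2 \<and> \<not> D z y3)"
        using no_four_claw[of x z y1 y2 y3] adj xV yV z Dx nD ne by blast
      moreover have "\<not> (D z y1 \<and> D z y2 \<and> D z y3)" using not_all_adjacent adj z by blast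
      ultimately show ?thesis using adj z xV yV
        by (auto simp: inner_simps ip tau D_commute[of _ z])
    next
      case nonadj
      have "\<not> (D z y1 \<and> D z y2)" using no_common[of z y1 y2 y3] nonadj z yV Dx nD ne by blast
      moreover have "\<not> (D z y1 \<and> D z y3)"
        using no_common[of z y1 y3 y2] nonadj z yV Dx nD ne facts by blast
      moreover have "\<not> (D z y2 \<and> D z y3)"
        using no_common[of z y2 y3 y1] nonadj z yV Dx nD ne facts by blast
      ultimately show ?thesis using nonadj z xV yV
        by (auto simp: inner_simps ip tau D_commute[of _ z])
    qed (use xV yV Dx nD ne facts in \<open>auto simp: inner_simps ip tau\<close>)
  qed
  then show ?thesis by simp
qed

text \<open>Since \<open>\<tau>\<close> has norm 2 as well, reflecting the non-neighbours of \<open>x\<close> makes every further vertex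
  adjacent to \<open>x\<close> and to exactly two of \<open>y1\<close>, \<open>y2\<close>, \<open>y3\<close>; the third one names its pillar, as in
  the Lemmens--Seidel analysis of equiangular lines.\<close>

private definition f where "f z = (if D x z then \<phi> z else \<tau> - \<phi> z)"
private definition R where "R = V - {x, y1, y2, y3}"

private lemma tau_tau2: "\<tau> \<bullet> \<tau> = 2"
proof -
  have "\<tau> \<bullet> \<tau> = \<tau> \<bullet> (\<phi> y1 + \<phi> y2 + \<phi> y3 - \<phi> x)" by (simp flip: tau_eq)
  then show ?thesis using xV yV by (simp add: inner_simps tau)
qed

private lemma f_props: assumes z: "z \<in> R"
  shows "f z \<bullet> f z = 2" "f z \<bullet> \<phi> x = 1" "f z \<bullet> \<phi> y1 + f z \<bullet> \<phi> y2 + f z \<bullet> \<phi> y3 = 2"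
    "f z \<bullet> \<phi> y1 = 0 \<or> f z \<bullet> \<phi> y1 = 1" "f z \<bullet> \<phi> y2 = 0 \<or> f z \<bullet> \<phi> y2 = 1" "f z \<bullet> \<phi> y3 = 0 \<or> f z \<bullet> \<phi> y3 = 1"
proof -
  have zV: "z \<in> V" and nz: "z \<noteq> x" "z \<noteq> y1" "z \<noteq> y2" "z \<noteq> y3" using z by (auto simp: R_def)
  have comm: "D z x \<longleftrightarrow> D x z" by (rule D_commute)
  show "f z \<bullet> f z = 2" using zV tau_tau2
    by (simp add: f_def inner_simps ip tau inner_commute[of "\<phi> z" \<tau>])
  show fx: "f z \<bullet> \<phi> x = 1" using zV xV nz by (simp add: f_def inner_simps ip tau comm)
  have "f z \<bullet> \<tau> = 1" using zV tau_tau2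
    by (simp add: f_def inner_simps tau inner_commute[of "\<phi> z" \<tau>])
  then have "f z \<bullet> (\<phi> y1 + \<phi> y2 + \<phi> y3 - \<phi> x) = 1" by (simp flip: tau_eq)
  then show "f z \<bullet> \<phi> y1 + f z \<bullet> \<phi> y2 + f z \<bullet> \<phi> y3 = 2" using fx by (simp add: inner_simps)
  show "f z \<bullet> \<phi> y1 = 0 \<or> f z \<bullet> \<phi> y1 = 1" "f z \<bullet> \<phi> y2 = 0 \<or> f z \<bullet> \<phi> y2 = 1" "f z \<bullet> \<phi> y3 = 0 \<or> f z \<bullet> \<phi> y3 = 1"
    using zV yV nz by (auto simp: f_def inner_simps ip tau)
qed

private lemma f_prods: assumes "z \<in> R" "w \<in> R" "z \<noteq> w"
  shows "f z \<bullet> f w = 0 \<or> f z \<bullet> f w = 1"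
proof -
  have zV: "z \<in> V" "w \<in> V" using assms by (auto simp: R_def)
  show ?thesis using zV tau_tau2 assms(3)
    by (auto simp: f_def inner_simps ip tau inner_commute[of "\<phi> z" \<tau>] inner_commute[of "\<phi> w" \<tau>])
qed

private definition P where "P k = {z\<in>R. f z \<bullet> \<phi> k = 0}"

text \<open>Any member of another pillar can serve as the vector \<open>g\<close> of
  \<open>pillar_card_le_8\<close>. The list of triples covers all namings of the three leaves at
  once.\<close>

private lemma P_bound:
  assumes abc: "(a, b, c) \<in> {(y1, y2, y3), (y1, y3, y2), (y2, y1, y3), (y2, y3, y1), (y3, y1, y2), (y3, y2, y1)}"
    and w: "w \<in> P b"
  shows "card (P c) \<le> 8"
proof (rule pillar_card_le_8[where f = f and a = "\<phi> a" and b = "\<phi> b" and c = "\<phi> c" and g = "f w"])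
  have disj: "P b \<inter> P c = {}"
    using abc f_props(3-6) by (fastforce simp: P_def)
  have PR: "P c \<subseteq> R" "w \<in> R" using w by (auto simp: P_def)
  show "finite (P c)" using finV by (auto simp: P_def R_def)
  show "f w \<bullet> f w = 2" using f_props PR by auto
  show "f w \<bullet> \<phi> a = 1" "f w \<bullet> \<phi> b = 0" "f w \<bullet> \<phi> c = 1" 
    using abc w f_props(3-6)[of w] PR by (auto simp: P_def)
  fix z assume z: "z \<in> P c"
  show "f z \<bullet> f z = 2" using f_props z by (auto simp: P_def)
  show "f z \<bullet> \<phi> a = 1" "f z \<bullet> \<phi> b = 1" "f z \<bullet> \<phi> c = 0" 
    using abc z f_props(3-6)[of z] by (auto simp: P_def)
  show "f w \<bullet> f z = 0 \<or> f w \<bullet> f z = 1" using f_prods[of w z] z PR disj w by auto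
  fix y assume "y \<in> P c" "y \<noteq> z"
  then show "f y \<bullet> f z = 0 \<or> f y \<bullet> f z = 1" using f_prods[of y z] z by (auto simp: P_def)
qed (use abc yV ne nD facts in \<open>auto simp: ip\<close>)

private lemma R_eq: "R = P y1 \<union> P y2 \<union> P y3"
  using f_props(3-6) by (fastforce simp: P_def)

text \<open>If all further vertices lie in the pillar of \<open>c\<close>, each of them is adjacent
  to \<open>a\<close> exactly if it is adjacent to \<open>x\<close>. Beyond these, \<open>x\<close>
  has three neighbours and \<open>a\<close> only one, against regularity.\<close>

private lemma one_pillar_contradiction:
  assumes abc: "(a, b, c) \<in> {(y1, y2, y3), (y1, y3, y2), (y2, y1, y3), (y2, y3, y1), (y3, y1, y2), (y3, y2, y1)}"
    and PR: "P c = R"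
  shows False
proof -
  define Q where "Q = {z\<in>R. D x z}"
  have finQ: "finite Q" using finV by (simp add: Q_def R_def)
  have aV: "a \<in> V" using abc yV by auto
  have fa: "f z \<bullet> \<phi> a = 1" if "z \<in> R" for z
  proof -
    have "z \<in> P c" using that PR by simp
    then have "f z \<bullet> \<phi> c = 0" by (simp add: P_def)
    then show ?thesis using that abc f_props(3-6)[of z] by auto
  qed
  have nx: "nbrs x = {y1, y2, y3} \<union> Q"
    using xV yV Dx D_irrefl by (auto simp: nbrs_def Q_def R_def)
  have "D a z \<longleftrightarrow> D x z" if z: "z \<in> R" for z
  proof -
    have zV: "z \<in> V" "z \<noteq> a" using z abc by (auto simp: R_def)
    show ?thesis using fa[OF z] zV aV D_commute[of a z] by (auto simp: f_def ip inner_simps tau split: if_splits)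
  qed
  then have na: "nbrs a = insert x Q"
    using abc xV yV Dx nD facts D_irrefl by (auto simp: nbrs_def Q_def R_def)
  have "card (nbrs x) = 3 + card Q" unfolding nx
    using finQ ne by (subst card_Un_disjoint) (auto simp: Q_def R_def)
  moreover have "card (nbrs a) = 1 + card Q" unfolding na using finQ by (auto simp: Q_def R_def)
  ultimately show False using card_nbrs xV aV by simp
qed

text \<open>At least two pillars are nonempty, so every pillar has a nonempty partner and at most 8
  members; the claw contributes 4 vertices.\<close>

lemma claw_imp_card_le: "card V \<le> 28"
proof -
  have finP: "finite (P k)" for k using finV by (auto simp: P_def R_def)
  have "V \<subseteq> {x, y1, y2, y3} \<union> R" by (auto simp: R_def)
  then have "card V \<le> card ({x, y1, y2, y3} \<union> R)" by (intro card_mono) (auto simp: R_eq finP)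
  also have "\<dots> \<le> card {x, y1, y2, y3} + card R" by (rule card_Un_le)
  also have "card {x, y1, y2, y3} \<le> 4" by (simp add: card_insert_if)
  also have "card R \<le> card (P y1) + card (P y2) + card (P y3)"
    unfolding R_eq by (meson add_right_mono card_Un_le order_trans)
  finally have "card V \<le> 4 + (card (P y1) + card (P y2) + card (P y3))" by simp
  moreover have "P y1 \<noteq> {} \<or> P y2 \<noteq> {}" "P y1 \<noteq> {} \<or> P y3 \<noteq> {}" "P y2 \<noteq> {} \<or> P y3 \<noteq> {}"
    using one_pillar_contradiction[of y1 y2 y3] one_pillar_contradiction[of y1 y3 y2]
      one_pillar_contradiction[of y2 y3 y1] R_eq by blast+
  then have "card (P y1) \<le> 8" "card (P y2) \<le> 8" "card (P y3) \<le> 8"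
    using P_bound[of y3 y2 y1] P_bound[of y2 y3 y1] P_bound[of y3 y1 y2] P_bound[of y1 y3 y2]
      P_bound[of y2 y1 y3] P_bound[of y1 y2 y3] by auto
  ultimately show ?thesis by simp
qed

end

end

section \<open>Large cliques\<close>

lemma inner_combination3:
  fixes a b c :: "'v::real_inner"
  shows "(p *\<^sub>R a + q *\<^sub>R b + r *\<^sub>R c) \<bullet> (p *\<^sub>R a + q *\<^sub>R b + r *\<^sub>R c) =
    p^2 * (a \<bullet> a) + q^2 * (b \<bullet> b) + r^2 * (c \<bullet> c)
    + 2 * p * q * (a \<bullet> b) + 2 * p * r * (a \<bullet> c) + 2 * q * r * (b \<bullet> c)"
  unfolding inner_add_left inner_add_right inner_scaleR_left inner_scaleR_right
    inner_commute[of b a] inner_commute[of c a] inner_commute[of c b]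
  by (simp add: power2_eq_square algebra_simps)

text \<open>The order exceeds the 28 vertices allowed by a claw, and the degree exceeds the 18
  neighbours allowed by a pentagon. The last condition excludes cocktail party graphs, where
  nonadjacent vertices have all neighbours in common.\<close>

locale large_root_graph = root_graph +
  assumes card_V: "29 \<le> card V" and d_ge: "19 \<le> d" and card_V_neq: "card V \<noteq> d + 2"
begin

lemma no_claw:
  assumes "x \<in> V" "y1 \<in> V" "y2 \<in> V" "y3 \<in> V" "D x y1" "D x y2" "D x y3"
    "y1 \<noteq> y2" "y1 \<noteq> y3" "y2 \<noteq> y3" "\<not> D y1 y2" "\<not> D y1 y3" "\<not> D y2 y3"
  shows False
  using claw_imp_card_le[OF assms(1-7) assms(11-13) assms(8-10)] card_V by simp

definition clique :: "'a set \<Rightarrow> bool" where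
  "clique K \<longleftrightarrow> K \<subseteq> V \<and> (\<forall>x\<in>K. \<forall>y\<in>K. x \<noteq> y \<longrightarrow> D x y)"

lemma clique_finite: "clique K \<Longrightarrow> finite K"
  using finV finite_subset by (auto simp: clique_def)

lemma clique_sum_inner:
  assumes K: "clique K" and A: "A \<subseteq> K" and B: "B \<subseteq> K"
  shows "(\<Sum>x\<in>A. \<phi> x) \<bullet> (\<Sum>x\<in>B. \<phi> x) = real (card A) * card B + card (A \<inter> B)"
proof -
  have fin: "finite A" "finite B" using clique_finite[OF K] A B finite_subset by auto
  have "(\<Sum>x\<in>A. \<phi> x) \<bullet> (\<Sum>x\<in>B. \<phi> x) = (\<Sum>x\<in>A. \<Sum>y\<in>B. \<phi> x \<bullet> \<phi> y)"
    by (simp add: inner_sum_left inner_sum_right) (rule sum.swap)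
  also have "\<dots> = (\<Sum>x\<in>A. \<Sum>y\<in>B. 1 + (if y = x then 1 else 0))"
    using K A B by (intro sum.cong refl) (auto simp: ip clique_def subset_iff)
  also have "\<dots> = (\<Sum>x\<in>A. real (card B) + (if x \<in> B then 1 else 0))"
    using fin by (simp add: sum.distrib)
  also have "\<dots> = real (card A) * card B + card (A \<inter> B)"
    using fin by (simp add: sum.distrib sum.If_cases)
  finally show ?thesis .
qed

text \<open>The vectors \<open>e c\<close> are orthonormal and orthogonal to
  \<open>\<phi> a\<close>, while \<open>\<phi> z\<close> has inner product 1/2 or -1/2 with each of
  them and 1 with \<open>\<phi> a\<close>. Bessel gives 1/2 + \<open>card C\<close> / 4 \<le> 2, so
  \<open>C\<close> has at most six elements.\<close>

lemma twin_asym: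
  assumes ab: "a \<in> V" "b \<in> V" "a \<noteq> b" "\<not> D a b"
    and C: "clique C" "7 \<le> card C" "\<And>c. c \<in> C \<Longrightarrow> D a c \<and> D b c"
    and z: "z \<in> V" "D a z" "\<not> D b z" "z \<noteq> b"
  shows False
proof -
  have CV: "C \<subseteq> V" using C by (simp add: clique_def)
  have finC: "finite C" using C clique_finite by auto
  have zC: "z \<notin> C" using C(3) z(3) by auto
  have ne: "a \<notin> C" "b \<notin> C" "z \<noteq> a" using C(3) z(2) D_irrefl by auto
  define e where "e c = \<phi> c - (1/2) *\<^sub>R (\<phi> a + \<phi> b)" for c
  have D': "D c a" "D c b" "D z a" "\<not> D z b" "\<not> D b a" if "c \<in> C" for c
    using C(3)[OF that] z ab D_commute by auto
  have ee: "e c \<bullet> e c' = (if c = c' then 1 else 0)" if "c \<in> C" "c' \<in> C" for c c'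
    using that ab CV D' C(3) C(1) ne by (auto simp: e_def inner_simps ip subset_iff clique_def)
  have ea: "e c \<bullet> \<phi> a = 0" if "c \<in> C" for c
    using that ab CV D' C(3) ne by (auto simp: e_def inner_simps ip subset_iff)
  have ez: "(\<phi> z \<bullet> e c)\<^sup>2 = 1/4" if "c \<in> C" for c
    using that ab CV D'[OF that] z ne zC by (auto simp: e_def inner_simps ip subset_iff power2_eq_square)
  define s where "s = (\<Sum>c\<in>C. (\<phi> z \<bullet> e c) *\<^sub>R e c)"
  have es: "e c \<bullet> s = \<phi> z \<bullet> e c" if "c \<in> C" for c
  proof -
    have "e c \<bullet> s = (\<Sum>c'\<in>C. if c = c' then \<phi> z \<bullet> e c' else 0)"
      unfolding s_def inner_sum_right by (rule sum.cong) (use ee that in auto)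
    then show ?thesis using finC that by simp
  qed
  have ss: "s \<bullet> s = card C / 4"
  proof -
    have "s \<bullet> s = (\<Sum>c\<in>C. (\<phi> z \<bullet> e c) * (e c \<bullet> s))" by (subst (1) s_def) (simp add: inner_sum_left)
    also have "\<dots> = (\<Sum>c\<in>C. 1/4)" by (rule sum.cong) (use es ez in \<open>auto simp: power2_eq_square\<close>)
    finally show ?thesis by simp
  qed
  have zs: "\<phi> z \<bullet> s = card C / 4"
  proof -
    have "\<phi> z \<bullet> s = (\<Sum>c\<in>C. (\<phi> z \<bullet> e c) * (\<phi> z \<bullet> e c))" by (simp add: s_def inner_sum_right)
    also have "\<dots> = (\<Sum>c\<in>C. 1/4)" by (rule sum.cong) (use ez in \<open>auto simp: power2_eq_square\<close>)
    finally show ?thesis by simp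
  qed
  have sa: "s \<bullet> \<phi> a = 0" by (simp add: s_def inner_sum_left ea)
  have za: "\<phi> z \<bullet> \<phi> a = 1" using z ab ne D_commute[of z a] by (simp add: ip)
  let ?w = "\<phi> z - (1/2) *\<^sub>R \<phi> a - s"
  have "?w \<bullet> ?w = 3/2 - card C / 4"
    using z ab zs ss sa za inner_commute[of s "\<phi> z"] inner_commute[of "\<phi> a" s] inner_commute[of "\<phi> a" "\<phi> z"]
    by (simp add: inner_simps ip)
  moreover have "0 \<le> ?w \<bullet> ?w" by simp
  ultimately show False using C(2) by simp
qed

text \<open>By \<open>twin_asym\<close> in both directions, \<open>a\<close> and \<open>b\<close>
  have the same neighbours. A common neighbour z and a nonadjacent common neighbour y satisfy
  \<open>\<phi> z + \<phi> y = \<phi> a + \<phi> b\<close>, so y is unique and z already has d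
  neighbours in \<open>X\<close>. Thus \<open>X\<close> is closed and equals \<open>V\<close>, a
  cocktail party graph.\<close>

lemma twin:
  assumes ab: "a \<in> V" "b \<in> V" "a \<noteq> b" "\<not> D a b"
    and C: "clique C" "7 \<le> card C" "\<And>c. c \<in> C \<Longrightarrow> D a c \<and> D b c"
  shows False
proof -
  have ba: "\<not> D b a" using ab D_commute by auto
  have C': "D b c \<and> D a c" if "c \<in> C" for c using C(3)[OF that] by simp
  have nab: "nbrs b = nbrs a"
    using twin_asym[OF ab C] twin_asym[OF ab(2,1) ab(3)[symmetric] ba C(1,2) C'] ab ba
    by (fastforce simp: nbrs_def)
  define X where "X = insert a (insert b (nbrs a))"
  have XV: "X \<subseteq> V" using ab by (auto simp: X_def nbrs_def)
  have finX: "finite X" by (simp add: X_def)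
  have cX: "card X = d + 2" using ab ba D_irrefl card_nbrs by (simp add: X_def nbrs_def finV)
  have "X = V"
  proof (rule conn[OF XV])
    show "X \<noteq> {}" by (simp add: X_def)
    fix z y assume zy: "z \<in> X" "y \<in> V" "D z y"
    show "y \<in> X"
    proof (cases "z \<in> nbrs a")
      case False
      then have "z = a \<or> z = b" using zy by (auto simp: X_def)
      then have "y \<in> nbrs a" using zy nab by (auto simp: nbrs_def)
      then show ?thesis by (simp add: X_def)
    next
      case True
      then have z: "z \<in> V" "D a z" "D b z" "z \<noteq> a" "z \<noteq> b" using nab ba ab D_irrefl by (auto simp: nbrs_def)
      define S where "S = {y\<in>X. y \<noteq> z \<and> \<not> D z y}"
      have S_eq: "\<phi> y = \<phi> a + \<phi> b - \<phi> z" if "y \<in> S" for y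
      proof -
        have "y \<noteq> a" "y \<noteq> b" using that z D_commute[of z a] D_commute[of z b] by (auto simp: S_def)
        then have "y \<in> nbrs a" using that by (auto simp: S_def X_def)
        then have y: "y \<in> V" "D a y" "D b y" using nab by (auto simp: nbrs_def)
        have "\<phi> z + \<phi> y = \<phi> a + \<phi> b"
          using that z y ab D_commute by (intro four_cycle) (auto simp: S_def)
        then show ?thesis by (simp add: algebra_simps)
      qed
      have "card S \<le> Suc 0"
        using S_eq phi_inj XV by (subst card_le_Suc0_iff_eq) (auto simp: S_def finX subset_iff)
      moreover have sub: "X - insert z S \<subseteq> nbrs z" using XV by (auto simp: S_def nbrs_def)
      moreover have "card (X - insert z S) \<ge> card X - card (insert z S)" by (rule diff_card_le_card_Diff) (simp add: S_def finX)
      moreover have "card (insert z S) \<le> Suc (card S)" by (rule card_insert_le_m1) auto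
      ultimately have "d \<le> card (X - insert z S)" using cX by linarith
      then have "X - insert z S = nbrs z"
        using card_seteq[OF finite_nbrs sub] card_nbrs[OF z(1)] by simp
      then show ?thesis using zy by (auto simp: nbrs_def)
    qed
  qed
  then show False using cX card_V_neq by simp
qed

text \<open>Let m be the size of the clique and c the number of neighbours in it. Seven neighbours
  contradict \<open>twin\<close>. Off the span of the clique, \<open>\<phi> y\<close> retains
  squared norm 2 - c (m + 1 - c) / (m + 1), which is negative for 3 \<le> c \<le> 6 once m \<ge> 9;
  at m = 8 and c = 3 it is 0.\<close>

lemma few_nbrs:
  assumes K: "clique K" "9 \<le> card K" and y: "y \<in> V" "y \<notin> K" and k: "k \<in> K" "\<not> D y k"
  shows "card (K \<inter> nbrs y) \<le> 2"
proof (rule ccontr)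
  assume gt: "\<not> card (K \<inter> nbrs y) \<le> 2"
  let ?C = "K \<inter> nbrs y" and ?E = "K - nbrs y"
  have finK: "finite K" using K clique_finite by auto
  have KV: "K \<subseteq> V" using K by (simp add: clique_def)
  have cl: "clique ?C" using K by (auto simp: clique_def)
  have le6: "card ?C \<le> 6"
  proof (rule ccontr)
    assume "\<not> card ?C \<le> 6"
    then have "7 \<le> card ?C" by simp
    moreover have "D y c \<and> D k c" if "c \<in> ?C" for c
    proof -
      have c: "c \<in> K" "D y c" using that by (auto simp: nbrs_def)
      then have "c \<noteq> k" using k by auto
      then show ?thesis using c k K by (auto simp: clique_def)
    qed
    moreover have "k \<in> V" "y \<noteq> k" using k KV y by auto
    ultimately show False using twin[of y k ?C] cl y k by blast
  qed
  define c where "c = real (card ?C)"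
  define m where "m = real (card K)"
  have E: "real (card ?E) = m - c"
  proof -
    have "card K = card ?C + card ?E"
      using finK by (subst card_Un_disjoint[symmetric]) (auto intro: arg_cong[where f = card])
    then show ?thesis by (simp add: m_def c_def)
  qed
  define A where "A = (\<Sum>x\<in>?C. \<phi> x)"
  define B where "B = (\<Sum>x\<in>?E. \<phi> x)"
  have AA: "A \<bullet> A = c * c + c" unfolding A_def c_def by (subst clique_sum_inner[OF K(1)]) auto
  have BB: "B \<bullet> B = (m - c) * (m - c) + (m - c)" unfolding B_def E[symmetric] by (subst clique_sum_inner[OF K(1)]) auto
  have "A \<bullet> B = real (card ?C) * card ?E + card (?C \<inter> ?E)"
    unfolding A_def B_def by (rule clique_sum_inner[OF K(1)]) auto
  moreover have "?C \<inter> ?E = {}" by auto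
  ultimately have AB: "A \<bullet> B = c * (m - c)" using E by (simp add: c_def)
  have "\<phi> y \<bullet> A = (\<Sum>x\<in>?C. 1)" unfolding A_def inner_sum_right
    using y KV by (intro sum.cong) (auto simp: ip nbrs_def)
  then have yA: "\<phi> y \<bullet> A = c" by (simp add: c_def)
  have yB: "\<phi> y \<bullet> B = 0" unfolding B_def inner_sum_right
    using y KV by (intro sum.neutral) (auto simp: ip nbrs_def subset_iff)
  \<comment> \<open>\<open>m + 1\<close> times the component of \<open>\<phi> y\<close> orthogonal to the span of the clique\<close>
  let ?w = "(m + 1) *\<^sub>R \<phi> y + (- (m + 1 - c)) *\<^sub>R A + c *\<^sub>R B"
  have yy: "\<phi> y \<bullet> \<phi> y = 2" using y by (simp add: ip)
  have "?w \<bullet> ?w = (m + 1) * (2 * (m + 1) - c * (m + 1 - c))"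
    unfolding inner_combination3 AA BB AB yA yB yy by (simp add: power2_eq_square algebra_simps)
  then have "0 \<le> (m + 1) * (2 * (m + 1) - c * (m + 1 - c))" using inner_ge_zero by metis
  moreover have m9: "m \<ge> 9" using K by (simp add: m_def)
  ultimately have "0 \<le> 2 * (m + 1) - c * (m + 1 - c)" by (simp add: zero_le_mult_iff)
  moreover have "card ?C = 3 \<or> card ?C = 4 \<or> card ?C = 5 \<or> card ?C = 6" using gt le6 by linarith
  then have "c = 3 \<or> c = 4 \<or> c = 5 \<or> c = 6" unfolding c_def by auto
  ultimately show False using m9 by auto
qed

text \<open>Off the span of the clique both vectors have squared norm 4 / M, but adjacency makes
  their inner product 4 / M - 1. Their sum would have squared norm 2 (8 - M) / M, which is
  negative.\<close>

lemma same_two_nbrs: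
  assumes K: "clique K" "9 \<le> card K" and y: "y \<in> V" "y \<notin> K" and z: "z \<in> V" "z \<notin> K"
    and k: "k1 \<noteq> k2" "K \<inter> nbrs y = {k1, k2}" "K \<inter> nbrs z = {k1, k2}" and yz: "D y z"
  shows False
proof -
  have finK: "finite K" using K clique_finite by auto
  have KV: "K \<subseteq> V" using K by (simp add: clique_def)
  have kK: "{k1, k2} \<subseteq> K" using k by auto
  define M where "M = real (card K) + 1"
  define A where "A = (\<Sum>x\<in>{k1,k2}. \<phi> x)"
  define B where "B = (\<Sum>x\<in>K. \<phi> x)"
  define w where "w = \<phi> y + \<phi> z"
  have AA: "A \<bullet> A = 6" unfolding A_def using k kK by (subst clique_sum_inner[OF K(1)]) auto
  have BB: "B \<bullet> B = M * (M - 1)" unfolding B_def M_def by (subst clique_sum_inner[OF K(1)]) (auto simp: algebra_simps)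
  have "{k1, k2} \<inter> K = {k1, k2}" using kK by auto
  then have AB: "A \<bullet> B = 2 * M" unfolding A_def B_def M_def using k kK
    by (subst clique_sum_inner[OF K(1)]) (auto simp: algebra_simps)
  have nB: "\<phi> v \<bullet> B = 2" if v: "v \<in> V" "v \<notin> K" "K \<inter> nbrs v = {k1, k2}" for v
  proof -
    have "\<phi> v \<bullet> B = (\<Sum>x\<in>K. if x \<in> nbrs v then 1 else 0)" unfolding B_def inner_sum_right
      using v KV by (intro sum.cong) (auto simp: ip nbrs_def subset_iff)
    also have "\<dots> = card (K \<inter> nbrs v)" using finK by (simp add: sum.If_cases)
    finally show ?thesis using v k by simp
  qed
  have nA: "\<phi> v \<bullet> A = 2" if v: "v \<in> V" "v \<notin> K" "K \<inter> nbrs v = {k1, k2}" for v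
  proof -
    have "D v k1" "D v k2" "v \<noteq> k1" "v \<noteq> k2" "k1 \<in> V" "k2 \<in> V" using v kK KV by (auto simp: nbrs_def)
    then show ?thesis using v k by (simp add: A_def inner_simps ip)
  qed
  have wB: "w \<bullet> B = 4" using nB[OF y k(2)] nB[OF z k(3)] by (simp add: w_def inner_simps)
  have wA: "w \<bullet> A = 4" using nA[OF y k(2)] nA[OF z k(3)] by (simp add: w_def inner_simps)
  have "y \<noteq> z" "D z y" using yz D_irrefl D_commute by auto
  then have ww: "w \<bullet> w = 6" using y z yz by (simp add: w_def inner_simps ip)
  \<comment> \<open>\<open>M\<close> times the component of \<open>w\<close> orthogonal to the span of the clique\<close>
  let ?w = "M *\<^sub>R w + (- 2 * M) *\<^sub>R A + 4 *\<^sub>R B"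
  have "?w \<bullet> ?w = 2 * M * (8 - M)"
    unfolding inner_combination3 AA BB AB wA wB ww by (simp add: power2_eq_square algebra_simps)
  then have "0 \<le> 2 * M * (8 - M)" using inner_ge_zero by metis
  moreover have "M \<ge> 10" using K by (simp add: M_def)
  ultimately show False by (simp add: zero_le_mult_iff)
qed

section \<open>Pentagons in a neighbourhood\<close>

text \<open>The cyclic order a, b, c, e, g follows the nonadjacent pairs, on which
  \<open>no_claw\<close> acts; the adjacency cycle is a, c, g, b, e.\<close>

definition pentagon :: "'a \<Rightarrow> 'a \<Rightarrow> 'a \<Rightarrow> 'a \<Rightarrow> 'a \<Rightarrow> 'a \<Rightarrow> bool" where
  "pentagon x a b c e g \<longleftrightarrow> x \<in> V \<and> {a, b, c, e, g} \<subseteq> nbrs x \<and>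
     a \<noteq> b \<and> b \<noteq> c \<and> c \<noteq> e \<and> e \<noteq> g \<and> g \<noteq> a \<and>
     \<not> D a b \<and> \<not> D b c \<and> \<not> D c e \<and> \<not> D e g \<and> \<not> D g a \<and>
     D a c \<and> D a e \<and> D b e \<and> D b g \<and> D c g"

lemma pentagon_rotate: "pentagon x a b c e g \<Longrightarrow> pentagon x b c e g a"
  by (simp add: pentagon_def D_commute[of c a] D_commute[of e a])

lemma pentagon_facts:
  assumes "pentagon x a b c e g"
  shows "x \<in> V" "a \<in> V" "b \<in> V" "c \<in> V" "e \<in> V" "g \<in> V"
    "x \<noteq> a" "x \<noteq> b" "x \<noteq> c" "x \<noteq> e" "x \<noteq> g" "a \<noteq> b" "a \<noteq> c" "a \<noteq> e" "a \<noteq> g"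
    "b \<noteq> c" "b \<noteq> e" "b \<noteq> g" "c \<noteq> e" "c \<noteq> g" "e \<noteq> g"
    "D x a" "D x b" "D x c" "D x e" "D x g" "D a x" "D b x" "D c x" "D e x" "D g x"
    "\<not> D a b" "\<not> D b c" "\<not> D c e" "\<not> D e g" "\<not> D g a"
    "\<not> D b a" "\<not> D c b" "\<not> D e c" "\<not> D g e" "\<not> D a g"
    "D a c" "D a e" "D b e" "D b g" "D c g" "D c a" "D e a" "D e b" "D g b" "D g c"
proof -
  note p = assms[unfolded pentagon_def nbrs_def, simplified]
  show "x \<in> V" "a \<in> V" "b \<in> V" "c \<in> V" "e \<in> V" "g \<in> V"
    "D x a" "D x b" "D x c" "D x e" "D x g" "D a c" "D a e" "D b e" "D b g" "D c g"
    "\<not> D a b" "\<not> D b c" "\<not> D c e" "\<not> D e g" "\<not> D g a"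
    "a \<noteq> b" "b \<noteq> c" "c \<noteq> e" "e \<noteq> g"
    using p by simp_all
  then show "D a x" "D b x" "D c x" "D e x" "D g x" "D c a" "D e a" "D e b" "D g b" "D g c"
    "\<not> D b a" "\<not> D c b" "\<not> D e c" "\<not> D g e" "\<not> D a g" by (simp_all only: D_commute, simp_all)
  have neq: "D y z \<Longrightarrow> y \<noteq> z" for y z using D_irrefl by auto
  show "a \<noteq> g" using p by blast
  show "x \<noteq> a" "x \<noteq> b" "x \<noteq> c" "x \<noteq> e" "x \<noteq> g" "a \<noteq> c" "a \<noteq> e" "b \<noteq> e" "b \<noteq> g" "c \<noteq> g"
    by (rule neq, use p in simp)+
qed

text \<open>The test vectors below are integral multiples of sums of components orthogonal to the span of
  \<open>x\<close> and the pentagon.\<close>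

definition joined :: "'a \<Rightarrow> 'a set \<Rightarrow> 'a set \<Rightarrow> 'a set" where
  "joined x A B = {w\<in>nbrs x. (\<forall>a\<in>A. w \<noteq> a \<and> D w a) \<and> (\<forall>b\<in>B. w \<noteq> b \<and> \<not> D w b)}"

lemma joined_facts:
  assumes "w \<in> joined x A B"
  shows "w \<in> V" "w \<noteq> x" "D x w" "D w x"
    "a \<in> A \<Longrightarrow> w \<noteq> a" "a \<in> A \<Longrightarrow> D w a" "a \<in> A \<Longrightarrow> D a w"
    "b \<in> B \<Longrightarrow> w \<noteq> b" "b \<in> B \<Longrightarrow> \<not> D w b" "b \<in> B \<Longrightarrow> \<not> D b w"
proof -
  have p: "w \<in> V" "D x w" "\<And>a. a \<in> A \<Longrightarrow> w \<noteq> a \<and> D w a" "\<And>b. b \<in> B \<Longrightarrow> w \<noteq> b \<and> \<not> D w b"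
    using assms by (auto simp: joined_def nbrs_def)
  show "w \<in> V" "D x w" using p by simp_all
  show "w \<noteq> x" using p(2) D_irrefl by auto
  show "D w x" using p(2) D_commute by blast
  show "a \<in> A \<Longrightarrow> w \<noteq> a" "a \<in> A \<Longrightarrow> D w a" "b \<in> B \<Longrightarrow> w \<noteq> b" "b \<in> B \<Longrightarrow> \<not> D w b"
    using p by simp_all
  then show "a \<in> A \<Longrightarrow> D a w" "b \<in> B \<Longrightarrow> \<not> D b w" using D_commute by blast+
qed

text \<open>Otherwise w, w' and b are three independent neighbours of x.\<close>

lemma joined_adjacent:
  assumes "x \<in> V" "b \<in> nbrs x" "b \<in> B" "b \<in> B'" "w \<in> joined x A B" "w' \<in> joined x A' B'" "w \<noteq> w'"
  shows "D w w'"
proof (rule ccontr)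
  assume "\<not> D w w'"
  moreover have "b \<in> V" "D x b" using assms(2) by (auto simp: nbrs_def)
  ultimately show False
    using no_claw[of x w w' b] assms(1,7) joined_facts(1,3)[OF assms(5)] joined_facts(1,3)[OF assms(6)]
      joined_facts(8,9)[OF assms(5,3)] joined_facts(8,9)[OF assms(6,4)] by blast
qed

lemma finite_joined [simp]: "finite (joined x A B)" by (simp add: joined_def)

lemma card_le_if_no_distinct_triple:
  assumes "finite A" "\<And>u v w. u \<in> A \<Longrightarrow> v \<in> A \<Longrightarrow> w \<in> A \<Longrightarrow> u \<noteq> v \<Longrightarrow> u \<noteq> w \<Longrightarrow> v \<noteq> w \<Longrightarrow> False"
  shows "card A \<le> 2"
proof (rule ccontr)
  assume "\<not> card A \<le> 2"
  then have "3 \<le> card A" by simp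
  then obtain B where "B \<subseteq> A" "card B = 3" by (meson obtain_subset_with_card_n)
  then show False using assms(2) by (auto simp: card_3_iff)
qed

lemma card_le_if_no_distinct_quadruple:
  assumes "finite A" "\<And>u v w z. u \<in> A \<Longrightarrow> v \<in> A \<Longrightarrow> w \<in> A \<Longrightarrow> z \<in> A \<Longrightarrow>
    u \<noteq> v \<Longrightarrow> u \<noteq> w \<Longrightarrow> u \<noteq> z \<Longrightarrow> v \<noteq> w \<Longrightarrow> v \<noteq> z \<Longrightarrow> w \<noteq> z \<Longrightarrow> False"
  shows "card A \<le> 3"
proof (rule ccontr)
  assume "\<not> card A \<le> 3"
  then have "4 \<le> card A" by simp
  then obtain B where B: "B \<subseteq> A" "card B = 4" by (meson obtain_subset_with_card_n)
  have "card B = Suc 3" using B by simp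
  then obtain u C where u: "B = insert u C" "u \<notin> C" "card C = 3" by (metis card_Suc_eq)
  then obtain v w z where "C = {v, w, z}" "v \<noteq> w" "v \<noteq> z" "w \<noteq> z" by (metis card_3_iff)
  then show False using assms(2)[of u v w z] u B(1) by simp
qed

text \<open>On the cycle p, r, t, q, s, two neighbouring nonzero numbers are both 1. A 2 has zeros
  on both sides and leaves at most 2 for the remaining neighbouring pair; without a 2 every number
  is at most 1.\<close>

lemma five_cycle_sum_le_5:
  fixes p q r s t :: nat
  assumes "p \<le> 2" "q \<le> 2" "r \<le> 2" "s \<le> 2" "t \<le> 2"
    and "p \<noteq> 0 \<Longrightarrow> r \<noteq> 0 \<Longrightarrow> p \<le> 1" "p \<noteq> 0 \<Longrightarrow> r \<noteq> 0 \<Longrightarrow> r \<le> 1"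
    "q \<noteq> 0 \<Longrightarrow> s \<noteq> 0 \<Longrightarrow> q \<le> 1" "q \<noteq> 0 \<Longrightarrow> s \<noteq> 0 \<Longrightarrow> s \<le> 1"
    "r \<noteq> 0 \<Longrightarrow> t \<noteq> 0 \<Longrightarrow> r \<le> 1" "r \<noteq> 0 \<Longrightarrow> t \<noteq> 0 \<Longrightarrow> t \<le> 1"
    "s \<noteq> 0 \<Longrightarrow> p \<noteq> 0 \<Longrightarrow> s \<le> 1" "s \<noteq> 0 \<Longrightarrow> p \<noteq> 0 \<Longrightarrow> p \<le> 1"
    "t \<noteq> 0 \<Longrightarrow> q \<noteq> 0 \<Longrightarrow> t \<le> 1" "t \<noteq> 0 \<Longrightarrow> q \<noteq> 0 \<Longrightarrow> q \<le> 1"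
  shows "p + (q + (r + (s + t))) \<le> 5"
proof (cases "p = 0")
  case True
  then show ?thesis using assms by (cases "q = 0"; cases "r = 0"; cases "s = 0"; cases "t = 0") auto
next
  case False
  then show ?thesis using assms by (cases "q = 0"; cases "r = 0"; cases "s = 0"; cases "t = 0") auto
qed

text \<open>Off the span of \<open>x\<close> and the pentagon, such a vertex has squared norm 2/3;
  two of them have inner product -1/3 if adjacent and -4/3 if not. The value -4/3 violates
  Cauchy--Schwarz, and four residuals with inner products -1/3 would have a sum of negative squared
  norm. The test vectors are 3 times these sums.\<close>

lemma card_joined_none:
  assumes p: "pentagon x a b c e g"
  shows "card (joined x {a,b,c,e,g} {}) \<le> 3"
proof (rule card_le_if_no_distinct_quadruple)
  note pf = pentagon_facts[OF p]
  have adj: "D u v" if uv: "u \<in> joined x {a,b,c,e,g} {}" "v \<in> joined x {a,b,c,e,g} {}" "u \<noteq> v" for u v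
  proof (rule ccontr)
    assume n: "\<not> D u v"
    then have n': "\<not> D v u" using D_commute by auto
    note uf = joined_facts(1-4)[OF uv(1)] joined_facts(5-7)[OF uv(1), of a] joined_facts(5-7)[OF uv(1), of b]
      joined_facts(5-7)[OF uv(1), of c] joined_facts(5-7)[OF uv(1), of e] joined_facts(5-7)[OF uv(1), of g]
    note vf = joined_facts(1-4)[OF uv(2)] joined_facts(5-7)[OF uv(2), of a] joined_facts(5-7)[OF uv(2), of b]
      joined_facts(5-7)[OF uv(2), of c] joined_facts(5-7)[OF uv(2), of e] joined_facts(5-7)[OF uv(2), of g]
    let ?w = "3 *\<^sub>R \<phi> u + 3 *\<^sub>R \<phi> v - 2 *\<^sub>R \<phi> a - 2 *\<^sub>R \<phi> b - 2 *\<^sub>R \<phi> c - 2 *\<^sub>R \<phi> e - 2 *\<^sub>R \<phi> g + 2 *\<^sub>R \<phi> x"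
    have "?w \<bullet> ?w < 0" using pf uf vf n n' uv(3) by (simp add: inner_simps ip)
    then show False using inner_ge_zero[of ?w] by linarith
  qed
  fix u v w z assume in4: "u \<in> joined x {a,b,c,e,g} {}" "v \<in> joined x {a,b,c,e,g} {}"
      "w \<in> joined x {a,b,c,e,g} {}" "z \<in> joined x {a,b,c,e,g} {}"
    and ne: "u \<noteq> v" "u \<noteq> w" "u \<noteq> z" "v \<noteq> w" "v \<noteq> z" "w \<noteq> z"
  have Ds: "D u v" "D u w" "D u z" "D v w" "D v z" "D w z" "D v u" "D w u" "D z u" "D w v" "D z v" "D z w"
    using adj in4 ne by auto
  note uf = joined_facts(1-4)[OF in4(1)] joined_facts(5-7)[OF in4(1), of a] joined_facts(5-7)[OF in4(1), of b]
    joined_facts(5-7)[OF in4(1), of c] joined_facts(5-7)[OF in4(1), of e] joined_facts(5-7)[OF in4(1), of g]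
  note vf = joined_facts(1-4)[OF in4(2)] joined_facts(5-7)[OF in4(2), of a] joined_facts(5-7)[OF in4(2), of b]
    joined_facts(5-7)[OF in4(2), of c] joined_facts(5-7)[OF in4(2), of e] joined_facts(5-7)[OF in4(2), of g]
  note wf = joined_facts(1-4)[OF in4(3)] joined_facts(5-7)[OF in4(3), of a] joined_facts(5-7)[OF in4(3), of b]
    joined_facts(5-7)[OF in4(3), of c] joined_facts(5-7)[OF in4(3), of e] joined_facts(5-7)[OF in4(3), of g]
  note zf = joined_facts(1-4)[OF in4(4)] joined_facts(5-7)[OF in4(4), of a] joined_facts(5-7)[OF in4(4), of b]
    joined_facts(5-7)[OF in4(4), of c] joined_facts(5-7)[OF in4(4), of e] joined_facts(5-7)[OF in4(4), of g]
  let ?w = "3 *\<^sub>R \<phi> u + 3 *\<^sub>R \<phi> v + 3 *\<^sub>R \<phi> w + 3 *\<^sub>R \<phi> z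
    - 4 *\<^sub>R \<phi> a - 4 *\<^sub>R \<phi> b - 4 *\<^sub>R \<phi> c - 4 *\<^sub>R \<phi> e - 4 *\<^sub>R \<phi> g + 4 *\<^sub>R \<phi> x"
  have "?w \<bullet> ?w < 0" using pf uf vf wf zf Ds ne by (simp add: inner_simps ip)
  then show False using inner_ge_zero[of ?w] by linarith
qed simp

lemma card_joined_le_1:
  assumes "\<And>w. w \<in> joined x A B \<Longrightarrow> \<phi> w = t"
  shows "card (joined x A B) \<le> 1"
proof -
  have "u = v" if "u \<in> joined x A B" "v \<in> joined x A B" for u v
    using that assms phi_inj joined_facts(1) by metis
  then have "card (joined x A B) \<le> Suc 0" by (subst card_le_Suc0_iff_eq) auto
  then show ?thesis by simp
qed

text \<open>Such a vertex completes an induced four-cycle with c, a, e and is therefore determined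
  by them.\<close>

lemma card_joined_one:
  assumes p: "pentagon x a b c e g"
  shows "card (joined x {b,c,e,g} {a}) \<le> 1"
proof -
  note pf = pentagon_facts[OF p]
  have "\<phi> w = \<phi> c + \<phi> e - \<phi> a" if w: "w \<in> joined x {b,c,e,g} {a}" for w
  proof -
    have "\<phi> w + \<phi> a = \<phi> c + \<phi> e"
      using pf joined_facts[OF w] by (intro four_cycle) auto
    then show ?thesis by (simp add: algebra_simps)
  qed
  then show ?thesis by (rule card_joined_le_1)
qed

text \<open>Again the residuals off the span of \<open>x\<close> and the pentagon have squared norm
  2/3 and inner products -1/3. Three of them sum to 0, a relation whose coefficients sum to
  1.\<close>

lemma card_joined_two:
  assumes p: "pentagon x a b c e g"
  shows "card (joined x {a,c,e} {b,g}) \<le> 2"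
proof (rule card_le_if_no_distinct_triple)
  note pf = pentagon_facts[OF p]
  fix u v w assume in3: "u \<in> joined x {a,c,e} {b,g}" "v \<in> joined x {a,c,e} {b,g}" "w \<in> joined x {a,c,e} {b,g}"
    and ne: "u \<noteq> v" "u \<noteq> w" "v \<noteq> w"
  have adj: "D y z" if "y \<in> joined x {a,c,e} {b,g}" "z \<in> joined x {a,c,e} {b,g}" "y \<noteq> z" for y z
    using joined_adjacent[of x b "{b,g}" "{b,g}"] that pf by (auto simp: nbrs_def)
  have Ds: "D u v" "D u w" "D v w" "D v u" "D w u" "D w v" using adj in3 ne by auto
  note uf = joined_facts(1-4)[OF in3(1)] joined_facts(5-7)[OF in3(1), of a] joined_facts(5-7)[OF in3(1), of c]
    joined_facts(5-7)[OF in3(1), of e] joined_facts(8-10)[OF in3(1), of b] joined_facts(8-10)[OF in3(1), of g]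
  note vf = joined_facts(1-4)[OF in3(2)] joined_facts(5-7)[OF in3(2), of a] joined_facts(5-7)[OF in3(2), of c]
    joined_facts(5-7)[OF in3(2), of e] joined_facts(8-10)[OF in3(2), of b] joined_facts(8-10)[OF in3(2), of g]
  note wf = joined_facts(1-4)[OF in3(3)] joined_facts(5-7)[OF in3(3), of a] joined_facts(5-7)[OF in3(3), of c]
    joined_facts(5-7)[OF in3(3), of e] joined_facts(8-10)[OF in3(3), of b] joined_facts(8-10)[OF in3(3), of g]
  let ?w = "\<phi> u + \<phi> v + \<phi> w + \<phi> a + \<phi> b + \<phi> g - 2 *\<^sub>R \<phi> c - 2 *\<^sub>R \<phi> e - \<phi> x"
  have "?w \<bullet> ?w = 0" using pf uf vf wf Ds ne by (simp add: inner_simps ip)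
  then have "?w = 0" by (simp only: inner_eq_zero_iff)
  then have "\<tau> \<bullet> ?w = 0" by simp
  then show False using pf uf vf wf by (simp add: inner_simps tau)
qed simp

text \<open>The two residuals off the span of \<open>x\<close> and the pentagon coincide, so w and z
  determine each other. This concerns two types that miss a common pentagon vertex, here
  \<open>b\<close>.\<close>

lemma joined_two_eq:
  assumes p: "pentagon x a b c e g" and w: "w \<in> joined x {a,c,e} {b,g}" and z: "z \<in> joined x {c,g,a} {b,e}"
  shows "\<phi> w + \<phi> a + \<phi> g = \<phi> z + \<phi> c + \<phi> e"
proof -
  note pf = pentagon_facts[OF p]
  note wf = joined_facts(1-4)[OF w] joined_facts(5-7)[OF w, of a] joined_facts(5-7)[OF w, of c]
    joined_facts(5-7)[OF w, of e] joined_facts(8-10)[OF w, of b] joined_facts(8-10)[OF w, of g]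
  note zf = joined_facts(1-4)[OF z] joined_facts(5-7)[OF z, of c] joined_facts(5-7)[OF z, of g]
    joined_facts(5-7)[OF z, of a] joined_facts(8-10)[OF z, of b] joined_facts(8-10)[OF z, of e]
  have "w \<noteq> z" using wf zf by auto
  moreover have "D w z" using joined_adjacent[of x b "{b,g}" "{b,e}", OF _ _ _ _ w z] pf \<open>w \<noteq> z\<close> by (auto simp: nbrs_def)
  moreover have "D z w" using \<open>D w z\<close> D_commute by blast
  ultimately have "(\<phi> w + \<phi> a + \<phi> g - \<phi> z - \<phi> c - \<phi> e) \<bullet> (\<phi> w + \<phi> a + \<phi> g - \<phi> z - \<phi> c - \<phi> e) = 0"
    using pf wf zf by (simp add: inner_simps ip)
  then have "\<phi> w + \<phi> a + \<phi> g - \<phi> z - \<phi> c - \<phi> e = 0" by (simp only: inner_eq_zero_iff)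
  then show ?thesis by (simp add: algebra_simps)
qed

lemma card_joined_two_two:
  assumes p: "pentagon x a b c e g"
    and ne: "joined x {a,c,e} {b,g} \<noteq> {}" "joined x {c,g,a} {b,e} \<noteq> {}"
  shows "card (joined x {a,c,e} {b,g}) \<le> 1" "card (joined x {c,g,a} {b,e}) \<le> 1"
proof -
  obtain w z where wz: "w \<in> joined x {a,c,e} {b,g}" "z \<in> joined x {c,g,a} {b,e}" using ne by auto
  have "\<phi> w' = \<phi> z + \<phi> c + \<phi> e - \<phi> a - \<phi> g" if "w' \<in> joined x {a,c,e} {b,g}" for w'
    using joined_two_eq[OF p that wz(2)] by (simp add: algebra_simps)
  then show "card (joined x {a,c,e} {b,g}) \<le> 1" by (rule card_joined_le_1)
  have "\<phi> z' = \<phi> w + \<phi> a + \<phi> g - \<phi> c - \<phi> e" if "z' \<in> joined x {c,g,a} {b,e}" for z'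
    using joined_two_eq[OF p wz(1) that] by (simp add: algebra_simps)
  then show "card (joined x {c,g,a} {b,e}) \<le> 1" by (rule card_joined_le_1)
qed

text \<open>By \<open>no_claw\<close>, a further neighbour of x misses no two consecutive vertices
  of the nonadjacency cycle. It misses none, one, or one of the five adjacent pairs, so x has at
  most 5 + 3 + 5 + 5 = 18 neighbours.\<close>

lemma no_pentagon: "\<not> pentagon x a b c e g"
proof
  assume p1: "pentagon x a b c e g"
  note p2 = pentagon_rotate[OF p1] note p3 = pentagon_rotate[OF p2]
  note p4 = pentagon_rotate[OF p3] note p5 = pentagon_rotate[OF p4]
  note pf = pentagon_facts[OF p1]
  let ?T0 = "joined x {a,b,c,e,g} {}"
  let ?S1 = "joined x {b,c,e,g} {a}" and ?S2 = "joined x {c,e,g,a} {b}" and ?S3 = "joined x {e,g,a,b} {c}"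
    and ?S4 = "joined x {g,a,b,c} {e}" and ?S5 = "joined x {a,b,c,e} {g}"
  let ?P1 = "joined x {a,c,e} {b,g}" and ?P2 = "joined x {b,e,g} {c,a}" and ?P3 = "joined x {c,g,a} {e,b}"
    and ?P4 = "joined x {e,a,b} {g,c}" and ?P5 = "joined x {g,b,c} {a,e}"
  have sub: "nbrs x \<subseteq> {a,b,c,e,g} \<union> (?T0 \<union> (?S1 \<union> (?S2 \<union> (?S3 \<union> (?S4 \<union> (?S5 \<union> (?P1 \<union> (?P2 \<union> (?P3 \<union> (?P4 \<union> ?P5))))))))))"
  proof
    fix w assume w: "w \<in> nbrs x"
    have free: "D w y \<or> D w z" if "y \<in> nbrs x" "z \<in> nbrs x" "y \<noteq> z" "\<not> D y z" "w \<noteq> y" "w \<noteq> z" for y z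
      using no_claw[of x w y z] that w pf by (auto simp: nbrs_def)
    have in_nbrs: "a \<in> nbrs x" "b \<in> nbrs x" "c \<in> nbrs x" "e \<in> nbrs x" "g \<in> nbrs x"
      using p1 by (auto simp: pentagon_def)
    show "w \<in> {a,b,c,e,g} \<union> (?T0 \<union> (?S1 \<union> (?S2 \<union> (?S3 \<union> (?S4 \<union> (?S5 \<union> (?P1 \<union> (?P2 \<union> (?P3 \<union> (?P4 \<union> ?P5))))))))))"
    proof (cases "w \<in> {a,b,c,e,g}")
      case False
      then have "D w a \<or> D w b" "D w b \<or> D w c" "D w c \<or> D w e" "D w e \<or> D w g" "D w g \<or> D w a"
        using free[OF in_nbrs(1,2)] free[OF in_nbrs(2,3)] free[OF in_nbrs(3,4)] free[OF in_nbrs(4,5)]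
          free[OF in_nbrs(5,1)] pf False by simp_all
      then show ?thesis using False w
        by (cases "D w a"; cases "D w b"; cases "D w c"; cases "D w e"; cases "D w g"; simp add: joined_def)
    qed auto
  qed
  have U: "card (A \<union> B) \<le> m + n" if "card A \<le> m" "card B \<le> n" for A B :: "'a set" and m n
    using card_Un_le[of A B] that by linarith
  have c5: "card {a,b,c,e,g} \<le> 5" by (simp add: card_insert_if)
  have S: "card ?S1 \<le> 1" "card ?S2 \<le> 1" "card ?S3 \<le> 1" "card ?S4 \<le> 1" "card ?S5 \<le> 1"
    by (rule card_joined_one, rule p1 p2 p3 p4 p5)+
  have P: "card ?P1 \<le> 2" "card ?P2 \<le> 2" "card ?P3 \<le> 2" "card ?P4 \<le> 2" "card ?P5 \<le> 2"
    by (rule card_joined_two, rule p1 p2 p3 p4 p5)+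
  have E: "joined x {c,g,a} {b,e} = ?P3" "joined x {e,a,b} {c,g} = ?P4" "joined x {g,b,c} {e,a} = ?P5"
    "joined x {a,c,e} {g,b} = ?P1" "joined x {b,e,g} {a,c} = ?P2"
    by (simp_all add: insert_commute)
  have Z: "\<And>A B. card (joined x A B) = 0 \<longleftrightarrow> joined x A B = {}" by simp
  note two = card_joined_two_two[OF p1, unfolded E] card_joined_two_two[OF p2, unfolded E]
    card_joined_two_two[OF p3, unfolded E] card_joined_two_two[OF p4, unfolded E] card_joined_two_two[OF p5, unfolded E]
  have P5: "card ?P1 + (card ?P2 + (card ?P3 + (card ?P4 + card ?P5))) \<le> 5"
    by (rule five_cycle_sum_le_5[OF P two[folded Z]])
  have "card (nbrs x) \<le> card ({a,b,c,e,g} \<union> (?T0 \<union> (?S1 \<union> (?S2 \<union> (?S3 \<union> (?S4 \<union> (?S5 \<union> (?P1 \<union> (?P2 \<union> (?P3 \<union> (?P4 \<union> ?P5)))))))))))"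
    by (rule card_mono[OF _ sub]) simp
  also have "\<dots> \<le> 5 + (3 + (1 + (1 + (1 + (1 + (1 + (card ?P1 + (card ?P2 + (card ?P3 + (card ?P4 + card ?P5))))))))))"
    by (intro U c5 card_joined_none[OF p1] S order_refl)
  finally show False using P5 card_nbrs[OF pf(1)] d_ge by linarith
qed

section \<open>Maximal cliques and the order bound\<close>

lemma D_sym: "D x y \<Longrightarrow> D y x"
  using D_commute by blast

lemma clique_insert:
  assumes "clique K" "w \<in> V" and adj: "\<And>k. k \<in> K \<Longrightarrow> k \<noteq> w \<Longrightarrow> D w k"
  shows "clique (insert w K)"
  unfolding clique_def
proof (intro conjI ballI impI)
  show "insert w K \<subseteq> V" using assms by (simp add: clique_def)
  fix a b assume ab: "a \<in> insert w K" "b \<in> insert w K" "a \<noteq> b"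
  consider "a = w" "b \<in> K" | "b = w" "a \<in> K" | "a \<in> K" "b \<in> K" using ab by blast
  then show "D a b"
  proof cases
    case 1 then show ?thesis using adj ab by blast
  next
    case 2 then show ?thesis using adj[of a] ab D_sym by blast
  next
    case 3 then show ?thesis using assms(1) ab by (auto simp: clique_def)
  qed
qed

text \<open>For coefficient sum 0 the squared norm is the sum of the squares minus twice the
  products over nonadjacent pairs. The leading eigenvalues are sqrt 2 on the path and 1 on the edge,
  so balancing the two parts gives a negative value, here 166 - 194 = -28.\<close>

lemma no_path_and_edge:
  assumes V: "x \<in> V" "{p, v, q, e, g} \<subseteq> nbrs x"
    and path: "v \<noteq> p" "v \<noteq> q" "p \<noteq> q" "\<not> D v p" "\<not> D v q" and edge: "e \<noteq> g" "\<not> D e g"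
    and adj: "D p q" "D p e" "D p g" "D v e" "D v g" "D q e" "D q g"
  shows False
proof -
  have inV: "p \<in> V" "v \<in> V" "q \<in> V" "e \<in> V" "g \<in> V" using V by (auto simp: nbrs_def)
  have sym: "D q p" "D e p" "D g p" "D e v" "D g v" "D e q" "D g q" "\<not> D p v" "\<not> D q v" "\<not> D g e"
    using adj path edge by (simp_all only: D_commute, simp_all)
  have ne: "p \<noteq> e" "p \<noteq> g" "v \<noteq> e" "v \<noteq> g" "q \<noteq> e" "q \<noteq> g" using adj D_irrefl by auto
  \<comment> \<open>coefficients with sum 0 approximating the leading eigenvectors of a path and an edge\<close>
  let ?w = "4 *\<^sub>R \<phi> p + 6 *\<^sub>R \<phi> v + 4 *\<^sub>R \<phi> q - 7 *\<^sub>R \<phi> e - 7 *\<^sub>R \<phi> g"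
  have "?w \<bullet> ?w < 0" using inV path edge adj sym ne by (simp add: inner_simps ip)
  then show False using inner_ge_zero[of ?w] by linarith
qed

lemma nbrs_iff: "y \<in> nbrs x \<longleftrightarrow> y \<in> V \<and> D x y" by (simp add: nbrs_def)

lemma clique_subset_nbrs: "clique K \<Longrightarrow> a \<in> K \<Longrightarrow> K - {a} \<subseteq> nbrs a"
proof
  assume K: "clique K" "a \<in> K"
  fix y assume "y \<in> K - {a}"
  then have "y \<in> V" "D a y" using K unfolding clique_def by auto
  then show "y \<in> nbrs a" by (simp add: nbrs_iff)
qed

lemma clique_insert_nbrs: "x \<in> V \<Longrightarrow> clique K \<Longrightarrow> K \<subseteq> nbrs x \<Longrightarrow> clique (insert x K)"
  by (rule clique_insert) (use nbrs_iff in blast)+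

lemma insert_large: 
  assumes "x \<in> V" "clique K" "K \<subseteq> nbrs x" "8 \<le> card K"
  shows "\<exists>K. clique K \<and> x \<in> K \<and> 9 \<le> card K"
proof (intro exI[of _ "insert x K"] conjI)
  show "clique (insert x K)" using assms clique_insert_nbrs by auto
  have "x \<notin> K" using assms D_irrefl by (auto simp: nbrs_def)
  then show "9 \<le> card (insert x K)" using assms clique_finite by simp
qed simp

text \<open>\<open>N1\<close> is a clique by \<open>no_claw\<close>. Two nonadjacent members of
  \<open>N2\<close> would close a pentagon through \<open>v\<close> and their missed vertices in
  \<open>N1\<close>. A nonadjacent pair in \<open>R\<close> would contradict
  \<open>no_path_and_edge\<close> together with p, v, q. Hence two cliques cover the
  neighbourhood.\<close>

lemma large_clique_if_path:
  assumes xV: "x \<in> V" and n: "p \<in> nbrs x" "v \<in> nbrs x" "q \<in> nbrs x" "v \<noteq> p" "v \<noteq> q" "p \<noteq> q" "\<not> D v p" "\<not> D v q"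
  shows "\<exists>K. clique K \<and> x \<in> K \<and> 9 \<le> card K"
proof -
  define N1 where "N1 = {w\<in>nbrs x. w \<noteq> v \<and> \<not> D v w}"
  define N2 where "N2 = {w\<in>nbrs x. w \<noteq> v \<and> D v w \<and> (\<exists>m\<in>N1. m \<noteq> w \<and> \<not> D m w)}"
  define R where "R = {w\<in>nbrs x. w \<noteq> v \<and> D v w \<and> (\<forall>m\<in>N1. m \<noteq> w \<longrightarrow> D m w)}"
  have sym: "D b a" if "D a b" for a b using that D_commute by blast
  have vV: "v \<in> V" using n by (simp add: nbrs_iff)
  have noclaw: "D b c" if "a \<in> nbrs x" "b \<in> nbrs x" "c \<in> nbrs x" "a \<noteq> b" "a \<noteq> c" "b \<noteq> c" "\<not> D a b" "\<not> D a c" for a b c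
    using no_claw[of x a b c] xV that by (auto simp: nbrs_iff)
  have A: "clique (insert v N2)"
  proof -
    have adj: "D a b" if ab: "a \<in> N2" "b \<in> N2" "a \<noteq> b" for a b
    proof (rule ccontr)
      assume nab: "\<not> D a b"
      obtain a' where a': "a' \<in> N1" "a' \<noteq> a" "\<not> D a' a" using ab by (auto simp: N2_def)
      obtain b' where b': "b' \<in> N1" "b' \<noteq> b" "\<not> D b' b" using ab by (auto simp: N2_def)
      have W: "a \<in> nbrs x" "b \<in> nbrs x" "a' \<in> nbrs x" "b' \<in> nbrs x" using ab a' b' by (auto simp: N1_def N2_def)
      have v: "v \<noteq> a" "v \<noteq> b" "D v a" "D v b" using ab by (auto simp: N2_def)
      have v': "v \<noteq> a'" "v \<noteq> b'" "\<not> D v a'" "\<not> D v b'" using a' b' by (auto simp: N1_def)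
      have "a' \<noteq> b" "b' \<noteq> a" using v v' by auto
      have a'b: "D a' b" using noclaw[of a b a'] W ab(3) nab a'(2,3) \<open>a' \<noteq> b\<close> sym by blast
      have ab': "D a b'" using noclaw[of b a b'] W ab(3) nab b'(2,3) \<open>b' \<noteq> a\<close> sym by blast
      have "a' \<noteq> b'" using a'b b' by auto
      have "D a' b'" using noclaw[of v a' b'] W n(2) v' \<open>a' \<noteq> b'\<close> by blast
      have "pentagon x v a' a b b'"
        unfolding pentagon_def using xV n(2) W v v' a' b' nab ab(3) a'b ab' \<open>D a' b'\<close> sym by blast
      then show False using no_pentagon by blast
    qed
    have "N2 \<subseteq> V" by (auto simp: N2_def nbrs_iff)
    then have "clique N2" unfolding clique_def using adj by blast
    then show ?thesis by (rule clique_insert[OF _ vV]) (simp add: N2_def)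
  qed
  have B: "clique (N1 \<union> R)"
  proof -
    have 1: "D a b" if "a \<in> N1" "b \<in> N1" "a \<noteq> b" for a b
      using noclaw[of v a b] that n by (auto simp: N1_def)
    have 2: "D a b" if "a \<in> N1" "b \<in> R" for a b
      using that by (auto simp: N1_def R_def)
    have 3: "D a b" if ab: "a \<in> R" "b \<in> R" "a \<noteq> b" for a b
    proof (rule ccontr)
      assume nab: "\<not> D a b"
      have N: "p \<in> N1" "q \<in> N1" using n by (auto simp: N1_def)
      show False
      proof (rule no_path_and_edge[of x p v q a b])
        show "{p, v, q, a, b} \<subseteq> nbrs x" using n ab by (auto simp: R_def)
      qed (use xV n ab nab 1[OF N n(6)] 2[OF N(1) ab(1)] 2[OF N(1) ab(2)] 2[OF N(2) ab(1)] 2[OF N(2) ab(2)] in \<open>simp_all add: R_def\<close>)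
    qed
    show ?thesis unfolding clique_def
    proof (intro conjI ballI impI)
      show "N1 \<union> R \<subseteq> V" by (auto simp: N1_def R_def nbrs_iff)
      fix a b assume "a \<in> N1 \<union> R" "b \<in> N1 \<union> R" "a \<noteq> b"
      then show "D a b" using 1 2 3 sym by blast
    qed
  qed
  have "nbrs x = insert v N2 \<union> (N1 \<union> R)" using n by (auto simp: N1_def N2_def R_def)
  then have "d \<le> card (insert v N2) + card (N1 \<union> R)" using card_nbrs[OF xV] card_Un_le by metis
  then have "8 \<le> card (insert v N2) \<or> 8 \<le> card (N1 \<union> R)" using d_ge by linarith
  moreover have "insert v N2 \<subseteq> nbrs x" "N1 \<union> R \<subseteq> nbrs x" using n by (auto simp: N1_def N2_def R_def)
  ultimately show ?thesis using insert_large[OF xV A] insert_large[OF xV B] by blast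
qed

text \<open>Here nonadjacency within the neighbourhood is a matching. A maximal clique contains a
  non-neighbour of each outside vertex, and this choice is injective, so the clique fills at least
  half of the neighbourhood.\<close>

lemma large_clique_if_matching:
  assumes xV: "x \<in> V" and no: "\<And>p v q. p \<in> nbrs x \<Longrightarrow> v \<in> nbrs x \<Longrightarrow> q \<in> nbrs x \<Longrightarrow> v \<noteq> p \<Longrightarrow> v \<noteq> q \<Longrightarrow>
    p \<noteq> q \<Longrightarrow> \<not> D v p \<Longrightarrow> \<not> D v q \<Longrightarrow> False"
  shows "\<exists>K. clique K \<and> x \<in> K \<and> 9 \<le> card K"
proof -
  let ?F = "{K\<in>Pow (nbrs x). clique K}"
  have "finite ?F" "?F \<noteq> {}" by (auto simp: clique_def)
  then obtain K where K: "K \<in> ?F" "\<And>K'. K' \<in> ?F \<Longrightarrow> K \<subseteq> K' \<Longrightarrow> K = K'"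
    using finite_has_maximal[of ?F] by metis
  have KW: "K \<subseteq> nbrs x" "clique K" using K by auto
  have "\<exists>k\<in>K. k \<noteq> w \<and> \<not> D k w" if w: "w \<in> nbrs x - K" for w
  proof (rule ccontr)
    assume "\<not> ?thesis"
    then have "D w k" if "k \<in> K" "k \<noteq> w" for k using that D_sym by blast
    then have "clique (insert w K)" using KW w by (intro clique_insert) (auto simp: nbrs_iff)
    then show False using K(2)[of "insert w K"] w KW by auto
  qed
  then obtain m where m: "\<And>w. w \<in> nbrs x - K \<Longrightarrow> m w \<in> K \<and> m w \<noteq> w \<and> \<not> D (m w) w" by metis
  have "inj_on m (nbrs x - K)"
  proof (rule inj_onI, rule ccontr)
    fix a b assume "a \<in> nbrs x - K" "b \<in> nbrs x - K" "m a = m b" "a \<noteq> b"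
    then show False using no[of a "m a" b] m[of a] m[of b] KW by auto
  qed
  then have "card (nbrs x - K) \<le> card K"
    using m clique_finite[OF KW(2)] by (intro card_inj_on_le[of m]) auto
  moreover have "card (nbrs x - K) = d - card K"
    using card_Diff_subset[OF clique_finite[OF KW(2)] KW(1)] card_nbrs[OF xV] by simp
  ultimately have "8 \<le> card K" using d_ge by linarith
  then show ?thesis using insert_large xV KW by blast
qed

lemma exists_large_clique:
  assumes xV: "x \<in> V"
  shows "\<exists>K. clique K \<and> x \<in> K \<and> 9 \<le> card K"
proof (rule ccontr)
  assume none: "\<not> ?thesis"
  show False
    by (rule notE[OF none large_clique_if_matching[OF xV]], rule notE[OF none], rule large_clique_if_path[OF xV])
qed

text \<open>Each vertex of \<open>nbrs x - K\<close> has at most two neighbours in \<open>K\<close>,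
  so two of them have a common non-neighbour there, as 4 < 9. If they were nonadjacent, all three
  would form a claw at x.\<close>

lemma clique_complement:
  assumes K: "clique K" "9 \<le> card K" and mx: "\<And>w. w \<in> V - K \<Longrightarrow> \<exists>k\<in>K. \<not> D w k" and x: "x \<in> K"
  shows "clique (insert x (nbrs x - K))" "card (nbrs x - K) + card K = d + 1"
proof -
  have xV: "x \<in> V" and finK: "finite K" using K x clique_finite by (auto simp: clique_def)
  have few: "card (K \<inter> nbrs w) \<le> 2" if w: "w \<in> nbrs x - K" for w
    using few_nbrs[OF K, of w] mx[of w] w by (auto simp: nbrs_iff)
  have "D w w'" if w: "w \<in> nbrs x - K" "w' \<in> nbrs x - K" "w \<noteq> w'" for w w'
  proof (rule ccontr)
    assume nD: "\<not> D w w'"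
    have "card ((K \<inter> nbrs w) \<union> (K \<inter> nbrs w')) < card K"
      using few[OF w(1)] few[OF w(2)] card_Un_le[of "K \<inter> nbrs w" "K \<inter> nbrs w'"] K(2) by linarith
    then have "\<not> K \<subseteq> (K \<inter> nbrs w) \<union> (K \<inter> nbrs w')"
      using card_mono[of "(K \<inter> nbrs w) \<union> (K \<inter> nbrs w')" K] finK by auto
    then obtain k where k: "k \<in> K" "k \<notin> nbrs w" "k \<notin> nbrs w'" by auto
    have kV: "k \<in> V" using k K by (auto simp: clique_def)
    then have nk: "\<not> D w k" "\<not> D w' k" using k by (auto simp: nbrs_iff)
    have wx: "w \<in> V" "w' \<in> V" "D x w" "D x w'" using w by (auto simp: nbrs_iff)
    then have "D w x" using D_commute by blast
    then have "k \<noteq> x" using nk by auto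
    then have "D x k" using K x k by (auto simp: clique_def)
    moreover have "w \<noteq> k" "w' \<noteq> k" using w k by auto
    ultimately show False using no_claw[of x w w' k] xV wx kV w(3) nD nk by blast
  qed
  then have "clique (nbrs x - K)" by (auto simp: clique_def nbrs_iff)
  then show "clique (insert x (nbrs x - K))" using clique_insert_nbrs[OF xV] by auto
  have "nbrs x \<inter> K = K - {x}" using K x D_irrefl by (auto simp: clique_def nbrs_iff)
  moreover have "card (nbrs x) = card (nbrs x \<inter> K) + card (nbrs x - K)"
    by (subst card_Un_disjoint[symmetric]) (auto intro: arg_cong[where f = card])
  moreover have "card (K - {x}) + 1 = card K" using x finK K(2) by simp
  ultimately show "card (nbrs x - K) + card K = d + 1" using card_nbrs[OF xV] by simp
qed

section \<open>Counting the edges that leave a maximal clique\<close>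

lemma edge_count:
  assumes K: "K \<subseteq> V" and m: "\<And>x. x \<in> K \<Longrightarrow> card (nbrs x - K) = m"
    and q: "\<And>y. y \<in> V - K \<Longrightarrow> card (K \<inter> nbrs y) \<le> q"
  shows "card K * m \<le> q * (card V - card K)"
proof -
  have fin: "finite K" "finite (V - K)" using K finV finite_subset by auto
  have "card K * m = (\<Sum>x\<in>K. card {y\<in>V - K. D x y})"
    using m by (simp add: nbrs_def set_diff_eq conj_commute conj_left_commute)
  also have "\<dots> = (\<Sum>y\<in>V - K. card {x\<in>K. D x y})"
    by (rule sum_multicount_gen) (use fin in auto)
  also have "\<dots> \<le> (\<Sum>y\<in>V - K. q)"
  proof (rule sum_mono)
    fix y assume y: "y \<in> V - K"
    have "{x\<in>K. D x y} = K \<inter> nbrs y" using K D_sym unfolding nbrs_def by blast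
    then show "card {x\<in>K. D x y} \<le> q" using q[OF y] by simp
  qed
  also have "\<dots> = q * (card V - card K)" using card_Diff_subset[OF fin(1) K] by simp
  finally show ?thesis .
qed

text \<open>The size is maximal among all cliques through \<open>x\<close>, not only under
  inclusion: comparison with the second clique \<open>insert x (nbrs x - K)\<close> then shows that
  \<open>K\<close> contains at least half of the closed neighbourhood.\<close>

definition max_clique :: "'a \<Rightarrow> 'a set \<Rightarrow> bool" where
  "max_clique x K \<longleftrightarrow> clique K \<and> x \<in> K \<and> (\<forall>K'. clique K' \<and> x \<in> K' \<longrightarrow> card K' \<le> card K)"

lemma ex_max_clique: assumes "x \<in> V" shows "\<exists>K. max_clique x K"
proof -
  obtain K0 where K0: "clique K0 \<and> x \<in> K0" using exists_large_clique[OF assms] by blast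
  have "\<forall>K. clique K \<and> x \<in> K \<longrightarrow> card K \<le> card V"
    using finV by (auto simp: clique_def card_mono)
  then have "\<forall>K. clique K \<and> x \<in> K \<longrightarrow> card K < Suc (card V)" by (simp add: less_Suc_eq_le)
  from ex_has_greatest_nat[where P = "\<lambda>K. clique K \<and> x \<in> K", OF K0 this] show ?thesis
    unfolding max_clique_def by blast
qed

lemma max_clique_props:
  assumes "max_clique x K"
  shows "clique K" "x \<in> K" "K \<subseteq> V" "x \<in> V" "finite K" "9 \<le> card K"
    "w \<in> V - K \<Longrightarrow> \<exists>k\<in>K. \<not> D w k" "z \<in> K \<Longrightarrow> card (nbrs z - K) + card K = d + 1" "d + 2 \<le> 2 * card K"
    "z \<in> K \<Longrightarrow> clique (insert z (nbrs z - K))"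
proof -
  show K: "clique K" "x \<in> K" "K \<subseteq> V" "x \<in> V" "finite K"
    using assms clique_finite by (auto simp: max_clique_def clique_def)
  have le: "card K' \<le> card K" if "clique K'" "x \<in> K'" for K' using that assms by (auto simp: max_clique_def)
  show K9: "9 \<le> card K" using le exists_large_clique[OF K(4)] by (meson order_trans)
  have mx: "\<exists>k\<in>K. \<not> D w k" if w: "w \<in> V - K" for w
  proof (rule ccontr)
    assume "\<not> ?thesis"
    then have "clique (insert w K)" using K w by (intro clique_insert) auto
    then have "card (insert w K) \<le> card K" using le K by auto
    then show False using w K by simp
  qed
  then show "w \<in> V - K \<Longrightarrow> \<exists>k\<in>K. \<not> D w k" .
  have cc: "clique (insert z (nbrs z - K))" "card (nbrs z - K) + card K = d + 1" if "z \<in> K" for z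
    using clique_complement[OF K(1) K9 _ that] mx by blast+
  then show "z \<in> K \<Longrightarrow> card (nbrs z - K) + card K = d + 1" "z \<in> K \<Longrightarrow> clique (insert z (nbrs z - K))" by auto
  have "card (insert x (nbrs x - K)) \<le> card K" using le[OF cc(1)[OF K(2)]] K(2) by simp
  then show "d + 2 \<le> 2 * card K" using cc(2)[OF K(2)] K(2) by simp
qed

lemma int_mult_diff_le:
  fixes k m q n :: nat
  assumes "k * (m + 1 - k) \<le> q * (n - k)" "k \<le> m + 1" "k \<le> n"
  shows "int k * (int m + 1 - int k) \<le> int q * (int n - int k)"
proof -
  have "int (k * (m + 1 - k)) \<le> int (q * (n - k))" using assms(1) by (simp only: of_nat_le_iff)
  then show ?thesis using assms(2,3) by (simp add: of_nat_diff add.commute)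
qed

lemma large_order_impossible:
  assumes u: "3 \<le> u" and s: "7 * u \<le> s + 4" and t: "1 \<le> t"
    and n: "card V = u * s + t" and d: "d + 2 = u + s + t"
    and bound: "\<And>K. clique K \<Longrightarrow> u * card K \<le> card V"
  shows False
proof -
  have few: "card (K \<inter> nbrs y) \<le> 2" if K: "max_clique x K" and y: "y \<in> V - K" for x y K
  proof -
    obtain k where "k \<in> K" "\<not> D y k" using max_clique_props(7)[OF K y] by blast
    then show ?thesis using few_nbrs[of K y] max_clique_props(1,6)[OF K] y by blast
  qed
  \<comment> \<open>The margin serves the disjointness argument in \<open>one\<close>: two
    intersecting maximal cliques there would have sizes adding up to at most d + 3.\<close>
  have big: "d + 4 \<le> 2 * card K" if K: "max_clique x K" for x K
  proof (rule ccontr)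
    assume small: "\<not> d + 4 \<le> 2 * card K"
    note Kp = max_clique_props[OF K]
    have "card K * (d + 1 - card K) \<le> 2 * (card V - card K)"
      using edge_count[OF Kp(3), of "d + 1 - card K" 2] Kp(8) few[OF K] by (metis diff_add_inverse2)
    moreover have "card K \<le> d + 1" using Kp(8)[OF Kp(2)] by simp
    moreover have "card K \<le> card V" using Kp finV card_mono by auto
    ultimately have "int (card K) * (int d + 1 - int (card K)) \<le> 2 * (int (card V) - int (card K))"
      using int_mult_diff_le[of "card K" d 2 "card V"] by simp
    moreover define a U S T where defs: "a = int (card K)" "U = int u" "S = int s" "T = int t"
    moreover have "int d = U + S + T - 2" "int (card V) = U * S + T" using n d defs by auto
    ultimately have c: "a * (U + S + T - 1 - a) \<le> 2 * (U * S + T - a)" by (simp add: algebra_simps)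
    have a: "U + S + T \<le> 2 * a" "2 * a \<le> U + S + T + 1" using small Kp(9) d defs by linarith+
    have ge: "U \<ge> 3" "S \<ge> 7 * U - 4" "T \<ge> 1" using u s t defs by linarith+
    \<comment> \<open>\<open>2 * a\<close> is one of two consecutive integers; the product handles
      both cases together.\<close>
    have "(2 * a - (U + S + T)) * (2 * a - (U + S + T + 1)) \<le> 0" 
      using a by (intro mult_nonneg_nonpos) auto
    then have "(U + S + T) * (U + S + T + 2) \<le> 4 * (a * (U + S + T + 1 - a))"
      using a by (simp add: algebra_simps)
    also have "\<dots> \<le> 8 * (U * S + T)" using c by (simp add: algebra_simps)
    finally have "S * (S - 6 * U + 2) + U * U + 2 * U + T * (2 * U + 2 * S - 6) + T * T \<le> 0"
      by (simp add: algebra_simps)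
    \<comment> \<open>The assumed size of \<open>S\<close> makes \<open>S - 6 * U + 2\<close> at
      least \<open>U - 2\<close>.\<close>
    moreover have "0 \<le> S * (S - 6 * U + 2)" "0 < U * U" "0 \<le> T * (2 * U + 2 * S - 6)" "0 \<le> T * T" using ge by auto
    ultimately show False using ge by linarith
  qed
  have one: "card (K \<inter> nbrs y) \<le> 1" if K: "max_clique x K" and y: "y \<in> V - K" for x y K
  proof (rule ccontr)
    assume "\<not> card (K \<inter> nbrs y) \<le> 1"
    then have two: "card (K \<inter> nbrs y) = 2" using few[OF K y] by linarith
    then obtain x1 x2 where x12: "K \<inter> nbrs y = {x1, x2}" "x1 \<noteq> x2" by (auto simp: card_2_iff)
    obtain K' where K': "max_clique y K'" using ex_max_clique y by blast
    note Kp = max_clique_props[OF K] note Kp' = max_clique_props[OF K']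
    have disj: "K \<inter> K' = {}"
    proof (rule ccontr)
      assume "K \<inter> K' \<noteq> {}"
      then obtain z where z: "z \<in> K" "z \<in> K'" by auto
      have "K' \<inter> K \<subseteq> K \<inter> nbrs y" using clique_subset_nbrs[OF Kp'(1,2)] y by blast
      then have 1: "card (K' \<inter> K) \<le> 2" using card_mono[of "K \<inter> nbrs y" "K' \<inter> K"] two by simp
      have "K' - K \<subseteq> nbrs z - K" using clique_subset_nbrs[OF Kp'(1) z(2)] z(1) by blast
      then have "card (K' - K) \<le> card (nbrs z - K)" by (intro card_mono) auto
      then have 2: "card (K' - K) + card K \<le> d + 1" using Kp(8)[OF z(1)] by linarith
      have "card K' = card (K' \<inter> K) + card (K' - K)"
        using Kp'(5) by (subst card_Un_disjoint[symmetric]) (auto intro: arg_cong[where f = card])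
      then show False using 1 2 big[OF K] big[OF K'] by linarith
    qed
    \<comment> \<open>A third vertex of the second clique at \<open>y\<close> is needed. The bound
      on \<open>card K'\<close> gives \<open>u * card B \<ge> u * (u - 1) + (u - 1) * t\<close>,
      hence \<open>card B \<ge> u\<close>.\<close>
    define B where "B = nbrs y - K'"
    have "u * card K' \<le> u * s + t" using bound[OF Kp'(1)] n by simp
    moreover have "card B + card K' = u + s + t - 1" using Kp'(8)[OF Kp'(2)] d by (simp add: B_def)
    then have "u * card B + u * card K' = u * (u + s + t - 1)" by (metis add_mult_distrib2)
    moreover have "int (u * (u + s + t - 1)) = int u * (int u + int s + int t - 1)" using u by (simp add: of_nat_diff)
    ultimately have "int u * (int u + int s + int t - 1) \<le> int u * int (card B) + int u * int s + int t"
      by (metis (no_types, lifting) add.commute add_le_cancel_left of_nat_add of_nat_le_iff of_nat_mult add.assoc)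
    then have "int u * (int u - 1 - int (card B)) + (int u - 1) * int t \<le> 0" by (simp add: algebra_simps)
    moreover have "0 < (int u - 1) * int t" using u t by auto
    ultimately have "int u * (int u - 1 - int (card B)) < 0" by linarith
    then have "int u - 1 - int (card B) < 0" by (simp add: mult_less_0_iff)
    then have B3: "3 \<le> card B" using u by linarith
    have "x1 \<in> B" "x2 \<in> B" using x12 disj by (auto simp: B_def)
    have "\<not> B \<subseteq> {x1, x2}"
      using card_mono[of "{x1, x2}" B] B3 x12(2) by auto
    then obtain z where z: "z \<in> B" "z \<noteq> x1" "z \<noteq> x2" by auto
    have zK: "z \<notin> K" using z x12 by (auto simp: B_def)
    have cB: "clique (insert y B)" using Kp'(10)[OF Kp'(2)] by (simp add: B_def)
    have zV: "z \<in> V" using z by (auto simp: B_def nbrs_iff)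
    have "y \<notin> B" using D_irrefl by (auto simp: B_def nbrs_iff)
    then have Dz: "D z x1" "D z x2" "D y z"
      using cB z \<open>x1 \<in> B\<close> \<open>x2 \<in> B\<close> by (auto simp: clique_def)
    have sub: "{x1, x2} \<subseteq> K \<inter> nbrs z" using Dz x12 by (auto simp: nbrs_iff)
    have "card (K \<inter> nbrs z) \<le> card {x1, x2}" using few[OF K, of z] zV zK x12(2) by simp
    then have "K \<inter> nbrs z = {x1, x2}" using card_seteq[OF _ sub] by auto
    then show False
      using same_two_nbrs[OF Kp(1,6), of y z x1 x2] y zV zK x12 Dz by auto
  qed
  obtain x where x: "x \<in> V" using card_V by fastforce
  obtain K where K: "max_clique x K" using ex_max_clique x by blast
  note Kp = max_clique_props[OF K]
  have "card K * (d + 1 - card K) \<le> 1 * (card V - card K)"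
    using edge_count[OF Kp(3), of "d + 1 - card K" 1] Kp(8) one[OF K] by (metis diff_add_inverse2)
  moreover have "card K \<le> d + 1" using Kp(8)[OF Kp(2)] by simp
  moreover have "card K \<le> card V" using Kp finV card_mono by auto
  ultimately have "int (card K) * (int d + 1 - int (card K)) \<le> int (card V) - int (card K)"
    using int_mult_diff_le[of "card K" d 1 "card V"] by simp
  moreover define a U S T N where defs: "a = int (card K)" "U = int u" "S = int s" "T = int t" "N = U * S + T"
  moreover have dN: "int d = U + S + T - 2" "int (card V) = N" using n d defs by auto
  ultimately have c: "a * (U + S + T - a) \<le> N" by (simp add: algebra_simps)
  have a: "U + S + T \<le> 2 * a" using Kp(9) d defs by linarith
  have ge: "U \<ge> 3" "S \<ge> 7 * U - 4" "T \<ge> 1" using u s t defs by linarith+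
  have aN: "U * a \<le> N" using bound[OF Kp(1)] dN(2) defs by (metis of_nat_le_iff of_nat_mult)
  \<comment> \<open>The next product compares the quadratic a (U + S + T - a) at a with its value at
    N / U without dividing.\<close>
  have "U * (U + S + T) \<le> U * (2 * a)" using a ge by (intro mult_left_mono) auto
  then have "0 \<le> (N - U * a) * (N + U * a - U * (U + S + T))" using aN by (intro mult_nonneg_nonneg) linarith+
  then have "N * (U * (U + S + T) - N) \<le> U * U * (a * (U + S + T - a))" by (simp add: algebra_simps)
  also have "\<dots> \<le> U * U * N" using c ge by (intro mult_left_mono) auto
  finally have "N * (T * (U - 1)) \<le> 0" by (simp add: defs algebra_simps)
  moreover have "0 < N" using ge by (auto simp: defs intro!: add_nonneg_pos)
  moreover have "0 < T * (U - 1)" using ge by auto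
  ultimately show False using mult_pos_pos[of N "T * (U - 1)"] by linarith
qed

end

section \<open>Gram vectors and quadratic forms\<close>

text \<open>Finitely supported sequences provide one inner product space for Gram matrices of any size.\<close>

typedef fsvec = "{f :: nat \<Rightarrow> real. finite {i. f i \<noteq> 0}}"
  morphisms coord Abs_fsvec
  by (rule exI[of _ "\<lambda>_. 0"]) simp

setup_lifting type_definition_fsvec

lemma finite_support [simp]: "finite {i. coord x i \<noteq> 0}"
  using coord[of x] by simp

instantiation fsvec :: real_vector
begin

lift_definition zero_fsvec :: fsvec is "\<lambda>_. 0" by simp
lift_definition plus_fsvec :: "fsvec \<Rightarrow> fsvec \<Rightarrow> fsvec" is "\<lambda>f g i. f i + g i"
  subgoal for f g by (rule finite_subset[of _ "{i. f i \<noteq> 0} \<union> {i. g i \<noteq> 0}"]) auto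
  done
lift_definition uminus_fsvec :: "fsvec \<Rightarrow> fsvec" is "\<lambda>f i. - f i" by simp
lift_definition minus_fsvec :: "fsvec \<Rightarrow> fsvec \<Rightarrow> fsvec" is "\<lambda>f g i. f i - g i"
  subgoal for f g by (rule finite_subset[of _ "{i. f i \<noteq> 0} \<union> {i. g i \<noteq> 0}"]) auto
  done
lift_definition scaleR_fsvec :: "real \<Rightarrow> fsvec \<Rightarrow> fsvec" is "\<lambda>c f i. c * f i"
  subgoal for c f by (rule finite_subset[of _ "{i. f i \<noteq> 0}"]) auto
  done

instance
  by standard (transfer; auto simp: algebra_simps fun_eq_iff)+

end

instantiation fsvec :: real_inner
begin

definition inner_fsvec :: "fsvec \<Rightarrow> fsvec \<Rightarrow> real" where
  "inner_fsvec x y = (\<Sum>i | coord x i \<noteq> 0. coord x i * coord y i)"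
definition norm_fsvec :: "fsvec \<Rightarrow> real" where "norm_fsvec x = sqrt (x \<bullet> x)"
definition sgn_fsvec :: "fsvec \<Rightarrow> fsvec" where "sgn_fsvec x = x /\<^sub>R norm x"
definition dist_fsvec :: "fsvec \<Rightarrow> fsvec \<Rightarrow> real" where "dist_fsvec x y = norm (x - y)"
definition uniformity_fsvec :: "(fsvec \<times> fsvec) filter" where
  "uniformity_fsvec = (INF e\<in>{0<..}. principal {(x, y). dist x y < e})"
definition open_fsvec :: "fsvec set \<Rightarrow> bool" where
  "open_fsvec U \<longleftrightarrow> (\<forall>x\<in>U. eventually (\<lambda>(x', y). x' = x \<longrightarrow> y \<in> U) uniformity)"

lemma inner_fsvec_superset:
  "finite I \<Longrightarrow> {i. coord x i \<noteq> 0} \<subseteq> I \<Longrightarrow> x \<bullet> y = (\<Sum>i\<in>I. coord x i * coord y i)"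
  unfolding inner_fsvec_def by (rule sum.mono_neutral_left) auto

instance
proof
  fix x y z :: fsvec and r :: real
  show "dist x y = norm (x - y)" "sgn x = x /\<^sub>R norm x" "norm x = sqrt (x \<bullet> x)"
    "uniformity = (INF e\<in>{0<..}. principal {(x :: fsvec, y). dist x y < e})"
    "open U = (\<forall>x\<in>U. \<forall>\<^sub>F (x', y) in uniformity. x' = x \<longrightarrow> y \<in> U)" for U :: "fsvec set"
    by (simp_all add: dist_fsvec_def sgn_fsvec_def norm_fsvec_def uniformity_fsvec_def open_fsvec_def)
  let ?I = "{i. coord x i \<noteq> 0} \<union> {i. coord y i \<noteq> 0} \<union> {i. coord z i \<noteq> 0}"
  have I: "a \<bullet> b = (\<Sum>i\<in>?I. coord a i * coord b i)" if "{i. coord a i \<noteq> 0} \<subseteq> ?I" for a b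
    by (rule inner_fsvec_superset[OF _ that]) simp
  show "x \<bullet> y = y \<bullet> x" using I[of x y] I[of y x] by (simp add: mult.commute subset_iff)
  have "{i. coord (x + y) i \<noteq> 0} \<subseteq> ?I" "{i. coord (r *\<^sub>R x) i \<noteq> 0} \<subseteq> ?I"
    by (auto simp: plus_fsvec.rep_eq scaleR_fsvec.rep_eq)
  then show "(x + y) \<bullet> z = x \<bullet> z + y \<bullet> z" "(r *\<^sub>R x) \<bullet> y = r * (x \<bullet> y)"
    using I[of x z] I[of y z] I[of "x + y" z] I[of "r *\<^sub>R x" y] I[of x y]
    by (simp_all add: subset_iff plus_fsvec.rep_eq scaleR_fsvec.rep_eq distrib_right sum.distrib sum_distrib_left mult.assoc)
  show nn: "0 \<le> x \<bullet> x" by (simp add: inner_fsvec_def sum_nonneg)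
  show "x \<bullet> x = 0 \<longleftrightarrow> x = 0"
  proof
    assume "x \<bullet> x = 0"
    then have "\<forall>i\<in>{i. coord x i \<noteq> 0}. coord x i * coord x i = 0"
      unfolding inner_fsvec_def by (subst (asm) sum_nonneg_eq_0_iff) auto
    then have "coord x = coord 0" by (auto simp: zero_fsvec.rep_eq fun_eq_iff)
    then show "x = 0" by (simp add: coord_inject)
  qed (simp add: inner_fsvec_def zero_fsvec.rep_eq)
qed

end

lemma ex_unit_orthogonal:
  fixes S :: "fsvec set"
  assumes "finite S"
  shows "\<exists>e. e \<bullet> e = 1 \<and> (\<forall>v\<in>S. e \<bullet> v = 0)"
proof -
  have "finite (\<Union>v\<in>S. {i. coord v i \<noteq> 0})" using assms by simp
  then obtain j where j: "\<And>v. v \<in> S \<Longrightarrow> coord v j = 0"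
    using ex_new_if_finite[OF infinite_UNIV_nat] by blast
  let ?e = "Abs_fsvec (\<lambda>i. if i = j then 1 else 0)"
  have c: "coord ?e = (\<lambda>i. if i = j then 1 else 0)" by (rule Abs_fsvec_inverse) simp
  have "?e \<bullet> v = coord v j" for v by (simp add: inner_fsvec_def c)
  then show ?thesis using j c by (intro exI[of _ ?e]) auto
qed

text \<open>Cholesky decomposition, one vertex at a time. If the new diagonal entry is 0, its whole
  row vanishes; otherwise the Schur complement is represented by induction, and a fresh orthogonal
  direction is added for \<open>a\<close>.\<close>

lemma gram_embedding:
  fixes K :: "'a \<Rightarrow> 'a \<Rightarrow> real"
  assumes "finite V" and "\<And>x y. K x y = K y x"
    and "\<And>c. 0 \<le> (\<Sum>x\<in>V. \<Sum>y\<in>V. c x * c y * K x y)"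
  shows "\<exists>\<phi> :: 'a \<Rightarrow> fsvec. \<forall>x\<in>V. \<forall>y\<in>V. \<phi> x \<bullet> \<phi> y = K x y"
  using assms
proof (induction V arbitrary: K rule: finite_induct)
  case (insert a V)
  note sym = insert.prems(1) and psd = insert.prems(2)
  have expand: "(\<Sum>x\<in>insert a V. \<Sum>y\<in>insert a V. c x * c y * K x y) =
    c a * c a * K a a + 2 * c a * (\<Sum>y\<in>V. c y * K a y) + (\<Sum>x\<in>V. \<Sum>y\<in>V. c x * c y * K x y)" for c
  proof -
    have "(\<Sum>x\<in>V. c x * c a * K x a) = c a * (\<Sum>y\<in>V. c y * K a y)"
      by (simp add: sum_distrib_left mult_ac sym[of _ a])
    moreover have "(\<Sum>y\<in>V. c a * c y * K a y) = c a * (\<Sum>y\<in>V. c y * K a y)"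
      by (simp add: sum_distrib_left mult_ac)
    ultimately show ?thesis using insert.hyps by (simp add: sum.distrib algebra_simps)
  qed
  show ?case
  proof (cases "K a a = 0")
    case True
    have psdV: "0 \<le> (\<Sum>x\<in>V. \<Sum>y\<in>V. c x * c y * K x y)" for c
    proof -
      have "(\<Sum>y\<in>V. (c(a := 0)) y * K a y) = (\<Sum>y\<in>V. c y * K a y)"
        "(\<Sum>x\<in>V. \<Sum>y\<in>V. (c(a := 0)) x * (c(a := 0)) y * K x y) = (\<Sum>x\<in>V. \<Sum>y\<in>V. c x * c y * K x y)"
        using insert.hyps by (auto intro!: sum.cong)
      then show ?thesis using psd[of "c(a := 0)"] unfolding expand by simp
    qed
    obtain \<phi> :: "'a \<Rightarrow> fsvec" where \<phi>: "\<And>x y. x \<in> V \<Longrightarrow> y \<in> V \<Longrightarrow> \<phi> x \<bullet> \<phi> y = K x y"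
      using insert.IH[OF sym psdV] by blast
    have zero: "K a z = 0" if z: "z \<in> V" for z
    proof (rule ccontr)
      assume nz: "K a z \<noteq> 0"
      \<comment> \<open>With weight \<open>t\<close> at \<open>a\<close> and 1 at \<open>z\<close>
        the form takes the value -1.\<close>
      define t where "t = - (K z z + 1) / (2 * K a z)"
      let ?c = "\<lambda>x. if x = a then t else if x = z then 1 else 0"
      have za: "z \<noteq> a" using z insert.hyps by auto
      have pick: "(\<Sum>y\<in>V. ?c y * g y) = g z" for g
      proof -
        have "(\<Sum>y\<in>V. ?c y * g y) = (\<Sum>y\<in>V. if y = z then g y else 0)"
          using insert.hyps by (intro sum.cong) auto
        then show ?thesis using insert.hyps z by simp
      qed
      moreover have "(\<Sum>x\<in>V. \<Sum>y\<in>V. ?c x * ?c y * K x y) = K z z"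
      proof -
        have "(\<Sum>x\<in>V. \<Sum>y\<in>V. ?c x * ?c y * K x y) = (\<Sum>x\<in>V. ?c x * (\<Sum>y\<in>V. ?c y * K x y))"
          by (simp only: sum_distrib_left mult.assoc)
        then show ?thesis unfolding pick .
      qed
      ultimately have "0 \<le> 2 * t * K a z + K z z"
        using psd[of ?c] insert.hyps z True unfolding expand by simp
      moreover have "2 * t * K a z = - (K z z + 1)" using nz by (simp add: t_def field_simps)
      ultimately show False by simp
    qed
    have zero': "K z a = 0" if "z \<in> V" for z using zero[OF that] sym[of z a] by simp
    have "(\<phi>(a := 0)) x \<bullet> (\<phi>(a := 0)) y = K x y" if "x \<in> insert a V" "y \<in> insert a V" for x y
      using that \<phi>[of x y] zero[of x] zero[of y] zero'[of x] True insert.hyps by (cases "x = a"; cases "y = a") simp_all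
    then show ?thesis by blast
  next
    case False
    have "0 \<le> K a a"
    proof -
      have "(\<Sum>y\<in>V. (if y = a then 1 else 0) * K a y) = 0"
        "(\<Sum>x\<in>V. \<Sum>y\<in>V. (if x = a then 1 else 0) * (if y = a then 1 else 0) * K x y) = 0"
        using insert.hyps by (auto intro!: sum.neutral)
      then show ?thesis using psd[of "\<lambda>x. if x = a then 1 else 0"] unfolding expand by simp
    qed
    then have pos: "0 < K a a" using False by simp
    define K' where "K' y z = K y z - K a y * K a z / K a a" for y z
    have psd': "0 \<le> (\<Sum>x\<in>V. \<Sum>y\<in>V. c x * c y * K' x y)" for c
    proof -
      define s where "s = (\<Sum>y\<in>V. c y * K a y)"
      \<comment> \<open>This coefficient at \<open>a\<close> minimises the form, and the minimum is
        the form of the Schur complement.\<close>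
      let ?c = "c(a := - s / K a a)"
      have e: "(\<Sum>y\<in>V. ?c y * K a y) = s"
        "(\<Sum>x\<in>V. \<Sum>y\<in>V. ?c x * ?c y * K x y) = (\<Sum>x\<in>V. \<Sum>y\<in>V. c x * c y * K x y)"
        unfolding s_def using insert.hyps by (auto intro!: sum.cong)
      have "(\<Sum>x\<in>V. \<Sum>y\<in>V. c x * c y * K' x y) =
        (\<Sum>x\<in>V. \<Sum>y\<in>V. c x * c y * K x y) - (\<Sum>x\<in>V. \<Sum>y\<in>V. (c x * K a x) * (c y * K a y)) / K a a"
        by (simp add: K'_def sum_subtractf algebra_simps sum_divide_distrib)
      also have "(\<Sum>x\<in>V. \<Sum>y\<in>V. (c x * K a x) * (c y * K a y)) = s * s"
        by (simp add: s_def sum_product)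
      finally have X: "(\<Sum>x\<in>V. \<Sum>y\<in>V. c x * c y * K' x y) =
        (\<Sum>x\<in>V. \<Sum>y\<in>V. c x * c y * K x y) - s * s / K a a" by (simp add: sum_divide_distrib)
      define Y where "Y = (\<Sum>x\<in>V. \<Sum>y\<in>V. c x * c y * K x y)"
      have "0 \<le> Y - s * s / K a a"
        using psd[of ?c] pos unfolding expand e Y_def[symmetric] by (simp add: field_simps)
      then show ?thesis unfolding X Y_def .
    qed
    have "K' x y = K' y x" for x y using sym by (simp add: K'_def mult.commute)
    then obtain \<phi> :: "'a \<Rightarrow> fsvec" where \<phi>: "\<And>x y. x \<in> V \<Longrightarrow> y \<in> V \<Longrightarrow> \<phi> x \<bullet> \<phi> y = K' x y"
      using insert.IH[of K'] psd' by blast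
    obtain e where e: "e \<bullet> e = 1" "\<And>v. v \<in> V \<Longrightarrow> e \<bullet> \<phi> v = 0"
      using ex_unit_orthogonal[of "\<phi> ` V"] insert.hyps by auto
    define \<psi> where "\<psi> x = (if x = a then sqrt (K a a) *\<^sub>R e else \<phi> x + (K a x / sqrt (K a a)) *\<^sub>R e)" for x
    have "\<psi> x \<bullet> \<psi> y = K x y" if "x \<in> insert a V" "y \<in> insert a V" for x y
    proof -
      have sq: "sqrt (K a a) * sqrt (K a a) = K a a" "sqrt (K a a) \<noteq> 0" using pos by auto
      have e': "\<phi> v \<bullet> e = 0" if "v \<in> V" for v using e(2)[OF that] by (simp add: inner_commute)
      have K: "K x a = K a x" by (rule sym)
      show ?thesis using that insert.hyps e(1) e(2)[of y] e'[of x] \<phi>[of x y] sq K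
        by (cases "x = a"; cases "y = a") (simp_all add: \<psi>_def inner_simps K'_def divide_simps)
    qed
    then show ?thesis by blast
  qed
qed simp

section \<open>The Rayleigh quotient on functions of sum 0\<close>

lemma linear_coefficient_zero:
  fixes p r :: real
  assumes "\<And>e. 2 * e * p + e * e * r \<le> 0"
  shows "p = 0"
proof (rule ccontr)
  assume p: "p \<noteq> 0"
  define e where "e = p / (\<bar>r\<bar> + 1)"
  have "e * e * \<bar>r\<bar> \<le> e * p"
  proof -
    have "e * e * \<bar>r\<bar> \<le> e * e * (\<bar>r\<bar> + 1)" by (intro mult_left_mono) auto
    also have "\<dots> = e * p" by (simp add: e_def)
    finally show ?thesis .
  qed
  moreover have "- (e * e * \<bar>r\<bar>) \<le> e * e * r"
    using mult_left_mono[of "- \<bar>r\<bar>" r "e * e"] by simp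
  moreover have "0 < p * p / (\<bar>r\<bar> + 1)" using p by (intro divide_pos_pos) (auto simp: zero_less_mult_iff)
  then have "0 < e * p" by (simp add: e_def)
  ultimately show False using assms[of e] by simp
qed

text \<open>A maximiser of the form on the unit sphere of the sum-zero hyperplane is stationary
  there. Constant row sums make \<open>A\<close> preserve the hyperplane, so the maximiser is an
  eigenvector and \<open>ev\<close> bounds the maximum.\<close>

lemma quadratic_form_le:
  fixes A :: "'a \<Rightarrow> 'a \<Rightarrow> real"
  assumes fin: "finite V" and sym: "\<And>x y. A x y = A y x"
    and row: "\<And>x. x \<in> V \<Longrightarrow> (\<Sum>y\<in>V. A x y) = k"
    and ev: "\<And>f \<mu>. (\<Sum>x\<in>V. f x) = 0 \<Longrightarrow> (\<And>x. x \<in> V \<Longrightarrow> (\<Sum>y\<in>V. A x y * f y) = \<mu> * f x) \<Longrightarrow>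
      \<exists>x\<in>V. f x \<noteq> 0 \<Longrightarrow> \<mu> \<le> \<theta>"
    and c: "(\<Sum>x\<in>V. c x) = 0"
  shows "(\<Sum>x\<in>V. \<Sum>y\<in>V. c x * c y * A x y) \<le> \<theta> * (\<Sum>x\<in>V. c x * c x)"
proof -
  define B where "B f g = (\<Sum>x\<in>V. \<Sum>y\<in>V. f x * g y * A x y)" for f g
  define I where "I f g = (\<Sum>x\<in>V. f x * g x)" for f g :: "'a \<Rightarrow> real"
  \<comment> \<open>The values are confined to [-1, 1] on \<open>V\<close> and to 0 elsewhere, which
    makes \<open>S\<close> a closed subset of a product of compact sets.\<close>
  define S where "S = {f. (\<forall>x. f x \<in> (if x \<in> V then {-1..1} else {0})) \<and> I f f = 1 \<and> (\<Sum>x\<in>V. f x) = 0}"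
  have B_sym: "B f g = B g f" for f g
    unfolding B_def by (subst sum.swap) (simp add: sym mult_ac)
  have B_add: "B (\<lambda>x. f x + e * h x) (\<lambda>x. f x + e * h x) = B f f + 2 * e * B f h + e * e * B h h" for f h e
  proof -
    have "B (\<lambda>x. f x + e * h x) (\<lambda>x. f x + e * h x) = B f f + e * B f h + e * B h f + e * e * B h h"
      by (simp add: B_def algebra_simps sum.distrib sum_distrib_left)
    then show ?thesis by (simp add: B_sym[of h f])
  qed
  have I_add: "I (\<lambda>x. f x + e * h x) (\<lambda>x. f x + e * h x) = I f f + 2 * e * I f h + e * e * I h h" for f h e
    by (simp add: I_def algebra_simps sum.distrib sum_distrib_left)
  have B_scale: "B (\<lambda>x. e * f x) (\<lambda>x. e * f x) = e * e * B f f" for e f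
    by (simp add: B_def sum_distrib_left mult_ac)
  have I_scale: "I (\<lambda>x. e * f x) (\<lambda>x. e * f x) = e * e * I f f" for e f
    by (simp add: I_def sum_distrib_left mult_ac)
  have I_nonneg: "0 \<le> I f f" for f by (simp add: I_def sum_nonneg)
  have I_zero: "f x = 0" if "I f f = 0" "x \<in> V" for f x
    using that fin by (simp add: I_def sum_nonneg_eq_0_iff)
  have normalise: "\<exists>f\<in>S. B g g = I g g * B f f" if g: "(\<Sum>x\<in>V. g x) = 0" "I g g \<noteq> 0" for g
  proof -
    define e where "e = 1 / sqrt (I g g)"
    define f where "f x = (if x \<in> V then e * g x else 0)" for x
    have pos: "0 < I g g" using g I_nonneg[of g] by simp
    then have ee: "e * e * I g g = 1" by (simp add: e_def)
    have If: "I f f = I (\<lambda>x. e * g x) (\<lambda>x. e * g x)" "B f f = B (\<lambda>x. e * g x) (\<lambda>x. e * g x)"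
      by (auto simp: I_def B_def f_def intro!: sum.cong)
    then have If1: "I f f = 1" using ee by (simp add: I_scale)
    have "(\<Sum>x\<in>V. f x) = e * (\<Sum>x\<in>V. g x)" by (simp add: f_def sum_distrib_left)
    moreover have "f x \<in> (if x \<in> V then {-1..1} else {0})" for x
    proof (cases "x \<in> V")
      case True
      have "f x * f x \<le> I f f" unfolding I_def by (rule member_le_sum[OF True]) (auto simp: fin)
      then have "\<bar>f x\<bar> \<le> 1" using If1 by (simp add: abs_square_le_1 power2_eq_square flip: power2_eq_square)
      then show ?thesis using True by auto
    qed (simp add: f_def)
    ultimately have "f \<in> S" using If1 g by (simp add: S_def)
    moreover have "I g g * B f f = B g g" using ee If(2) by (simp add: B_scale mult_ac)
    ultimately show ?thesis by force
  qed
  show ?thesis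
  proof (cases "I c c = 0")
    case True
    then have "\<And>x. x \<in> V \<Longrightarrow> c x = 0" using I_zero by blast
    then have "B c c = 0" by (simp add: B_def)
    then show ?thesis using True by (simp add: B_def I_def)
  next
    case False
    then have ne: "S \<noteq> {}" using normalise[OF c] by auto
    have coord: "continuous_on UNIV (\<lambda>f :: 'a \<Rightarrow> real. f x)" for x
      by (rule continuous_on_product_coordinates)
    have cont: "continuous_on UNIV (\<lambda>f. B f f)" "continuous_on UNIV (\<lambda>f. I f f)"
      "continuous_on UNIV (\<lambda>f :: 'a \<Rightarrow> real. \<Sum>x\<in>V. f x)"
      unfolding B_def I_def by (intro continuous_intros coord)+
    have "compactin (product_topology (\<lambda>_. euclidean) UNIV) (PiE UNIV (\<lambda>x. if x \<in> V then {-1..1::real} else {0}))"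
      by (subst compactin_PiE) auto
    then have "compact (PiE UNIV (\<lambda>x. if x \<in> V then {-1..1::real} else {0}))"
      by (simp add: euclidean_product_topology)
    moreover have "closed {f. I f f = 1}" "closed {f :: 'a \<Rightarrow> real. (\<Sum>x\<in>V. f x) = 0}"
      by (intro closed_Collect_eq cont continuous_on_const)+
    ultimately have "compact (PiE UNIV (\<lambda>x. if x \<in> V then {-1..1::real} else {0}) \<inter> {f. I f f = 1} \<inter> {f. (\<Sum>x\<in>V. f x) = 0})"
      by (intro compact_Int_closed)
    also have "PiE UNIV (\<lambda>x. if x \<in> V then {-1..1::real} else {0}) \<inter> {f. I f f = 1} \<inter> {f. (\<Sum>x\<in>V. f x) = 0} = S"
      unfolding S_def PiE_UNIV_domain Pi_def by blast
    finally have "compact S" .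
    then obtain f where f: "f \<in> S" and mx: "\<And>g. g \<in> S \<Longrightarrow> B g g \<le> B f f"
      using continuous_attains_sup[OF _ ne, of "\<lambda>f. B f f"] continuous_on_subset[OF cont(1)] by blast
    define \<mu> where "\<mu> = B f f"
    have fS: "I f f = 1" "(\<Sum>x\<in>V. f x) = 0" using f by (auto simp: S_def)
    have le: "B g g \<le> \<mu> * I g g" if g: "(\<Sum>x\<in>V. g x) = 0" for g
    proof (cases "I g g = 0")
      case True
      then have "\<And>x. x \<in> V \<Longrightarrow> g x = 0" using I_zero by blast
      then have "B g g = 0" by (simp add: B_def)
      then show ?thesis using True by simp
    next
      case False
      then obtain f' where f': "f' \<in> S" "B g g = I g g * B f' f'" using normalise[OF g] by blast
      then show ?thesis using mult_left_mono[OF mx[OF f'(1)] I_nonneg[of g]] by (simp add: \<mu>_def mult.commute)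
    qed
    \<comment> \<open>The error in the eigenvector equation has sum 0, so it is an admissible
      direction; stationarity tested on it gives squared norm 0.\<close>
    define v where "v x = (\<Sum>y\<in>V. A x y * f y) - \<mu> * f x" for x
    have orth: "B f h = \<mu> * I f h" if h: "(\<Sum>x\<in>V. h x) = 0" for h
    proof -
      have "B f h - \<mu> * I f h = 0"
      proof (rule linear_coefficient_zero)
        fix e :: real
        have "(\<Sum>x\<in>V. f x + e * h x) = 0" using h fS by (simp add: sum.distrib flip: sum_distrib_left)
        from le[OF this] show "2 * e * (B f h - \<mu> * I f h) + e * e * (B h h - \<mu> * I h h) \<le> 0"
          unfolding B_add I_add using fS by (simp add: \<mu>_def algebra_simps)
      qed
      then show ?thesis by simp
    qed
    have "(\<Sum>x\<in>V. \<Sum>y\<in>V. A x y * f y) = (\<Sum>y\<in>V. (\<Sum>x\<in>V. A y x) * f y)"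
      by (subst sum.swap) (simp add: sum_distrib_right sym)
    also have "\<dots> = 0" using row fS(2) by (simp flip: sum_distrib_left)
    finally have sv: "(\<Sum>x\<in>V. v x) = 0" using fS(2) by (simp add: v_def sum_subtractf flip: sum_distrib_left)
    have "I v v = B f v - \<mu> * I f v"
    proof -
      define W where "W x = (\<Sum>y\<in>V. A x y * f y)" for x
      have "B f v = (\<Sum>x\<in>V. v x * W x)"
        unfolding B_sym[of f v] by (simp add: B_def W_def sum_distrib_left mult_ac)
      moreover have "I v v = (\<Sum>x\<in>V. v x * (W x - \<mu> * f x))" by (simp add: I_def v_def W_def)
      ultimately show ?thesis by (simp add: I_def right_diff_distrib sum_subtractf sum_distrib_left mult_ac)
    qed
    then have "I v v = 0" using orth[OF sv] by simp
    then have "\<And>x. x \<in> V \<Longrightarrow> (\<Sum>y\<in>V. A x y * f y) = \<mu> * f x" using I_zero[of v] by (simp add: v_def)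
    moreover have "\<exists>x\<in>V. f x \<noteq> 0"
    proof (rule ccontr)
      assume "\<not> ?thesis"
      then have "I f f = 0" by (simp add: I_def)
      then show False using fS(1) by simp
    qed
    ultimately have "\<mu> \<le> \<theta>" using ev[OF fS(2)] by blast
    then have "\<mu> * I c c \<le> \<theta> * I c c" by (intro mult_right_mono I_nonneg)
    then show ?thesis using le[OF c] by (simp add: B_def I_def)
  qed
qed

section \<open>The characteristic polynomial of the adjacency matrix\<close>

lemma nth_1_rev_sorted_ge:
  assumes "a \<in># X" "b \<in># X" "a < b"
  shows "a \<le> rev (sorted_list_of_multiset X) ! 1"
proof -
  let ?L = "rev (sorted_list_of_multiset X)"
  have mono: "?L ! j \<le> ?L ! i" if "i \<le> j" "j < length ?L" for i j
    by (rule sorted_rev_nth_mono[OF _ that]) simp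
  have "a \<in> set ?L" "b \<in> set ?L" using assms by simp_all
  then obtain i j where ij: "i < length ?L" "?L ! i = a" "j < length ?L" "?L ! j = b"
    by (meson in_set_conv_nth)
  have "i \<noteq> 0"
  proof
    assume "i = 0"
    then have "b \<le> a" using mono[of 0 j] ij by simp
    then show False using assms(3) by simp
  qed
  then show ?thesis using mono[of 1 i] ij by simp
qed

lemma nth_1_rev_sorted_le:
  assumes "2 \<le> size X" "size {#x \<in># X. \<theta> < x#} \<le> 1"
  shows "rev (sorted_list_of_multiset X) ! 1 \<le> \<theta>"
proof (rule ccontr)
  assume gt: "\<not> ?thesis"
  let ?L = "rev (sorted_list_of_multiset X)"
  have mset: "mset ?L = X" by simp
  have "2 \<le> length ?L" using assms(1) mset by (metis size_mset)
  then obtain x l where xl: "?L = x # l" by (cases ?L) auto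
  then obtain y ys where "l = y # ys" using \<open>2 \<le> length ?L\<close> by (cases l) auto
  then have L: "?L = x # y # ys" using xl by simp
  have "sorted (rev ?L)" unfolding rev_rev_ident by (rule sorted_sorted_list_of_multiset)
  then have "y \<le> x" unfolding L by (simp add: sorted_append)
  moreover have "\<theta> < y" using gt L by simp
  moreover from calculation have "\<theta> < x" by (meson less_le_trans)
  ultimately have "2 \<le> size {#x \<in># mset ?L. \<theta> < x#}" unfolding L by simp
  then show False using assms(2) mset by simp
qed

text \<open>Conjugation by a matrix with first column \<open>(1, \<dots>, 1)\<close> splits off the factor \<open>X - k\<close>; if the
  other factor vanished at \<open>k\<close>, there would be an eigenvector with entry 0 at index 0.\<close>

lemma order_char_poly_le_1:
  fixes A :: "real mat"
  assumes A: "A \<in> carrier_mat n n"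
    and row: "\<And>i. i < n \<Longrightarrow> (\<Sum>j<n. A $$ (i, j)) = k" and col: "\<And>j. j < n \<Longrightarrow> (\<Sum>i<n. A $$ (i, j)) = k"
    and ker: "\<And>w i. w 0 = 0 \<Longrightarrow> (\<And>i. i < n \<Longrightarrow> (\<Sum>j<n. A $$ (i, j) * w j) = k * w i) \<Longrightarrow> i < n \<Longrightarrow> w i = 0"
  shows "order k (char_poly A) \<le> 1"
proof (cases n)
  case 0
  then have "char_poly A = 1" using A unfolding char_poly_defs by (simp add: det_def)
  then show ?thesis by (simp add: order_0I)
next
  case (Suc m)
  define P :: "real mat" where "P = mat n n (\<lambda>(i, j). if j = 0 \<or> i = j then 1 else 0)"
  define Q :: "real mat" where "Q = mat n n (\<lambda>(i, j). if i = j then 1 else if j = 0 then -1 else 0)"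
  have carr: "P \<in> carrier_mat n n" "Q \<in> carrier_mat n n" by (simp_all add: P_def Q_def)
  have prod: "(M * N) $$ (i, j) = (\<Sum>l<n. M $$ (i, l) * N $$ (l, j))"
    if "M \<in> carrier_mat n n" "N \<in> carrier_mat n n" "i < n" "j < n" for M N :: "real mat" and i j
    using that by (auto simp: scalar_prod_def lessThan_atLeast0 intro!: sum.cong)
  have n0: "0 < n" using Suc by simp
  have PM: "(P * M) $$ (i, j) = M $$ (0, j) + (if i = 0 then 0 else M $$ (i, j))"
    if "M \<in> carrier_mat n n" "i < n" "j < n" for M i j
  proof -
    have "(P * M) $$ (i, j) = (\<Sum>l<n. (if l = 0 then M $$ (0, j) else 0) + (if l = i \<and> i \<noteq> 0 then M $$ (i, j) else 0))"
      unfolding prod[OF carr(1) that] using that by (intro sum.cong) (auto simp: P_def)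
    then show ?thesis using n0 that by (simp add: sum.distrib)
  qed
  have QM: "(Q * M) $$ (i, j) = M $$ (i, j) - (if i = 0 then 0 else M $$ (0, j))"
    if "M \<in> carrier_mat n n" "i < n" "j < n" for M i j
  proof -
    have "(Q * M) $$ (i, j) = (\<Sum>l<n. (if l = i then M $$ (i, j) else 0) - (if l = 0 then (if i = 0 then 0 else M $$ (0, j)) else 0))"
      unfolding prod[OF carr(2) that] using that by (intro sum.cong) (auto simp: Q_def)
    then show ?thesis using n0 that by (simp add: sum_subtractf)
  qed
  have PQ: "P * Q = 1\<^sub>m n"
    using PM[OF carr(2)] carr by (intro eq_matI) (auto simp: Q_def)
  have QP: "Q * P = 1\<^sub>m n"
    using QM[OF carr(1)] carr by (intro eq_matI) (auto simp: P_def)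
  define B where "B = Q * (A * P)"
  have BC: "B \<in> carrier_mat n n" using carr A by (simp add: B_def)
  have "P * B * Q = (P * Q) * A * (P * Q)" unfolding B_def
    using carr A by (simp add: assoc_mult_mat[of _ n n _ n _ n])
  then have "A = P * B * Q" using A PQ by simp
  then have "similar_mat_wit A B P Q"
    unfolding similar_mat_wit_def Let_def using PQ QP A BC carr by auto
  then have "similar_mat A B" unfolding similar_mat_def by blast
  then have cpB: "char_poly A = char_poly B" by (rule char_poly_similar)
  define A1 where "A1 = mat 1 1 (\<lambda>_. k)"
  define A2 where "A2 = mat 1 m (\<lambda>(i, j). A $$ (0, Suc j))"
  define A3 where "A3 = mat m m (\<lambda>(i, j). A $$ (Suc i, Suc j) - A $$ (0, Suc j))"
  have AP: "(A * P) $$ (i, j) = (if j = 0 then k else A $$ (i, j))" if "i < n" "j < n" for i j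
  proof -
    have "(A * P) $$ (i, j) = (\<Sum>l<n. if j = 0 then A $$ (i, l) else if l = j then A $$ (i, j) else 0)"
      unfolding prod[OF A carr(1) that] using that by (intro sum.cong) (auto simp: P_def)
    then show ?thesis using row that by simp
  qed
  have APC: "A * P \<in> carrier_mat n n" using A carr by simp
  have "B = four_block_mat A1 A2 (0\<^sub>m m 1) A3"
  proof (rule eq_matI)
    show "dim_row B = dim_row (four_block_mat A1 A2 (0\<^sub>m m 1) A3)"
      "dim_col B = dim_col (four_block_mat A1 A2 (0\<^sub>m m 1) A3)"
      using BC Suc by (auto simp: A1_def A3_def)
    fix i j assume "i < dim_row (four_block_mat A1 A2 (0\<^sub>m m 1) A3)" "j < dim_col (four_block_mat A1 A2 (0\<^sub>m m 1) A3)"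
    then have ij: "i < n" "j < n" using Suc by (auto simp: A1_def A3_def)
    have "B $$ (i, j) = (A * P) $$ (i, j) - (if i = 0 then 0 else (A * P) $$ (0, j))"
      unfolding B_def using QM[OF APC ij] .
    then show "B $$ (i, j) = four_block_mat A1 A2 (0\<^sub>m m 1) A3 $$ (i, j)"
      using AP[OF ij] AP[OF n0 ij(2)] ij Suc
      by (cases i; cases j) (auto simp: A1_def A2_def A3_def)
  qed
  then have "char_poly A = char_poly A1 * char_poly A3"
    unfolding cpB by (simp only:) (rule char_poly_four_block_zeros_col, auto simp: A1_def A2_def A3_def)
  moreover have "char_poly A1 = [:- k, 1:]"
    by (simp add: char_poly_defs A1_def det_def) 
  ultimately have cp: "char_poly A = [:- k, 1:] * char_poly A3" by simp
  have A3C: "A3 \<in> carrier_mat m m" by (simp add: A3_def)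
  have ne: "char_poly A \<noteq> 0" using degree_monic_char_poly[OF A] by auto
  have "poly (char_poly A3) k \<noteq> 0"
  proof
    assume "poly (char_poly A3) k = 0"
    then obtain v where v: "v \<in> carrier_vec m" "v \<noteq> 0\<^sub>v m" "A3 *\<^sub>v v = k \<cdot>\<^sub>v v"
      using eigenvalue_root_char_poly[OF A3C] A3C by (auto simp: eigenvalue_def eigenvector_def)
    define w where "w i = (if i = 0 then 0 else v $ (i - 1))" for i
    define a where "a = (\<Sum>j<n. A $$ (0, j) * w j)"
    have Aw: "(\<Sum>j<n. A $$ (i, j) * w j) = k * w i + a" if i: "i < n" for i
    proof (cases i)
      case 0 then show ?thesis by (simp add: a_def w_def)
    next
      case (Suc i')
      then have i': "i' < m" using i \<open>n = Suc m\<close> by simp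
      have "(A3 *\<^sub>v v) $ i' = (\<Sum>j<m. (A $$ (Suc i', Suc j) - A $$ (0, Suc j)) * v $ j)"
        using i' v(1) by (auto simp: A3_def scalar_prod_def lessThan_atLeast0 intro!: sum.cong)
      then have "(\<Sum>j<m. A $$ (Suc i', Suc j) * v $ j) - (\<Sum>j<m. A $$ (0, Suc j) * v $ j) = k * v $ i'"
        using v i' by (simp add: left_diff_distrib sum_subtractf)
      moreover have "(\<Sum>j<n. A $$ (l, j) * w j) = (\<Sum>j<m. A $$ (l, Suc j) * v $ j)" for l
        unfolding \<open>n = Suc m\<close> sum.lessThan_Suc_shift by (simp add: w_def)
      ultimately show ?thesis unfolding a_def by (simp add: Suc w_def)
    qed
    \<comment> \<open>The eigenvector equations hold up to the common error \<open>a\<close>. As the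
      columns also sum to \<open>k\<close>, adding all equations gives
      \<open>n * a = 0\<close>.\<close>
    have "(\<Sum>i<n. \<Sum>j<n. A $$ (i, j) * w j) = (\<Sum>j<n. (\<Sum>i<n. A $$ (i, j)) * w j)"
      by (subst sum.swap) (simp add: sum_distrib_right)
    also have "\<dots> = k * (\<Sum>j<n. w j)" using col by (simp add: sum_distrib_left)
    finally have "real n * a = 0" using Aw by (simp add: sum.distrib sum_distrib_left)
    then have "a = 0" using n0 by simp
    then have "w i = 0" if "i < n" for i using ker[of w i] Aw that by (simp add: w_def)
    then have "v $ i = 0" if "i < m" for i using that Suc by (force simp: w_def)
    then show False using v(1,2) by (auto simp: vec_eq_iff)
  qed
  then have "order k (char_poly A3) = 0" by (rule order_0I)
  moreover have "order k [:- k, 1:] = 1" using order_power_n_n[of k 1] by simp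
  ultimately show ?thesis using order_mult[of "[:- k, 1:]" "char_poly A3" k] ne cp by simp
qed

lemma adjacency_mat_index:
  assumes "finite V"
  shows "adjacency_mat V E \<in> carrier_mat (card V) (card V)"
    "i < card V \<Longrightarrow> j < card V \<Longrightarrow>
      adjacency_mat V E $$ (i, j) = adjacency E (sorted_list_of_set V ! i) (sorted_list_of_set V ! j)"
    "bij_betw (\<lambda>i. sorted_list_of_set V ! i) {..<card V} V"
proof -
  show "adjacency_mat V E \<in> carrier_mat (card V) (card V)"
    "i < card V \<Longrightarrow> j < card V \<Longrightarrow>
      adjacency_mat V E $$ (i, j) = adjacency E (sorted_list_of_set V ! i) (sorted_list_of_set V ! j)"
    by (simp_all add: adjacency_mat_def)
  show "bij_betw (\<lambda>i. sorted_list_of_set V ! i) {..<card V} V"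
    by (rule bij_betw_nth) (use assms in simp_all)
qed

lemma root_char_poly_adjacency_iff:
  assumes fin: "finite V"
  shows "poly (char_poly (adjacency_mat V E)) \<theta> = 0 \<longleftrightarrow>
    (\<exists>f. (\<exists>x\<in>V. f x \<noteq> 0) \<and> (\<forall>x\<in>V. (\<Sum>y\<in>V. real (adjacency E x y) * f y) = \<theta> * f x))"
proof -
  let ?n = "card V" and ?l = "\<lambda>i. sorted_list_of_set V ! i" and ?A = "adjacency_mat V E"
  note A = adjacency_mat_index(1)[OF fin, of E] adjacency_mat_index(2)[OF fin, where E = E]
    adjacency_mat_index(3)[OF fin]
  have mult: "(?A *\<^sub>v v) $ i = (\<Sum>y\<in>V. real (adjacency E (?l i) y) * f y)"
    if v: "v \<in> carrier_vec ?n" "\<And>i. i < ?n \<Longrightarrow> v $ i = f (?l i)" and i: "i < ?n" for v f i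
  proof -
    have "(?A *\<^sub>v v) $ i = (\<Sum>j<?n. ?A $$ (i, j) * v $ j)"
      using carrier_matD[OF A(1)] v(1) i
      by (auto simp: scalar_prod_def lessThan_atLeast0 intro!: sum.cong)
    also have "\<dots> = (\<Sum>j<?n. real (adjacency E (?l i) (?l j)) * f (?l j))"
      using A(2) v i by (intro sum.cong) auto
    also have "\<dots> = (\<Sum>y\<in>V. real (adjacency E (?l i) y) * f y)"
      by (rule sum.reindex_bij_betw[OF A(3)])
    finally show ?thesis .
  qed
  have img: "\<exists>i<?n. x = ?l i" if "x \<in> V" for x
    using that bij_betw_imp_surj_on[OF A(3)] by blast
  have l_in: "?l i \<in> V" if "i < ?n" for i
    using that bij_betw_imp_surj_on[OF A(3)] by blast
  have "poly (char_poly ?A) \<theta> = 0 \<longleftrightarrow> (\<exists>v. v \<in> carrier_vec ?n \<and> v \<noteq> 0\<^sub>v ?n \<and> ?A *\<^sub>v v = \<theta> \<cdot>\<^sub>v v)"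
    using eigenvalue_root_char_poly[OF A(1)] A(1) by (auto simp: eigenvalue_def eigenvector_def)
  also have "\<dots> \<longleftrightarrow> (\<exists>f. (\<exists>x\<in>V. f x \<noteq> 0) \<and> (\<forall>x\<in>V. (\<Sum>y\<in>V. real (adjacency E x y) * f y) = \<theta> * f x))"
  proof
    assume "\<exists>v. v \<in> carrier_vec ?n \<and> v \<noteq> 0\<^sub>v ?n \<and> ?A *\<^sub>v v = \<theta> \<cdot>\<^sub>v v"
    then obtain v where v: "v \<in> carrier_vec ?n" "v \<noteq> 0\<^sub>v ?n" "?A *\<^sub>v v = \<theta> \<cdot>\<^sub>v v" by blast
    define f where "f x = v $ (the_inv_into {..<?n} ?l x)" for x
    have inj: "inj_on ?l {..<?n}" using A(3) by (simp add: bij_betw_def)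
    have vf: "v $ i = f (?l i)" if "i < ?n" for i
      using that the_inv_into_f_f[OF inj, of i] by (simp add: f_def)
    obtain i where "i < ?n" "v $ i \<noteq> 0" using v(1,2) by (auto simp: vec_eq_iff)
    then have "\<exists>x\<in>V. f x \<noteq> 0" using vf[of i] l_in[of i] by auto
    moreover have "(\<Sum>y\<in>V. real (adjacency E x y) * f y) = \<theta> * f x" if xV: "x \<in> V" for x
    proof -
      obtain i where i: "i < ?n" "x = ?l i" using img[OF xV] by blast
      have "(\<Sum>y\<in>V. real (adjacency E (?l i) y) * f y) = (\<theta> \<cdot>\<^sub>v v) $ i"
        using mult[OF v(1) vf i(1)] v(3) by simp
      then show ?thesis using i v(1) vf by simp
    qed
    ultimately show "\<exists>f. (\<exists>x\<in>V. f x \<noteq> 0) \<and> (\<forall>x\<in>V. (\<Sum>y\<in>V. real (adjacency E x y) * f y) = \<theta> * f x)" by blast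
  next
    assume "\<exists>f. (\<exists>x\<in>V. f x \<noteq> 0) \<and> (\<forall>x\<in>V. (\<Sum>y\<in>V. real (adjacency E x y) * f y) = \<theta> * f x)"
    then obtain f x where f: "x \<in> V" "f x \<noteq> 0" "\<And>x. x \<in> V \<Longrightarrow> (\<Sum>y\<in>V. real (adjacency E x y) * f y) = \<theta> * f x" by blast
    define v where "v = vec ?n (\<lambda>i. f (?l i))"
    have v: "v \<in> carrier_vec ?n" "\<And>i. i < ?n \<Longrightarrow> v $ i = f (?l i)" by (simp_all add: v_def)
    obtain i where "i < ?n" "x = ?l i" using img[OF f(1)] by blast
    then have "v \<noteq> 0\<^sub>v ?n" using v(2)[of i] f(2) by auto
    moreover have "?A *\<^sub>v v = \<theta> \<cdot>\<^sub>v v"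
    proof (rule eq_vecI)
      fix i assume "i < dim_vec (\<theta> \<cdot>\<^sub>v v)"
      then have i: "i < ?n" using v(1) by simp
      have "?l i \<in> V" using l_in i by blast
      then show "(?A *\<^sub>v v) $ i = (\<theta> \<cdot>\<^sub>v v) $ i" using mult[OF v i] f(3) v i by simp
    qed (use A(1) v(1) in simp)
    ultimately show "\<exists>v. v \<in> carrier_vec ?n \<and> v \<noteq> 0\<^sub>v ?n \<and> ?A *\<^sub>v v = \<theta> \<cdot>\<^sub>v v" using v(1) by blast
  qed
  finally show ?thesis .
qed

lemma char_poly_adjacency_nonzero:
  assumes "finite V"
  shows "char_poly (adjacency_mat V E) \<noteq> 0"
  using degree_monic_char_poly[OF adjacency_mat_index(1)[OF assms, of E]] by auto

lemma eigenvalues_mset_iff: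
  "finite V \<Longrightarrow> \<theta> \<in># eigenvalues_mset V E \<longleftrightarrow> poly (char_poly (adjacency_mat V E)) \<theta> = 0"
  by (simp add: eigenvalues_mset_def set_count_proots char_poly_adjacency_nonzero)

section \<open>Linear hypergraphs with second eigenvalue at most 1\<close>

locale linear_hypergraph =
  fixes V :: "'a::linorder set" and E :: "'a set set" and r u :: nat
  assumes finV: "finite V"
    and edges: "e \<in> E \<Longrightarrow> e \<subseteq> V" "e \<in> E \<Longrightarrow> card e = u"
    and deg: "x \<in> V \<Longrightarrow> card {e\<in>E. x \<in> e} = r"
    and lin: "e \<in> E \<Longrightarrow> f \<in> E \<Longrightarrow> {x, y} \<subseteq> e \<Longrightarrow> {x, y} \<subseteq> f \<Longrightarrow> x \<noteq> y \<Longrightarrow> e = f"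
    and connected: "connected_hypergraph V E"
begin

definition col :: "'a \<Rightarrow> 'a \<Rightarrow> bool" where
  "col x y \<longleftrightarrow> x \<noteq> y \<and> (\<exists>e\<in>E. {x, y} \<subseteq> e)"

lemma col_sym: "col x y \<longleftrightarrow> col y x" by (auto simp: col_def insert_commute)

lemma finE: "finite E" using edges finV by (auto intro: finite_subset[of _ "Pow V"])

lemma card_common: "x \<noteq> y \<Longrightarrow> card {e\<in>E. x \<in> e \<and> y \<in> e} = (if col x y then 1 else 0)"
proof (cases "col x y")
  case True
  assume "x \<noteq> y"
  obtain e where e: "e \<in> E" "x \<in> e" "y \<in> e" using True by (auto simp: col_def)
  have "f = e" if "f \<in> E" "x \<in> f" "y \<in> f" for f
    using lin[OF that(1) e(1), of x y] that e \<open>x \<noteq> y\<close> by simp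
  then have "{e\<in>E. x \<in> e \<and> y \<in> e} = {e}" using e by blast
  then show ?thesis using True by simp
next
  case False
  assume "x \<noteq> y"
  then have "{e\<in>E. x \<in> e \<and> y \<in> e} = {}" using False by (auto simp: col_def)
  then show ?thesis using False by (simp only: card.empty if_False)
qed

lemma adjacency_eq: "adjacency E x y = (if col x y then 1 else 0)"
proof (cases "x = y")
  case True then show ?thesis by (simp add: adjacency_def col_def)
next
  case False then show ?thesis using card_common[of x y] by (simp add: adjacency_def)
qed

lemma card_col: assumes x: "x \<in> V" shows "card {y\<in>V. col x y} = r * (u - 1)"
proof -
  let ?F = "{e\<in>E. x \<in> e}"
  have "{y\<in>V. col x y} = (\<Union>e\<in>?F. e - {x})" using edges(1) by (auto simp: col_def)
  also have "card \<dots> = (\<Sum>e\<in>?F. card (e - {x}))"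
  proof (rule card_UN_disjoint)
    show "\<forall>e\<in>?F. finite (e - {x})" using edges(1) finV finite_subset by blast
    show "\<forall>e\<in>?F. \<forall>f\<in>?F. e \<noteq> f \<longrightarrow> (e - {x}) \<inter> (f - {x}) = {}"
    proof (intro ballI impI, rule ccontr)
      fix e f assume ef: "e \<in> ?F" "f \<in> ?F" "e \<noteq> f" "(e - {x}) \<inter> (f - {x}) \<noteq> {}"
      then obtain y where "y \<in> e" "y \<in> f" "y \<noteq> x" by auto
      then show False using lin[of e f x y] ef by auto
    qed
  qed (simp add: finE)
  also have "\<dots> = (\<Sum>e\<in>?F. u - 1)" using edges(2) by (intro sum.cong) auto
  also have "\<dots> = r * (u - 1)" using deg[OF x] by simp
  finally show ?thesis .
qed

lemma row_sum: assumes "x \<in> V" shows "(\<Sum>y\<in>V. real (adjacency E x y)) = real (r * (u - 1))"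
proof -
  have "(\<Sum>y\<in>V. real (adjacency E x y)) = (\<Sum>y\<in>V. if col x y then 1 else 0)"
    by (simp add: adjacency_eq if_distrib cong: if_cong)
  also have "\<dots> = real (card {y\<in>V. col x y})" using finV by (simp add: sum.If_cases Int_def)
  finally show ?thesis using card_col[OF assms] by simp
qed

lemma sum_card_incidence:
  assumes "X \<subseteq> V"
  shows "(\<Sum>e\<in>E. card (e \<inter> X)) = r * card X"
proof -
  have fX: "finite X" using assms finV finite_subset by auto
  have "r * card X = (\<Sum>x\<in>X. card {e\<in>E. x \<in> e})" using deg assms by (simp add: subset_iff)
  also have "\<dots> = (\<Sum>e\<in>E. card {x\<in>X. x \<in> e})" by (rule sum_multicount_gen) (auto simp: fX finE)
  also have "\<dots> = (\<Sum>e\<in>E. card (e \<inter> X))" by (simp add: Int_def conj_commute)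
  finally show ?thesis by simp
qed

lemma card_edges: "u * card E = r * card V"
proof -
  have "(\<Sum>e\<in>E. card (e \<inter> V)) = (\<Sum>e\<in>E. u)"
    using edges by (intro sum.cong) (auto simp: Int_absorb2)
  then show ?thesis using sum_card_incidence[of V] by simp
qed

text \<open>An edge meets \<open>K\<close> at most once, so \<open>r * card K \<le> card E\<close>,
  while \<open>u * card E = r * card V\<close>.\<close>

lemma coclique_bound:
  assumes K: "K \<subseteq> V" "\<And>x y. x \<in> K \<Longrightarrow> y \<in> K \<Longrightarrow> \<not> col x y" and r: "0 < r"
  shows "u * card K \<le> card V"
proof -
  have fK: "finite K" by (rule finite_subset[OF K(1) finV])
  have "r * card K = (\<Sum>e\<in>E. card (e \<inter> K))" using sum_card_incidence[OF K(1)] by simp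
  also have "\<dots> \<le> (\<Sum>e\<in>E. 1)"
  proof (rule sum_mono)
    fix e assume e: "e \<in> E"
    have "a = b" if "a \<in> e \<inter> K" "b \<in> e \<inter> K" for a b
      using that e K(2)[of a b] by (auto simp: col_def)
    then have "card (e \<inter> K) \<le> Suc 0" using fK by (subst card_le_Suc0_iff_eq) auto
    then show "card (e \<inter> K) \<le> 1" by simp
  qed
  finally have "u * (r * card K) \<le> u * card E" by simp
  then have "r * (u * card K) \<le> r * card V" unfolding card_edges by (simp add: mult_ac)
  then show ?thesis using r by simp
qed

text \<open>Expands the variance of \<open>card (e \<inter> X)\<close> over all edges, as every point of \<open>X\<close> is collinear with
  every point outside.\<close>

lemma complement_connected:
  assumes n: "u * r < card V" and X: "X \<subseteq> V" "X \<noteq> {}"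
    and closed: "\<And>x y. x \<in> X \<Longrightarrow> y \<in> V \<Longrightarrow> x \<noteq> y \<Longrightarrow> \<not> col x y \<Longrightarrow> y \<in> X"
  shows "X = V"
proof (rule ccontr)
  assume "X \<noteq> V"
  define Y where "Y = V - X"
  have fin: "finite X" "finite Y" using X finV finite_subset by (auto simp: Y_def)
  have "Y \<noteq> {}" using X \<open>X \<noteq> V\<close> by (auto simp: Y_def)
  then have Y0: "0 < card Y" and X0: "0 < card X" using fin X by (auto simp: card_gt_0_iff)
  have V: "card V = card X + card Y"
    unfolding Y_def using card_Diff_subset[OF fin(1) X(1)] card_mono[OF finV X(1)] by simp
  have prod: "(\<Sum>e\<in>E. card (e \<inter> X) * card (e \<inter> Y)) = card X * card Y"
  proof -
    have "card (e \<inter> X) * card (e \<inter> Y) = (\<Sum>x\<in>X. \<Sum>y\<in>Y. if x \<in> e \<and> y \<in> e then 1 else 0)" for e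
    proof -
      have "card (e \<inter> X) = (\<Sum>x\<in>X. if x \<in> e then 1 else 0)" "card (e \<inter> Y) = (\<Sum>x\<in>Y. if x \<in> e then 1 else 0)"
        using fin by (simp_all add: sum.If_cases Int_commute)
      then show ?thesis by (auto simp: sum_product intro!: sum.cong)
    qed
    then have "(\<Sum>e\<in>E. card (e \<inter> X) * card (e \<inter> Y)) = (\<Sum>e\<in>E. \<Sum>x\<in>X. \<Sum>y\<in>Y. if x \<in> e \<and> y \<in> e then 1 else 0)"
      by simp
    also have "\<dots> = (\<Sum>x\<in>X. \<Sum>e\<in>E. \<Sum>y\<in>Y. if x \<in> e \<and> y \<in> e then 1 else 0)" by (rule sum.swap)
    also have "\<dots> = (\<Sum>x\<in>X. \<Sum>y\<in>Y. \<Sum>e\<in>E. if x \<in> e \<and> y \<in> e then 1 else 0)"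
      by (intro sum.cong refl) (rule sum.swap)
    also have "\<dots> = (\<Sum>x\<in>X. \<Sum>y\<in>Y. 1)"
    proof (intro sum.cong refl)
      fix x y assume xy: "x \<in> X" "y \<in> Y"
      then have "x \<noteq> y" "col x y" using closed[of x y] by (auto simp: Y_def)
      then have "card {e\<in>E. x \<in> e \<and> y \<in> e} = 1" using card_common by simp
      then show "(\<Sum>e\<in>E. if x \<in> e \<and> y \<in> e then 1 else 0) = (1::nat)"
        using finE by (simp add: sum.If_cases Int_def)
    qed
    finally show ?thesis by simp
  qed
  define i where "i e = real (card (e \<inter> X))" for e
  define n where "n = real (card V)"
  define a where "a = real (card X)"
  define b where "b = real (card Y)"
  define k where "k = real u * real r"
  have S1: "(\<Sum>e\<in>E. i e) = r * a"
    using sum_card_incidence[OF X(1)] by (simp add: i_def a_def flip: of_nat_sum of_nat_mult)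
  have split: "card (e \<inter> X) + card (e \<inter> Y) = u" if "e \<in> E" for e
  proof -
    have "e = (e \<inter> X) \<union> (e \<inter> Y)" using edges(1)[OF that] by (auto simp: Y_def)
    then have "card e = card (e \<inter> X) + card (e \<inter> Y)"
      using fin by (metis (no_types, lifting) Diff_disjoint Y_def card_Un_disjoint finite_Int inf_assoc inf_bot_right inf_left_commute)
    then show ?thesis using edges(2)[OF that] by simp
  qed
  have S2: "(\<Sum>e\<in>E. i e * i e) = k * a - a * b"
  proof -
    have "(\<Sum>e\<in>E. i e * i e) = (\<Sum>e\<in>E. u * i e - real (card (e \<inter> X) * card (e \<inter> Y)))"
    proof (rule sum.cong[OF refl])
      fix e assume "e \<in> E"
      then have "real u = i e + real (card (e \<inter> Y))" using split[of e] by (simp add: i_def flip: of_nat_add)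
      then show "i e * i e = u * i e - real (card (e \<inter> X) * card (e \<inter> Y))" by (simp add: i_def algebra_simps)
    qed
    also have "\<dots> = u * (r * a) - real (card X * card Y)"
      by (simp only: sum_subtractf sum_distrib_left[symmetric] S1 of_nat_sum[symmetric] prod)
    finally show ?thesis by (simp add: a_def b_def k_def)
  qed
  have E: "u * real (card E) = r * n" using card_edges by (simp add: n_def flip: of_nat_mult)
  \<comment> \<open>The mean of \<open>i\<close> over the edges is \<open>u * a / n\<close>. The
    scaled variance evaluates to \<open>n * a * b * (k - n)\<close>, which is negative as
    \<open>k = u * r\<close> is less than \<open>n\<close>.\<close>
  have "0 \<le> (\<Sum>e\<in>E. (n * i e - u * a)\<^sup>2)" by (rule sum_nonneg) simp
  also have "\<dots> = (\<Sum>e\<in>E. n * n * (i e * i e) - 2 * n * u * a * i e + u * u * a * a)"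
    by (rule sum.cong) (simp_all add: power2_eq_square algebra_simps)
  also have "\<dots> = n * n * (k * a - a * b) - 2 * n * u * a * (r * a) + u * a * a * (real u * real (card E))"
    by (simp only: sum.distrib sum_subtractf sum_distrib_left[symmetric] S1 S2 sum_constant) (simp add: mult_ac)
  also have "\<dots> = n * a * (n * (k - b) - k * a)" unfolding E by (simp add: k_def algebra_simps)
  also have "n * (k - b) - k * a = b * (k - n)"
    using V by (simp add: n_def a_def b_def algebra_simps)
  finally have "0 \<le> n * a * (b * (k - n))" .
  moreover have "0 < n * a * b" using X0 Y0 V by (simp add: n_def a_def b_def)
  moreover have "k < n" using n by (simp add: k_def n_def flip: of_nat_mult)
  ultimately show False using mult_pos_neg[of "n * a * b" "k - n"] by (simp add: mult.assoc)
qed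

text \<open>Maximum principle: at a maximum of \<open>f\<close> the equation forces equality at all
  collinear points, and walks spread it over \<open>V\<close>.\<close>

lemma constant_if_eigenvector:
  assumes f: "\<And>x. x \<in> V \<Longrightarrow> (\<Sum>y\<in>V. real (adjacency E x y) * f y) = real (r * (u - 1)) * f x"
    and ab: "a \<in> V" "b \<in> V"
  shows "f a = f b"
proof -
  define m where "m = Max (f ` V)"
  have ne: "f ` V \<noteq> {}" "finite (f ` V)" using ab finV by auto
  have le: "f y \<le> m" if "y \<in> V" for y using that ne by (simp add: m_def)
  obtain z where z: "z \<in> V" "f z = m" using Max_in[OF ne(2,1)] by (auto simp: m_def)
  have step: "f y = m" if x: "x \<in> V" "f x = m" and y: "y \<in> V" "col x y" for x y
  proof -
    have "(\<Sum>y\<in>V. real (adjacency E x y) * (m - f y)) = m * real (r * (u - 1)) - real (r * (u - 1)) * f x"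
      using f[OF x(1)] row_sum[OF x(1)] by (simp add: right_diff_distrib sum_subtractf flip: sum_distrib_right)
    then have "(\<Sum>y\<in>V. real (adjacency E x y) * (m - f y)) = 0" using x by simp
    then have "real (adjacency E x y) * (m - f y) = 0"
      using sum_nonneg_eq_0_iff[OF finV, of "\<lambda>y. real (adjacency E x y) * (m - f y)"] le y by auto
    then show ?thesis using y by (simp add: adjacency_eq)
  qed
  have "f w = m" if w: "w \<in> V" for w
  proof -
    obtain xs es where walk: "walk V E xs es" "hd xs = z" "last xs = w"
      using connected z w unfolding connected_hypergraph_def by blast
    have len: "length xs = length es + 1" and V: "set xs \<subseteq> V" using walk by (auto simp: walk_def)
    have "f (xs ! i) = m" if "i < length xs" for i
      using that
    proof (induction i)
      case 0
      then show ?case using z walk(2) by (simp add: hd_conv_nth)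
    next
      case (Suc i)
      then have "i < length es" using len by simp
      then have "xs ! i \<in> es ! i" "xs ! Suc i \<in> es ! i" "xs ! i \<noteq> xs ! Suc i" "es ! i \<in> E"
        using walk(1) by (auto simp: walk_def)
      then have "col (xs ! i) (xs ! Suc i)" by (auto simp: col_def)
      moreover have "xs ! i \<in> V" "xs ! Suc i \<in> V" using Suc.prems V nth_mem[of _ xs] by auto
      moreover have "f (xs ! i) = m" using Suc by simp
      ultimately show ?case using step by blast
    qed
    moreover have "xs \<noteq> []" using len by auto
    ultimately show ?thesis using walk(3) len by (auto simp: last_conv_nth)
  qed
  then show ?thesis using ab by simp
qed

section \<open>From the second eigenvalue to the Gram matrix and the upper bound\<close>

lemma degree_less: assumes "x \<in> V" shows "r * (u - 1) < card V"
proof -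
  have "{y\<in>V. col x y} \<subset> V" using assms by (auto simp: col_def)
  then show ?thesis using psubset_card_mono[OF finV] card_col[OF assms] by metis
qed

text \<open>If \<open>\<mu>\<close> exceeded \<open>\<theta>\<close>, then \<open>\<mu>\<close> and
  the degree would be two eigenvalues above \<open>\<theta>\<close>. They differ, because
  eigenvectors for the degree are constant and \<open>f\<close> is a nonzero function of sum
  0.\<close>

lemma eigenvalue_le_second:
  assumes V: "a \<in> V" and f: "(\<Sum>x\<in>V. f x) = 0" "x \<in> V" "f x \<noteq> 0"
    and ev: "\<And>x. x \<in> V \<Longrightarrow> (\<Sum>y\<in>V. real (adjacency E x y) * f y) = \<mu> * f x"
    and th: "second_eigenvalue V E \<le> \<theta>" "\<theta> < real (r * (u - 1))"
  shows "\<mu> \<le> \<theta>"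
proof (rule ccontr)
  assume gt: "\<not> \<mu> \<le> \<theta>"
  let ?k = "real (r * (u - 1))"
  have "\<mu> \<noteq> ?k"
  proof
    assume "\<mu> = ?k"
    then have "f y = f x" if "y \<in> V" for y using constant_if_eigenvector[of f y x] ev f that by simp
    then have "(\<Sum>y\<in>V. f y) = card V * f x" by simp
    then show False using f finV by auto
  qed
  have "?k \<in># eigenvalues_mset V E"
    unfolding eigenvalues_mset_iff[OF finV] root_char_poly_adjacency_iff[OF finV]
    by (rule exI[of _ "\<lambda>_. 1"]) (use V row_sum in auto)
  moreover have "\<mu> \<in># eigenvalues_mset V E"
    unfolding eigenvalues_mset_iff[OF finV] root_char_poly_adjacency_iff[OF finV]
    using ev f by blast
  ultimately have "min \<mu> ?k \<le> second_eigenvalue V E"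
    unfolding second_eigenvalue_def
    using nth_1_rev_sorted_ge[of \<mu> "eigenvalues_mset V E" ?k] nth_1_rev_sorted_ge[of ?k "eigenvalues_mset V E" \<mu>] \<open>\<mu> \<noteq> ?k\<close>
    by linarith
  then show False using th gt by linarith
qed

text \<open>This is J + I - A, or equivalently 2 I plus the adjacency matrix of the
  complement.\<close>

definition gram :: "'a \<Rightarrow> 'a \<Rightarrow> real" where
  "gram x y = (if x = y then 2 else if col x y then 0 else 1)"

text \<open>Split \<open>c\<close> into its mean \<open>m\<close> and a part \<open>b\<close> of sum
  0. On \<open>b\<close> the form is I - A, nonnegative by the eigenvalue bound; the constant part
  contributes \<open>n * m * m * (n + 1 - k)\<close>, where k is the degree, and regularity removes
  the cross terms.\<close>

lemma gram_psd:
  assumes V: "a \<in> V" and th: "second_eigenvalue V E \<le> 1" "1 < r * (u - 1)"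
  shows "0 \<le> (\<Sum>x\<in>V. \<Sum>y\<in>V. c x * c y * gram x y)"
proof -
  let ?k = "real (r * (u - 1))" and ?A = "\<lambda>x y. real (adjacency E x y)"
  define n where "n = real (card V)"
  have n0: "0 < n" using V finV by (auto simp: n_def card_gt_0_iff)
  define m where "m = (\<Sum>x\<in>V. c x) / n"
  define b where "b x = c x - m" for x
  have sb: "(\<Sum>x\<in>V. b x) = 0" using n0 by (simp add: b_def sum_subtractf m_def n_def)
  have sc: "(\<Sum>x\<in>V. c x) = n * m" using n0 by (simp add: m_def)
  have c: "c x = b x + m" for x by (simp add: b_def)
  have sym: "?A x y = ?A y x" for x y using col_sym[of x y] by (simp add: adjacency_eq)
  have th': "1 < ?k" using th(2) by (metis of_nat_1 of_nat_less_iff)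
  have le: "(\<Sum>x\<in>V. \<Sum>y\<in>V. b x * b y * ?A x y) \<le> 1 * (\<Sum>x\<in>V. b x * b x)"
  proof (rule quadratic_form_le[OF finV sym row_sum _ sb])
    fix f \<mu> assume "(\<Sum>x\<in>V. f x) = 0" "\<And>x. x \<in> V \<Longrightarrow> (\<Sum>y\<in>V. ?A x y * f y) = \<mu> * f x" "\<exists>x\<in>V. f x \<noteq> 0"
    then show "\<mu> \<le> 1" using eigenvalue_le_second[OF V _ _ _ _ th(1) th'] by blast
  qed
  have not_col: "\<not> col x x" for x by (simp add: col_def)
  have row: "(\<Sum>x\<in>V. \<Sum>y\<in>V. g x * ?A x y) = ?k * (\<Sum>x\<in>V. g x)" for g
  proof -
    have "(\<Sum>x\<in>V. \<Sum>y\<in>V. g x * ?A x y) = (\<Sum>x\<in>V. g x * ?k)"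
      by (rule sum.cong) (simp_all only: sum_distrib_left[symmetric] row_sum)
    then show ?thesis by (simp only: sum_distrib_right[symmetric] mult.commute)
  qed
  have "(\<Sum>x\<in>V. \<Sum>y\<in>V. c x * c y * ?A x y) =
    (\<Sum>x\<in>V. \<Sum>y\<in>V. b x * b y * ?A x y) + m * (\<Sum>x\<in>V. \<Sum>y\<in>V. b x * ?A x y)
      + m * (\<Sum>x\<in>V. \<Sum>y\<in>V. b y * ?A x y) + m * (\<Sum>x\<in>V. \<Sum>y\<in>V. m * ?A x y)"
    by (simp add: c algebra_simps sum.distrib sum_distrib_left)
  also have "(\<Sum>x\<in>V. \<Sum>y\<in>V. b y * ?A x y) = (\<Sum>x\<in>V. \<Sum>y\<in>V. b x * ?A x y)"
    by (subst sum.swap) (simp add: sym)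
  finally have cAc: "(\<Sum>x\<in>V. \<Sum>y\<in>V. c x * c y * ?A x y) = (\<Sum>x\<in>V. \<Sum>y\<in>V. b x * b y * ?A x y) + m * m * n * ?k"
    unfolding row sb by (simp add: n_def mult_ac)
  have cc: "(\<Sum>x\<in>V. c x * c x) = (\<Sum>x\<in>V. b x * b x) + n * m * m"
  proof -
    have "(\<Sum>x\<in>V. c x * c x) = (\<Sum>x\<in>V. b x * b x + (2 * m) * b x + m * m)"
      by (simp add: c algebra_simps)
    also have "\<dots> = (\<Sum>x\<in>V. b x * b x) + (2 * m) * (\<Sum>x\<in>V. b x) + n * (m * m)"
      by (simp only: sum.distrib sum_distrib_left[symmetric] sum_constant n_def) (simp add: mult_ac)
    finally show ?thesis by (simp add: sb)
  qed
  have "(\<Sum>x\<in>V. \<Sum>y\<in>V. c x * c y * gram x y) =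
    (\<Sum>x\<in>V. \<Sum>y\<in>V. c x * c y + (if y = x then c x * c x else 0) - c x * c y * ?A x y)"
    by (intro sum.cong refl) (simp_all add: gram_def adjacency_eq not_col)
  also have "\<dots> = (\<Sum>x\<in>V. c x) * (\<Sum>x\<in>V. c x) + (\<Sum>x\<in>V. c x * c x) - (\<Sum>x\<in>V. \<Sum>y\<in>V. c x * c y * ?A x y)"
    using finV by (simp add: sum.distrib sum_subtractf sum_product)
  also have "\<dots> \<ge> n * m * m * (n + 1 - ?k)"
    unfolding cAc cc sc using le by (simp add: algebra_simps)
  finally have ge: "n * m * m * (n + 1 - ?k) \<le> (\<Sum>x\<in>V. \<Sum>y\<in>V. c x * c y * gram x y)" .
  have "?k < n" using degree_less[OF V] unfolding n_def by (simp only: of_nat_less_iff)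
  then have "0 \<le> (n * (m * m)) * (n + 1 - ?k)" using n0
    by (intro mult_nonneg_nonneg[OF mult_nonneg_nonneg[OF _ zero_le_square]]) auto
  then have "0 \<le> n * m * m * (n + 1 - ?k)" by (simp only: mult.assoc)
  then show ?thesis using ge by linarith
qed

lemma card_le:
  assumes u: "3 \<le> u" and r: "7 * u \<le> r + 5" and th: "second_eigenvalue V E \<le> 1"
  shows "card V \<le> u * (r + 1)"
proof (rule ccontr)
  assume "\<not> card V \<le> u * (r + 1)"
  then obtain t where t: "card V = u * (r + 1) + t" "1 \<le> t"
    by (metis less_imp_add_positive linorder_not_less One_nat_def Suc_leI)
  have r16: "16 \<le> r" using u r by linarith
  define k where "k = r * (u - 1)"
  \<comment> \<open>Together with \<open>dk\<close> this gives \<open>d = u + r + t - 1\<close>,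
    which is at least 3 + 16 + 1 - 1 = 19.\<close>
  have ku: "k + r = u * r" using u by (cases u) (auto simp: k_def)
  have "16 * 2 \<le> r * (u - 1)" using r16 u by (intro mult_le_mono) auto
  then have k1: "1 < k" by (simp add: k_def)
  have "V \<noteq> {}" using t by auto
  then obtain a where a: "a \<in> V" by blast
  have gs: "gram x y = gram y x" for x y using col_sym[of x y] by (auto simp: gram_def)
  obtain \<phi> :: "'a \<Rightarrow> fsvec" where \<phi>: "\<And>x y. x \<in> V \<Longrightarrow> y \<in> V \<Longrightarrow> \<phi> x \<bullet> \<phi> y = gram x y"
    using gram_embedding[of V gram, OF finV gs gram_psd[OF a th]] k1 unfolding k_def by blast
  define D where "D x y \<longleftrightarrow> x \<in> V \<and> y \<in> V \<and> x \<noteq> y \<and> \<not> col x y" for x y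
  define d where "d = card V - 1 - k"
  have kn: "k < card V" using degree_less[OF a] by (simp add: k_def)
  have dk: "d + 1 + k = card V" using kn by (simp add: d_def)
  have degD: "card {y\<in>V. D x y} = d" if x: "x \<in> V" for x
  proof -
    have "V = insert x ({y\<in>V. D x y} \<union> {y\<in>V. col x y})" using x by (auto simp: D_def)
    then have "card V = card (insert x ({y\<in>V. D x y} \<union> {y\<in>V. col x y}))" by simp
    also have "\<dots> = Suc (card ({y\<in>V. D x y} \<union> {y\<in>V. col x y}))"
      using finV by (intro card_insert_disjoint) (auto simp: D_def col_def)
    also have "card ({y\<in>V. D x y} \<union> {y\<in>V. col x y}) = card {y\<in>V. D x y} + k"
      using finV card_col[OF x] by (subst card_Un_disjoint) (auto simp: D_def k_def)
    finally show ?thesis using dk by simp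
  qed
  define \<tau> where "\<tau> = (1 / (real d + 2)) *\<^sub>R (\<Sum>x\<in>V. \<phi> x)"
  have ip: "\<phi> x \<bullet> \<phi> y = (if x = y then 2 else if D x y then 1 else 0)" if "x \<in> V" "y \<in> V" for x y
    using \<phi>[OF that] that by (auto simp: gram_def D_def)
  have tau: "\<tau> \<bullet> \<phi> x = 1" if x: "x \<in> V" for x
  proof -
    have "(\<Sum>y\<in>V. \<phi> y \<bullet> \<phi> x) = (\<Sum>y\<in>V. (if y = x then 2 else 0) + (if y \<in> {y\<in>V. D x y} then 1 else 0))"
      using x by (intro sum.cong refl) (auto simp: ip D_def col_sym)
    also have "\<dots> = 2 + real d"
      using finV x degD[OF x] by (simp add: sum.distrib sum.If_cases Int_def)
    finally show ?thesis by (simp add: \<tau>_def inner_sum_left)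
  qed
  interpret G: large_root_graph V D \<phi> \<tau> d
  proof
    show "finite V" by (rule finV)
    show "D x y = D y x" for x y using col_sym[of x y] by (auto simp: D_def)
    show "(\<Sum>x\<in>V. \<phi> x) = (real d + 2) *\<^sub>R \<tau>" by (simp add: \<tau>_def)
    show "X = V" if "X \<subseteq> V" "X \<noteq> {}" "\<And>x y. x \<in> X \<Longrightarrow> y \<in> V \<Longrightarrow> D x y \<Longrightarrow> y \<in> X" for X
      by (rule complement_connected[OF _ that(1,2)]) (use that t in \<open>auto simp: D_def algebra_simps\<close>)
    have "3 * 17 \<le> u * (r + 1)" using u r16 by (intro mult_le_mono) auto
    then show "29 \<le> card V" using t by simp
    show "19 \<le> d" using dk t ku u r16 by (simp add: algebra_simps)
    show "card V \<noteq> d + 2" using dk k1 by simp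
  qed (use ip degD tau in \<open>auto simp: D_def\<close>)
  show False
  proof (rule G.large_order_impossible)
    show "3 \<le> u" "7 * u \<le> (r + 1) + 4" "1 \<le> t" "card V = u * (r + 1) + t" using u r t by auto
    show "d + 2 = u + (r + 1) + t" using dk t ku by (simp add: algebra_simps)
    show "u * card K \<le> card V" if "G.clique K" for K
    proof (rule coclique_bound)
      show "K \<subseteq> V" using that by (simp add: G.clique_def)
      show "\<not> col x y" if "x \<in> K" "y \<in> K" for x y
      proof
        assume "col x y"
        then have "x \<noteq> y" by (simp add: col_def)
        then have "D x y" using \<open>G.clique K\<close> that by (simp add: G.clique_def)
        then show False using \<open>col x y\<close> by (simp add: D_def)
      qed
    qed (use r16 in simp)
  qed
qed

end

text \<open>Distinct edges e, f through x and y yield the Berge cycle x, e, y, f, x of length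
  2.\<close>

lemma linear_if_girth:
  assumes g: "3 \<le> girth V E" and E: "\<And>e. e \<in> E \<Longrightarrow> e \<subseteq> V"
    and ef: "e \<in> E" "f \<in> E" "{x, y} \<subseteq> e" "{x, y} \<subseteq> f" "x \<noteq> y"
  shows "e = f"
proof (rule ccontr)
  assume "e \<noteq> f"
  have "walk V E [x, y, x] [e, f]"
    unfolding walk_def using ef E by (auto simp: less_Suc_eq numeral_2_eq_2)
  then have "Berge_cycle V E [x, y, x] [e, f]"
    using \<open>e \<noteq> f\<close> ef by (simp add: Berge_cycle_def)
  then have "enat 2 \<in> {enat (length es) | xs es. Berge_cycle V E xs es}" by force
  then have "girth V E \<le> enat 2" unfolding girth_def by (rule Inf_lower)
  then have "(3::enat) \<le> enat 2" using g by (rule order_trans[rotated])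
  then show False by (simp add: numeral_eq_enat)
qed

section \<open>The hypergraph of an orthogonal array\<close>

lemma two_le_size:
  assumes "x \<in># X" "y \<in># X" "x \<noteq> y"
  shows "2 \<le> size X"
proof -
  obtain Y where Y: "X = add_mset x Y" using assms(1) by (metis insert_DiffM)
  then have "y \<in># Y" using assms by auto
  then obtain Z where "Y = add_mset y Z" by (metis insert_DiffM)
  then show ?thesis using Y by simp
qed

text \<open>The point \<open>c\<close> of group \<open>i < u\<close> is encoded as the vertex \<open>i * s + c\<close>. The columns \<open>j\<close> are the blocks,
  and row \<open>u\<close> of the array sorts them into parallel classes, of which the class \<open>J\<close> with entry 0 is
  deleted; \<open>b x\<close> is the deleted block through \<open>x\<close>. In the coordinates \<open>x div s\<close> and \<open>b x\<close> the
  adjacency matrix is the tensor product of two matrices all-ones minus identity.\<close>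

locale transversal_design =
  fixes a :: "nat \<Rightarrow> nat \<Rightarrow> nat" and u s :: nat
  assumes a_less: "i \<le> u \<Longrightarrow> j < s\<^sup>2 \<Longrightarrow> a i j < s"
    and uniq: "i \<le> u \<Longrightarrow> i' \<le> u \<Longrightarrow> i \<noteq> i' \<Longrightarrow> c < s \<Longrightarrow> c' < s \<Longrightarrow>
      \<exists>!j. j < s\<^sup>2 \<and> a i j = c \<and> a i' j = c'"
    and u_ge: "3 \<le> u" and s_ge: "3 \<le> s"
begin

definition V :: "nat set" where "V = {..<u * s}"
definition blk :: "nat \<Rightarrow> nat set" where "blk j = (\<lambda>i. i * s + a i j) ` {..<u}"
definition E :: "nat set set" where "E = blk ` {j. j < s\<^sup>2 \<and> a u j \<noteq> 0}"
definition J :: "nat set" where "J = {j. j < s\<^sup>2 \<and> a u j = 0}"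
definition b :: "nat \<Rightarrow> nat" where "b x = (THE j. j < s\<^sup>2 \<and> a u j = 0 \<and> a (x div s) j = x mod s)"

lemma s_pos: "0 < s" using s_ge by simp

lemma finV: "finite V" by (simp add: V_def)

lemma div_less: "x \<in> V \<Longrightarrow> x div s < u" by (simp add: V_def less_mult_imp_div_less)

lemma point_in_V: "i < u \<Longrightarrow> c < s \<Longrightarrow> i * s + c \<in> V"
proof -
  assume "i < u" "c < s"
  then have "i * s + c < Suc i * s" by simp
  also have "\<dots> \<le> u * s" using \<open>i < u\<close> by (intro mult_le_mono1) simp
  finally show ?thesis by (simp add: V_def)
qed

lemma point_div_mod:
  assumes "c < s"
  shows "(i * s + c) div s = i" "(i * s + c) mod s = c"
  using assms s_pos by (simp_all add: div_mult_self3)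

lemma point_eqI:
  assumes "x div s = y div s" "x mod s = y mod s"
  shows "x = y"
proof -
  have "x = x div s * s + x mod s" by (rule div_mult_mod_eq[symmetric])
  also have "\<dots> = y div s * s + y mod s" by (simp only: assms)
  also have "\<dots> = y" by (rule div_mult_mod_eq)
  finally show ?thesis .
qed

lemma mem_blk: "j < s\<^sup>2 \<Longrightarrow> x \<in> blk j \<longleftrightarrow> x \<in> V \<and> a (x div s) j = x mod s"
proof
  assume j: "j < s\<^sup>2" and "x \<in> blk j"
  then obtain i where i: "i < u" "x = i * s + a i j" by (auto simp: blk_def)
  have "a i j < s" using a_less[of i j] i j by simp
  then show "x \<in> V \<and> a (x div s) j = x mod s" using i point_in_V by simp
next
  assume j: "j < s\<^sup>2" and x: "x \<in> V \<and> a (x div s) j = x mod s"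
  then have "x = (x div s) * s + a (x div s) j" by simp
  then show "x \<in> blk j" using div_less x unfolding blk_def by blast
qed

lemma blk_inj: "j < s\<^sup>2 \<Longrightarrow> j' < s\<^sup>2 \<Longrightarrow> blk j = blk j' \<Longrightarrow> j = j'"
proof -
  assume j: "j < s\<^sup>2" "j' < s\<^sup>2" "blk j = blk j'"
  have "a i j = a i j'" if i: "i < u" for i
  proof -
    have less: "a i j < s" using a_less i j by simp
    have "i * s + a i j \<in> blk j'" using i j(3) by (auto simp: blk_def)
    then show ?thesis using mem_blk[OF j(2)] less by simp
  qed
  then have "a 0 j = a 0 j'" "a 1 j = a 1 j'" using u_ge by auto
  moreover have "\<exists>!l. l < s\<^sup>2 \<and> a 0 l = a 0 j \<and> a 1 l = a 1 j"
    using u_ge j a_less by (intro uniq) simp_all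
  ultimately show ?thesis using j(1,2) by metis
qed

lemma b_props:
  assumes x: "x \<in> V"
  shows "b x \<in> J" "a (x div s) (b x) = x mod s"
    and "j \<in> J \<Longrightarrow> a (x div s) j = x mod s \<Longrightarrow> j = b x"
proof -
  have ex: "\<exists>!j. j < s\<^sup>2 \<and> a u j = 0 \<and> a (x div s) j = x mod s"
    using uniq[of u "x div s" 0 "x mod s"] div_less[OF x] s_pos by simp
  then have "b x < s\<^sup>2 \<and> a u (b x) = 0 \<and> a (x div s) (b x) = x mod s"
    unfolding b_def by (rule theI')
  then show "b x \<in> J" "a (x div s) (b x) = x mod s" by (simp_all add: J_def)
  then show "j \<in> J \<Longrightarrow> a (x div s) j = x mod s \<Longrightarrow> j = b x" using ex by (auto simp: J_def)
qed

lemma meet: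
  assumes i: "i < u" and j: "j \<in> J"
  shows "i * s + a i j \<in> V" "(i * s + a i j) div s = i" "b (i * s + a i j) = j"
proof -
  have less: "a i j < s" using a_less i j by (simp add: J_def)
  show p: "i * s + a i j \<in> V" "(i * s + a i j) div s = i" using point_in_V i less by simp_all
  show "b (i * s + a i j) = j" using b_props(3)[OF p(1) j] p less by simp
qed

lemma meet_eq:
  assumes "x \<in> V"
  shows "(x div s) * s + a (x div s) (b x) = x"
  unfolding b_props(2)[OF assms] by (rule div_mult_mod_eq)

lemma card_J: "card J = s"
proof -
  have "bij_betw (a 0) J {..<s}" unfolding bij_betw_def
  proof
    show "inj_on (a 0) J"
    proof (rule inj_onI)
      fix j j' assume jj: "j \<in> J" "j' \<in> J" "a 0 j = a 0 j'"
      have "a 0 j < s" using a_less jj by (simp add: J_def)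
      then show "j = j'" using uniq[of u 0 0 "a 0 j"] jj s_pos u_ge by (auto simp: J_def)
    qed
    show "a 0 ` J = {..<s}"
    proof
      show "a 0 ` J \<subseteq> {..<s}" using a_less by (auto simp: J_def)
      show "{..<s} \<subseteq> a 0 ` J"
      proof
        fix c assume "c \<in> {..<s}"
        then obtain j where "j < s\<^sup>2" "a u j = 0" "a 0 j = c" using uniq[of u 0 0 c] s_pos u_ge by auto
        then show "c \<in> a 0 ` J" by (auto simp: J_def)
      qed
    qed
  qed
  then show ?thesis using bij_betw_same_card by fastforce
qed

lemma finJ: "finite J" by (simp add: J_def)

text \<open>Points of different groups lie on exactly one block, and it is lost precisely when it is
  the deleted block through both.\<close>

lemma common_edge_iff:
  assumes xy: "x \<in> V" "y \<in> V" "x \<noteq> y"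
  shows "(\<exists>e\<in>E. x \<in> e \<and> y \<in> e) \<longleftrightarrow> x div s \<noteq> y div s \<and> b x \<noteq> b y"
proof
  assume "\<exists>e\<in>E. x \<in> e \<and> y \<in> e"
  then obtain j where j: "j < s\<^sup>2" "a u j \<noteq> 0" "x \<in> blk j" "y \<in> blk j" by (auto simp: E_def)
  then have m: "a (x div s) j = x mod s" "a (y div s) j = y mod s" using mem_blk by auto
  have d: "x div s \<noteq> y div s" using m point_eqI[of x y] xy(3) by auto
  moreover have "b x \<noteq> b y"
  proof
    assume "b x = b y"
    then have "a (y div s) (b x) = y mod s" using b_props(2)[OF xy(2)] by simp
    moreover have "b x < s\<^sup>2" using b_props(1)[OF xy(1)] by (simp add: J_def)
    ultimately have "b x = j"
      using uniq[of "x div s" "y div s" "x mod s" "y mod s"] d m j(1) b_props(2)[OF xy(1)] div_less[OF xy(1)] div_less[OF xy(2)] s_pos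
      by auto
    then show False using b_props(1)[OF xy(1)] j(2) by (simp add: J_def)
  qed
  ultimately show "x div s \<noteq> y div s \<and> b x \<noteq> b y" by simp
next
  assume h: "x div s \<noteq> y div s \<and> b x \<noteq> b y"
  then obtain j where j: "j < s\<^sup>2" "a (x div s) j = x mod s" "a (y div s) j = y mod s"
    using uniq[of "x div s" "y div s" "x mod s" "y mod s"] div_less[OF xy(1)] div_less[OF xy(2)] s_pos by auto
  have "a u j \<noteq> 0"
  proof
    assume "a u j = 0"
    then have "j \<in> J" using j by (simp add: J_def)
    then show False using b_props(3)[OF xy(1)] b_props(3)[OF xy(2)] j h by metis
  qed
  then have "blk j \<in> E" using j(1) by (auto simp: E_def)
  moreover have "x \<in> blk j" "y \<in> blk j" using j mem_blk xy by auto
  ultimately show "\<exists>e\<in>E. x \<in> e \<and> y \<in> e" by blast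
qed

lemma edges:
  assumes "e \<in> E"
  shows "e \<subseteq> V" "card e = u"
proof -
  obtain j where j: "j < s\<^sup>2" "e = blk j" using assms by (auto simp: E_def)
  show "e \<subseteq> V" using mem_blk j by auto
  have "inj_on (\<lambda>i. i * s + a i j) {..<u}"
  proof (rule inj_onI)
    fix i i' assume "i \<in> {..<u}" "i' \<in> {..<u}" "i * s + a i j = i' * s + a i' j"
    then have "(i * s + a i j) div s = (i' * s + a i' j) div s" "a i j < s" "a i' j < s"
      using a_less j(1) by simp_all
    then show "i = i'" using point_div_mod(1)[of "a i j" i] point_div_mod(1)[of "a i' j" i'] by metis
  qed
  then show "card e = u" unfolding j(2) blk_def by (simp add: card_image)
qed

lemma edges_linear:
  assumes "e \<in> E" "f \<in> E" "{x, y} \<subseteq> e" "{x, y} \<subseteq> f" "x \<noteq> y"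
  shows "e = f"
proof -
  obtain j j' where j: "j < s\<^sup>2" "e = blk j" and j': "j' < s\<^sup>2" "f = blk j'" using assms by (auto simp: E_def)
  have xy: "x \<in> V" "y \<in> V" using assms mem_blk[OF j(1)] j by auto
  have m: "a (x div s) j = x mod s" "a (y div s) j = y mod s" "a (x div s) j' = x mod s" "a (y div s) j' = y mod s"
    using assms mem_blk j j' by auto
  have "x div s \<noteq> y div s" using m point_eqI[of x y] assms(5) by auto
  then have "j = j'" using uniq[of "x div s" "y div s" "x mod s" "y mod s"] m j j' div_less xy s_pos
    by (metis mod_less_divisor less_imp_le)
  then show ?thesis using j j' by simp
qed

text \<open>Row \<open>u\<close> takes every symbol once on the blocks through a point, and the
  block with symbol 0 is deleted.\<close>

lemma degree:
  assumes x: "x \<in> V"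
  shows "card {e\<in>E. x \<in> e} = s - 1"
proof -
  let ?I = "{j. j < s\<^sup>2 \<and> a u j \<noteq> 0 \<and> a (x div s) j = x mod s}"
  have "{e\<in>E. x \<in> e} = blk ` ?I" using mem_blk x by (auto simp: E_def)
  moreover have "inj_on blk ?I" using blk_inj by (auto intro: inj_onI)
  ultimately have "card {e\<in>E. x \<in> e} = card ?I" by (simp add: card_image)
  also have "bij_betw (a u) ?I {1..<s}" unfolding bij_betw_def
  proof
    note U = uniq[of u "x div s" _ "x mod s"]
    show "inj_on (a u) ?I"
    proof (rule inj_onI)
      fix j j' assume jj: "j \<in> ?I" "j' \<in> ?I" "a u j = a u j'"
      then show "j = j'" using U[of "a u j"] a_less[of u j] div_less[OF x] s_pos by auto
    qed
    show "a u ` ?I = {1..<s}"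
    proof
      show "a u ` ?I \<subseteq> {1..<s}" using a_less[of u] by auto
      show "{1..<s} \<subseteq> a u ` ?I"
      proof
        fix c assume c: "c \<in> {1..<s}"
        then obtain j where "j < s\<^sup>2" "a u j = c" "a (x div s) j = x mod s" using U[of c] div_less[OF x] s_pos by auto
        then show "c \<in> a u ` ?I" using c by auto
      qed
    qed
  qed
  then have "card ?I = card {1..<s}" by (rule bij_betw_same_card)
  finally show ?thesis by simp
qed

text \<open>Two groups and two deleted blocks can be avoided since there are at least three of each.
  The resulting point is collinear with both given points and so provides walks of length 2.\<close>

lemma ex_point_avoiding: "\<exists>z\<in>V. z div s \<noteq> i1 \<and> z div s \<noteq> i2 \<and> b z \<noteq> j1 \<and> b z \<noteq> j2"
proof -
  have two: "card {p, q} \<le> 2" for p q :: nat by (simp add: card_insert_if)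
  have "\<not> {..<u} \<subseteq> {i1, i2}"
    using card_mono[of "{i1, i2}" "{..<u}"] two[of i1 i2] u_ge by fastforce
  then obtain i where i: "i < u" "i \<noteq> i1" "i \<noteq> i2" by auto
  have "\<not> J \<subseteq> {j1, j2}"
    using card_mono[of "{j1, j2}" J] two[of j1 j2] s_ge card_J by fastforce
  then obtain j where j: "j \<in> J" "j \<noteq> j1" "j \<noteq> j2" by auto
  show ?thesis using meet[OF i(1) j(1)] i j by (intro bexI[of _ "i * s + a i j"]) simp_all
qed

lemma connected: "connected_hypergraph V E"
  unfolding connected_hypergraph_def
proof (intro ballI)
  fix x y assume xy: "x \<in> V" "y \<in> V"
  obtain z where z: "z \<in> V" "z div s \<noteq> x div s" "z div s \<noteq> y div s" "b z \<noteq> b x" "b z \<noteq> b y"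
    using ex_point_avoiding by blast
  have ne: "x \<noteq> z" "z \<noteq> y" using z by auto
  obtain e where e: "e \<in> E" "x \<in> e" "z \<in> e" using common_edge_iff[OF xy(1) z(1) ne(1)] z by metis
  obtain f where f: "f \<in> E" "z \<in> f" "y \<in> f" using common_edge_iff[OF z(1) xy(2) ne(2)] z by metis
  have "walk V E [x, z, y] [e, f]"
    unfolding walk_def using xy z e f ne by (auto simp: less_Suc_eq numeral_2_eq_2)
  then show "\<exists>xs es. walk V E xs es \<and> hd xs = x \<and> last xs = y" by (intro exI[of _ "[x, z, y]"] exI) auto
qed

sublocale linear_hypergraph V E "s - 1" u
proof
  show "finite V" by (rule finV)
  show "connected_hypergraph V E" by (rule connected)
  show "e \<subseteq> V" "card e = u" if "e \<in> E" for e using edges[OF that] by simp_all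
  show "card {e\<in>E. x \<in> e} = s - 1" if "x \<in> V" for x using degree[OF that] .
  show "e = f" if "e \<in> E" "f \<in> E" "{x, y} \<subseteq> e" "{x, y} \<subseteq> f" "x \<noteq> y" for e f x y
    using edges_linear[OF that] .
qed

section \<open>Girth and spectrum of the design\<close>

lemma adjacency_grid:
  assumes "x \<in> V" "y \<in> V"
  shows "adjacency E x y = (if x div s \<noteq> y div s \<and> b x \<noteq> b y then 1 else 0)"
proof -
  have "col x y \<longleftrightarrow> x div s \<noteq> y div s \<and> b x \<noteq> b y"
  proof (cases "x = y")
    case True then show ?thesis by (simp add: col_def)
  next
    case False
    then show ?thesis unfolding common_edge_iff[OF assms False, symmetric] by (simp add: col_def)
  qed
  then show ?thesis by (simp only: adjacency_eq)
qed

lemma girth_ge_3: "3 \<le> girth V E"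
  unfolding girth_def
proof (rule Inf_greatest)
  fix q assume "q \<in> {enat (length es) | xs es. Berge_cycle V E xs es}"
  then obtain xs es where q: "q = enat (length es)" and c: "Berge_cycle V E xs es" by auto
  have w: "walk V E xs es" "es \<noteq> []" "hd xs = last xs" "distinct es" using c by (auto simp: Berge_cycle_def)
  have len: "length xs = Suc (length es)" using w(1) by (simp add: walk_def)
  have step: "xs ! i \<in> es ! i" "xs ! Suc i \<in> es ! i" "xs ! i \<noteq> xs ! Suc i" "es ! i \<in> E" if "i < length es" for i
    using w(1) that by (auto simp: walk_def)
  have closed: "xs ! 0 = xs ! length es" using w(3) len by (metis Suc_neq_Zero diff_Suc_1 hd_conv_nth last_conv_nth list.size(3))
  have "length es \<noteq> 1"
  proof
    assume "length es = 1"
    then show False using step(3)[of 0] closed by simp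
  qed
  moreover have "length es \<noteq> 2"
  proof
    assume l: "length es = 2"
    have "es ! 0 = es ! 1"
      using edges_linear[of "es ! 0" "es ! 1" "xs ! 0" "xs ! 1"] step[of 0] step[of 1] closed l by (simp add: numeral_2_eq_2)
    then show False using w(4) l by (simp add: nth_eq_iff_index_eq)
  qed
  moreover have "length es \<noteq> 0" using w(2) by simp
  ultimately have "3 \<le> length es" by linarith
  then show "3 \<le> q" unfolding q by (simp add: numeral_eq_enat)
qed

text \<open>Inclusion-exclusion: the group and the deleted block of \<open>x\<close> are removed,
  and \<open>x\<close>, their only common point, is restored once.\<close>

lemma sum_grid:
  fixes f :: "nat \<Rightarrow> real"
  assumes x: "x \<in> V"
  shows "(\<Sum>y\<in>V. real (adjacency E x y) * f y) =
    (\<Sum>y\<in>V. f y) - (\<Sum>y | y \<in> V \<and> y div s = x div s. f y) - (\<Sum>y | y \<in> V \<and> b y = b x. f y) + f x"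
proof -
  have eq: "y = x" if "y \<in> V" "y div s = x div s" "b y = b x" for y
    using meet_eq[OF x] meet_eq[OF that(1)] that by simp
  have "(\<Sum>y\<in>V. real (adjacency E x y) * f y) =
    (\<Sum>y\<in>V. f y - (if y div s = x div s then f y else 0) - (if b y = b x then f y else 0) + (if y = x then f y else 0))"
  proof (rule sum.cong[OF refl])
    fix y assume y: "y \<in> V"
    show "real (adjacency E x y) * f y =
      f y - (if y div s = x div s then f y else 0) - (if b y = b x then f y else 0) + (if y = x then f y else 0)"
      using eq[OF y] unfolding adjacency_grid[OF x y]
      by (cases "y div s = x div s"; cases "b y = b x"; cases "y = x") simp_all
  qed
  also have "\<dots> = (\<Sum>y\<in>V. f y) - (\<Sum>y\<in>V. if y div s = x div s then f y else 0)
      - (\<Sum>y\<in>V. if b y = b x then f y else 0) + f x"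
    using finV x by (simp add: sum.distrib sum_subtractf)
  finally show ?thesis by (simp add: sum.inter_filter[OF finV, symmetric])
qed

lemma sum_over_row:
  fixes f :: "nat \<Rightarrow> real"
  assumes i: "i < u"
  shows "(\<Sum>x | x \<in> V \<and> x div s = i. g (b x)) = (\<Sum>j\<in>J. g j)"
proof (rule sum.reindex_bij_betw)
  show "bij_betw b {x. x \<in> V \<and> x div s = i} J"
  proof (rule bij_betwI[where g = "\<lambda>j. i * s + a i j"])
    show "b \<in> {x. x \<in> V \<and> x div s = i} \<rightarrow> J" by (simp add: b_props(1))
    show "(\<lambda>j. i * s + a i j) \<in> J \<rightarrow> {x. x \<in> V \<and> x div s = i}" using meet[OF i] by simp
    show "i * s + a i (b x) = x" if "x \<in> {x. x \<in> V \<and> x div s = i}" for x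
      using that meet_eq[of x] by auto
    show "b (i * s + a i j) = j" if "j \<in> J" for j using meet(3)[OF i that] .
  qed
qed

lemma sum_over_column:
  assumes j: "j \<in> J"
  shows "(\<Sum>x | x \<in> V \<and> b x = j. g (x div s)) = (\<Sum>i<u. g i)"
proof (rule sum.reindex_bij_betw)
  show "bij_betw (\<lambda>x. x div s) {x. x \<in> V \<and> b x = j} {..<u}"
  proof (rule bij_betwI[where g = "\<lambda>i. i * s + a i j"])
    show "(\<lambda>x. x div s) \<in> {x. x \<in> V \<and> b x = j} \<rightarrow> {..<u}" by (simp add: div_less)
    show "(\<lambda>i. i * s + a i j) \<in> {..<u} \<rightarrow> {x. x \<in> V \<and> b x = j}" using meet[OF _ j] by simp
    show "x div s * s + a (x div s) j = x" if "x \<in> {x. x \<in> V \<and> b x = j}" for x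
      using that meet_eq[of x] by auto
    show "(i * s + a i j) div s = i" if "i \<in> {..<u}" for i using meet(2)[OF _ j] that by simp
  qed
qed

lemma sum_rows: "(\<Sum>i<u. \<Sum>x | x \<in> V \<and> x div s = i. f x) = (\<Sum>x\<in>V. f x :: real)"
proof (rule sum.group)
  show "(\<lambda>x. x div s) ` V \<subseteq> {..<u}" by (rule image_subsetI) (simp add: div_less)
qed (simp_all add: finV)

lemma sum_columns: "(\<Sum>j\<in>J. \<Sum>x | x \<in> V \<and> b x = j. f x) = (\<Sum>x\<in>V. f x :: real)"
proof (rule sum.group)
  show "b ` V \<subseteq> J" by (rule image_subsetI) (rule b_props(1))
qed (simp_all add: finV finJ)

text \<open>Summing the equation over a group expresses \<open>R i\<close> through the total
  \<open>T\<close> alone, and likewise for \<open>C j\<close>; the denominators are positive as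
  \<open>\<theta>\<close> exceeds 1. Then \<open>(\<theta> - 1) * f x\<close> does not depend on
  \<open>x\<close>.\<close>

lemma eigenvector_constant:
  assumes ev: "\<And>x. x \<in> V \<Longrightarrow> (\<Sum>y\<in>V. real (adjacency E x y) * f y) = \<theta> * f x" and th: "1 < \<theta>"
    and xy: "x \<in> V" "y \<in> V"
  shows "f x = f y"
proof -
  define T where "T = (\<Sum>y\<in>V. f y)"
  define R where "R i = (\<Sum>y | y \<in> V \<and> y div s = i. f y)" for i
  define C where "C j = (\<Sum>y | y \<in> V \<and> b y = j. f y)" for j
  have eq: "\<theta> * f x = T - R (x div s) - C (b x) + f x" if "x \<in> V" for x
    using ev[OF that] sum_grid[OF that, of f] by (simp add: T_def R_def C_def)
  have R: "R i = (s - 1) * T / (\<theta> + s - 1)" if i: "i < u" for i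
  proof -
    have "\<theta> * R i = (\<Sum>x | x \<in> V \<and> x div s = i. T - R i - C (b x) + f x)"
      unfolding R_def[of i] sum_distrib_left using eq by (intro sum.cong refl) (auto simp: R_def)
    also have "\<dots> = (\<Sum>x | x \<in> V \<and> x div s = i. T - R i - C (b x)) + R i"
      by (simp add: sum.distrib R_def)
    also have "(\<Sum>x | x \<in> V \<and> x div s = i. T - R i - C (b x)) = (\<Sum>j\<in>J. T - R i - C j)"
      by (rule sum_over_row[OF i])
    also have "\<dots> = s * (T - R i) - T" using sum_columns[of f]
      by (simp only: sum_subtractf sum_constant card_J C_def T_def) (simp add: algebra_simps)
    finally have "(\<theta> + s - 1) * R i = (s - 1) * T" using s_pos by (simp add: algebra_simps of_nat_diff)
    moreover have "\<theta> + s - 1 \<noteq> 0" using th by linarith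
    ultimately show ?thesis by (simp add: field_simps)
  qed
  have C: "C j = (u - 1) * T / (\<theta> + u - 1)" if j: "j \<in> J" for j
  proof -
    have "\<theta> * C j = (\<Sum>x | x \<in> V \<and> b x = j. T - R (x div s) - C j + f x)"
      unfolding C_def[of j] sum_distrib_left using eq by (intro sum.cong refl) (auto simp: C_def)
    also have "\<dots> = (\<Sum>x | x \<in> V \<and> b x = j. T - R (x div s) - C j) + C j"
      by (simp add: sum.distrib C_def)
    also have "(\<Sum>x | x \<in> V \<and> b x = j. T - R (x div s) - C j) = (\<Sum>i<u. T - R i - C j)"
      by (rule sum_over_column[OF j])
    also have "\<dots> = u * (T - C j) - T" using sum_rows[of f]
      by (simp only: sum_subtractf sum_constant card_lessThan R_def T_def) (simp add: algebra_simps)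
    finally have "(\<theta> + u - 1) * C j = (u - 1) * T" using u_ge by (simp add: algebra_simps of_nat_diff)
    moreover have "\<theta> + u - 1 \<noteq> 0" using th by linarith
    ultimately show ?thesis by (simp add: field_simps)
  qed
  have "(\<theta> - 1) * f x = T - R (x div s) - C (b x)" if "x \<in> V" for x using eq[OF that] by (simp add: algebra_simps)
  then have "(\<theta> - 1) * f x = (\<theta> - 1) * f y"
    using xy R[OF div_less] C[OF b_props(1)] by simp
  then show ?thesis using th by simp
qed

text \<open>Supplies a second element of the eigenvalue multiset, so that its entry 1 exists. The
  eigenvector depends only on the deleted block, with weights of sum 0.\<close>

lemma root_minus: "poly (char_poly (adjacency_mat V E)) (- real (u - 1)) = 0"
proof -
  have "2 \<le> card J" using card_J s_ge by simp
  then obtain B where "B \<subseteq> J" "card B = 2" by (meson obtain_subset_with_card_n)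
  then obtain j1 j2 where j: "j1 \<in> J" "j2 \<in> J" "j1 \<noteq> j2" by (auto simp: card_2_iff)
  define g where "g j = (if j = j1 then 1 else 0) - (if j = j2 then 1 else 0 :: real)" for j
  have sg: "(\<Sum>j\<in>J. g j) = 0" using j finJ by (simp add: g_def sum_subtractf)
  have row: "(\<Sum>y | y \<in> V \<and> y div s = i. g (b y)) = 0" if "i < u" for i
    using sum_over_row[OF that, of g] sg by simp
  have "(\<Sum>y\<in>V. real (adjacency E x y) * g (b y)) = - real (u - 1) * g (b x)" if x: "x \<in> V" for x
  proof -
    have "(\<Sum>y | y \<in> V \<and> b y = b x. g (b y)) = (\<Sum>y | y \<in> V \<and> b y = b x. (\<lambda>_. g (b x)) (y div s))"
      by (rule sum.cong) auto
    also have "\<dots> = u * g (b x)" using sum_over_column[OF b_props(1)[OF x], of "\<lambda>_. g (b x)"] by simp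
    finally have col: "(\<Sum>y | y \<in> V \<and> b y = b x. g (b y)) = u * g (b x)" .
    have tot: "(\<Sum>y\<in>V. g (b y)) = 0" using sum_rows[of "\<lambda>y. g (b y)"] row by simp
    have "(\<Sum>y\<in>V. real (adjacency E x y) * g (b y)) = 0 - 0 - u * g (b x) + g (b x)"
      using sum_grid[OF x, of "\<lambda>y. g (b y)"] unfolding row[OF div_less[OF x]] col tot .
    then show ?thesis using u_ge by (simp only:) (simp add: algebra_simps of_nat_diff)
  qed
  moreover have "\<exists>x\<in>V. g (b x) \<noteq> 0"
  proof -
    have "0 < u" using u_ge by simp
    then show ?thesis using meet(1,3)[of 0 j1] j(1,3)
      by (intro bexI[of _ "0 * s + a 0 j1"]) (simp_all add: g_def)
  qed
  ultimately show ?thesis unfolding root_char_poly_adjacency_iff[OF finV] by (intro exI[of _ "\<lambda>x. g (b x)"]) blast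
qed

text \<open>An eigenvalue above 1 has constant eigenvectors and hence is the degree. As the multiset
  counts algebraic multiplicities, the degree must also be a simple root of the characteristic
  polynomial.\<close>

lemma second_eigenvalue_le_1: "second_eigenvalue V E \<le> 1"
  unfolding second_eigenvalue_def
proof (rule nth_1_rev_sorted_le)
  let ?X = "eigenvalues_mset V E" and ?k = "real ((s - 1) * (u - 1))"
  have p0: "0 \<in> V" using u_ge s_ge by (simp add: V_def)
  have k: "?k \<in># ?X"
    unfolding eigenvalues_mset_iff[OF finV] root_char_poly_adjacency_iff[OF finV]
    by (rule exI[of _ "\<lambda>_. 1"]) (use p0 row_sum in auto)
  have m: "- real (u - 1) \<in># ?X" unfolding eigenvalues_mset_iff[OF finV] by (rule root_minus)
  have "0 < u - 1" using u_ge by simp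
  then have "- real (u - 1) < 0" by (simp only: neg_less_0_iff_less of_nat_0_less_iff)
  then have "?k \<noteq> - real (u - 1)" by (metis of_nat_0_le_iff not_less)
  then show "2 \<le> size ?X" by (rule two_le_size[OF k m])
  have only_k: "(1 < \<theta>) \<longrightarrow> (\<theta> = ?k)" if \<theta>: "\<theta> \<in># ?X" for \<theta>
  proof
    assume gt: "1 < \<theta>"
    obtain f where f0: "\<exists>x\<in>V. f x \<noteq> 0" and f1: "\<forall>x\<in>V. (\<Sum>y\<in>V. real (adjacency E x y) * f y) = \<theta> * f x"
      using \<theta> unfolding eigenvalues_mset_iff[OF finV] root_char_poly_adjacency_iff[OF finV] by (elim exE conjE)
    obtain x where x: "x \<in> V" "f x \<noteq> 0" using f0 by (elim bexE)
    note f = x bspec[OF f1]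
    have "f y = f x" if "y \<in> V" for y by (rule eigenvector_constant[OF f(3) gt that f(1)])
    then have "\<theta> * f x = (\<Sum>y\<in>V. real (adjacency E x y)) * f x" using f(3)[OF f(1)] by (simp add: sum_distrib_right)
    then show "\<theta> = ?k" using row_sum[OF f(1)] f(2) by simp
  qed
  have k1: "1 < ?k"
  proof -
    have "2 * 2 \<le> (s - 1) * (u - 1)" using s_ge u_ge by (intro mult_le_mono) auto
    then have "1 < (s - 1) * (u - 1)" by simp
    then show ?thesis using of_nat_less_iff[of 1 "(s - 1) * (u - 1)", where 'a = real] by (simp only: of_nat_1)
  qed
  have "{#\<theta> \<in># ?X. 1 < \<theta>#} = {#\<theta> \<in># ?X. \<theta> = ?k#}"
    by (rule filter_mset_cong) (use only_k k1 in blast)+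
  then have "size {#\<theta> \<in># ?X. 1 < \<theta>#} = count ?X ?k" by (simp add: filter_eq_replicate_mset)
  also have "\<dots> = order ?k (char_poly (adjacency_mat V E))"
    by (simp add: eigenvalues_mset_def char_poly_adjacency_nonzero[OF finV])
  also have "\<dots> \<le> 1"
  proof (rule order_char_poly_le_1)
    have l: "sorted_list_of_set V ! i = i" if "i < card V" for i
      using that by (simp add: V_def lessThan_atLeast0)
    have mem: "x \<in> V \<longleftrightarrow> x < card V" for x by (simp add: V_def)
    have sumV: "(\<Sum>y\<in>V. g y) = (\<Sum>y<card V. g y)" for g :: "nat \<Rightarrow> real" by (simp add: V_def)
    show A: "adjacency_mat V E \<in> carrier_mat (card V) (card V)" by (rule adjacency_mat_index(1)[OF finV])
    have ix: "adjacency_mat V E $$ (i, j) = adjacency E i j" if "i < card V" "j < card V" for i j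
      using adjacency_mat_index(2)[OF finV that] l that by simp
    have row: "(\<Sum>j<card V. adjacency_mat V E $$ (i, j) * w j) = (\<Sum>y\<in>V. real (adjacency E i y) * w y)"
      if "i < card V" for i w
      unfolding sumV using that ix by (intro sum.cong) auto
    show "(\<Sum>j<card V. adjacency_mat V E $$ (i, j)) = ?k" if "i < card V" for i
      using row[OF that, of "\<lambda>_. 1"] row_sum[of i] that mem by simp
    show "(\<Sum>i<card V. adjacency_mat V E $$ (i, j)) = ?k" if j: "j < card V" for j
    proof -
      have "(\<Sum>i<card V. adjacency_mat V E $$ (i, j)) = (\<Sum>i<card V. adjacency_mat V E $$ (j, i) * 1)"
        using j ix adjacency_eq col_sym[of _ j] by (intro sum.cong) simp_all
      then show ?thesis using row[OF j, of "\<lambda>_. 1"] row_sum[of j] j mem by simp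
    qed
    fix w :: "nat \<Rightarrow> real" and i
    assume w: "w 0 = 0" "\<And>i. i < card V \<Longrightarrow> (\<Sum>j<card V. adjacency_mat V E $$ (i, j) * w j) = ?k * w i" "i < card V"
    have "(\<Sum>y\<in>V. real (adjacency E x y) * w y) = ?k * w x" if "x \<in> V" for x
    proof -
      have "x < card V" using that mem by simp
      then show ?thesis using row[of x w] w(2)[of x] by simp
    qed
    then have "w i = w 0" by (rule eigenvector_constant[OF _ k1]) (use w(3) p0 mem in simp_all)
    then show "w i = 0" using w(1) by simp
  qed
  finally show "size {#\<theta> \<in># ?X. 1 < \<theta>#} \<le> 1" .
qed

end

section \<open>The maximum order\<close>

theorem theorem7p12:
  fixes u r :: nat
  assumes "u \<ge> 3"
    and "r \<ge> max (7 * u - 5) (u\<^sup>2 - 1)"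
  shows "h r u 1 \<le> ereal (real (u * (r + 1))) \<and>
    ((\<exists>(S :: 'b set) M. orthogonal_array (u + 1) (r + 1) S M) \<longrightarrow>
      h r u 1 = ereal (real (u * (r + 1))))"
proof -
  have "7 * u - 5 \<le> r" using assms(2) by simp
  then have r: "7 * u \<le> r + 5" by linarith
  have upper: "h r u 1 \<le> ereal (real (u * (r + 1)))"
    unfolding h_def
  proof (rule Sup_least, clarify)
    fix V :: "nat set" and E
    assume hyp: "hypergraph V E" "connected_hypergraph V E" "3 \<le> girth V E" "regular r V E" "uniform u E"
      and th: "second_eigenvalue V E \<le> 1"
    have fin: "finite V" and E: "\<And>e. e \<in> E \<Longrightarrow> e \<subseteq> V" using hyp(1) by (simp_all add: hypergraph_def)
    interpret linear_hypergraph V E r u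
    proof
      show "e = f" if "e \<in> E" "f \<in> E" "{x, y} \<subseteq> e" "{x, y} \<subseteq> f" "x \<noteq> y" for e f x y
        by (rule linear_if_girth[OF hyp(3) E that])
      show "e \<subseteq> V" if "e \<in> E" for e using E[OF that] .
      show "card e = u" if "e \<in> E" for e using hyp(5) that by (simp add: uniform_def)
      show "card {e\<in>E. x \<in> e} = r" if "x \<in> V" for x using hyp(4) that by (simp add: regular_def)
    qed (rule fin hyp(2))+
    show "ereal (real (card V)) \<le> ereal (real (u * (r + 1)))"
      using card_le[OF assms(1) r th] by (simp only: ereal_less_eq of_nat_le_iff)
  qed
  moreover have "h r u 1 = ereal (real (u * (r + 1)))" if "orthogonal_array (u + 1) (r + 1) S M" for S :: "'b set" and M
  proof (rule antisym[OF upper])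
    have S: "finite S" "card S = r + 1" and M: "M \<in> carrier_mat (u + 1) ((r + 1)\<^sup>2)" "elements_mat M \<subseteq> S"
      and ex1: "\<And>i i' c c'. i < u + 1 \<Longrightarrow> i' < u + 1 \<Longrightarrow> i \<noteq> i' \<Longrightarrow> c \<in> S \<Longrightarrow> c' \<in> S \<Longrightarrow>
        \<exists>!j. j < (r + 1)\<^sup>2 \<and> M $$ (i, j) = c \<and> M $$ (i', j) = c'"
      using that by (simp_all add: orthogonal_array_def)
    \<comment> \<open>The symbols are renamed 0, ..., r, so that points become numbers and the class
      with symbol 0 can be deleted.\<close>
    obtain g where g: "bij_betw g S {0..<r + 1}" using ex_bij_betw_finite_nat[OF S(1)] S(2) by auto
    have MS: "M $$ (i, j) \<in> S" if "i \<le> u" "j < (r + 1)\<^sup>2" for i j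
      using M that elements_matI[OF M(1), of i j] by auto
    interpret transversal_design "\<lambda>i j. g (M $$ (i, j))" u "r + 1"
    proof
      show "g (M $$ (i, j)) < r + 1" if "i \<le> u" "j < (r + 1)\<^sup>2" for i j
        using bij_betwE[OF g] MS[OF that] by auto
      show "\<exists>!j. j < (r + 1)\<^sup>2 \<and> g (M $$ (i, j)) = c \<and> g (M $$ (i', j)) = c'"
        if h: "i \<le> u" "i' \<le> u" "i \<noteq> i'" "c < r + 1" "c' < r + 1" for i i' c c'
      proof -
        have "c \<in> g ` S" "c' \<in> g ` S" using h g by (auto simp: bij_betw_def)
        then obtain p p' where p: "p \<in> S" "g p = c" "p' \<in> S" "g p' = c'" by blast
        have inj: "inj_on g S" using g by (simp add: bij_betw_def)
        have eq: "g (M $$ (i, j)) = c \<longleftrightarrow> M $$ (i, j) = p" "g (M $$ (i', j)) = c' \<longleftrightarrow> M $$ (i', j) = p'"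
          if "j < (r + 1)\<^sup>2" for j
          using inj_on_eq_iff[OF inj MS[OF h(1) that] p(1)] inj_on_eq_iff[OF inj MS[OF h(2) that] p(3)]
          by (simp_all only: p(2,4))
        have *: "j < (r + 1)\<^sup>2 \<and> g (M $$ (i, j)) = c \<and> g (M $$ (i', j)) = c' \<longleftrightarrow>
            j < (r + 1)\<^sup>2 \<and> M $$ (i, j) = p \<and> M $$ (i', j) = p'" for j
          by (intro conj_cong refl eq)
        show ?thesis unfolding * by (rule ex1) (use h(1-3) p(1,3) in simp_all)
      qed
      show "3 \<le> u" "3 \<le> r + 1" using assms(1) r by simp_all
    qed
    have "regular r V E" using degree by (simp add: regular_def)
    moreover have "uniform u E" using edges by (simp add: uniform_def)
    moreover have "hypergraph V E" using edges finV assms(1) by (simp add: hypergraph_def)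
    moreover have "card V = u * (r + 1)" by (simp only: V_def card_lessThan)
    moreover have "2 \<le> u * (r + 1)" using assms(1) by simp
    ultimately show "ereal (real (u * (r + 1))) \<le> h r u 1"
      unfolding h_def using connected girth_ge_3 second_eigenvalue_le_1
      by (intro Sup_upper CollectI exI[of _ V] exI[of _ E]) simp
  qed
  ultimately show ?thesis by blast
qed

end
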